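(* Let $H$ be a triangular quasi-Hopf algebra and $A$ any object in ${}^{H}\mathscr{A}^{\mathrm{com}}$. Then the ${}^{H}\mathscr{M}$-object $\mathrm{der}(A)$ of derivations, together with the internal commutator $[\cdot,\cdot]$ (restricted from $\mathrm{end}(A)$), is a Lie algebra in ${}^{H}\mathscr{M}$.
   Context: BASIC SETTING. $k$ is a commutative associative ring with unit. $H$ is a quasitriangular quasi-Hopf algebra over $k$, placed in degree $0$, with coproduct $\Delta(h)=h_{(1)}\otimes h_{(2)}$, counit $\epsilon$, invertible associator $\phi=\phi^{(1)}\otimes\phi^{(2)}\otimes\phi^{(3)}$ with inverse $\phi^{-1}=\phi^{(-1)}\otimes\phi^{(-2)}\otimes\phi^{(-3)}$, quasi-antipode $(S,\alpha,\beta)$ and universal $R$-matrix $R=R^{(1)}\otimes R^{(2)}$ (summations understood). $H$ is triangular if $R=R_{21}^{-1}$, $R_{21}=R^{(2)}\otimes R^{(1)}$. Conventions: $(\mathrm{id}\otimes\Delta)\Delta(h)=\phi\,(\Delta\otimes\mathrm{id})\Delta(h)\,\phi^{-1}$; $S(h_{(1)})\alpha h_{(2)}=\epsilon(h)\alpha$; $h_{(1)}\beta S(h_{(2)})=\epsilon(h)\beta$; $\phi^{(1)}\beta S(\phi^{(2)})\alpha\phi^{(3)}=1=S(\phi^{(-1)})\alpha\phi^{(-2)}\beta S(\phi^{(-3)})$; $\Delta^{\mathrm{op}}(h)=R\,\Delta(h)\,R^{-1}$; the remaining axioms (pentagon, counit normalization, hexagons) are the ones making the following a braided monoidal category. ${}^{H}\mathscr{M}$: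 objects are bounded $\mathbb{Z}$-graded left $H$-modules $V=\bigoplus_n V_n$ ($V_n=0$ for all but finitely many $n$; action $\triangleright$ degree-preserving); morphisms are degree-preserving $H$-equivariant $k$-linear maps. $V\otimes W$ is the graded tensor product over $k$ with $h\triangleright(v\otimes w)=(h_{(1)}\triangleright v)\otimes(h_{(2)}\triangleright w)$; unit $I=k$ (degree $0$, action by $\epsilon$); associator $\Phi((v\otimes w)\otimes x)=(\phi^{(1)}\triangleright v)\otimes((\phi^{(2)}\triangleright w)\otimes(\phi^{(3)}\triangleright x))$; braiding $\tau(v\otimes w)=(-1)^{|v||w|}(R^{(2)}\triangleright w)\otimes(R^{(1)}\triangleright v)$. Internal hom: $\hom(V,W)=\bigoplus_n\bigoplus_{l-m=n}\mathrm{Hom}_k(V_m,W_l)$ with $h\triangleright L=(h_{(1)}\triangleright\cdot)\circ L\circ(S(h_{(2)})\triangleright\cdot)$. Currying bijection: for $f:V\otimes W\to X$, $\zeta(f)(v)=f((\phi^{(-1)}\triangleright v)\otimes((\phi^{(-2)}\beta S(\phi^{(-3)}))\triangleright(\cdot)))$; inverse: for $g:V\to\hom(W,X)$, $\zeta^{-1}(g)(v\otimes w)=\phi^{(1)}\triangleright(g(v)((S(\phi^{(2)})\alpha\phi^{(3)})\triangleright w))$. Evaluation $\mathrm{ev}=\zeta^{-1}(\mathrm{id}):\hom(V,W)\otimes V\to W$; internal composition $\bullet=\zeta(\mathrm{ev}\circ(\mathrm{id}\otimes\mathrm{ev})\circ\Phi):\hom(W,X)\otimes\hom(V,W)\to\hom(V,X)$.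 $\mathrm{end}(V)=\hom(V,V)$, unit $1=(\beta\triangleright\cdot)$. Internal commutator on $\mathrm{end}(V)$: $[\cdot,\cdot]=\bullet-\bullet\circ\tau$, i.e. $[L,L']=L\bullet L'-(-1)^{|L||L'|}(R^{(2)}\triangleright L')\bullet(R^{(1)}\triangleright L)$. ALGEBRAS. An algebra in ${}^{H}\mathscr{M}$ is an object $A$ with ${}^{H}\mathscr{M}$-morphisms product $\mu:A\otimes A\to A$ and unit $I\to A$, with $(aa')a''=(\phi^{(1)}\triangleright a)((\phi^{(2)}\triangleright a')(\phi^{(3)}\triangleright a''))$ and $1a=a=a1$; it is braided commutative (an object of ${}^{H}\mathscr{A}^{\mathrm{com}}$) if $\mu\circ\tau=\mu$. Let $\hat l=\zeta(\mu):A\to\mathrm{end}(A)$ and $[L,a]:=[L,\hat l(a)]$ for $L\in\mathrm{end}(A)$, $a\in A$. DERIVATIONS. $\mathrm{der}(A)=\mathrm{Ker}\,\zeta([\cdot,\cdot]-\hat l\circ\mathrm{ev})\subseteq\mathrm{end}(A)$, where $[\cdot,\cdot]-\hat l\circ\mathrm{ev}:\mathrm{end}(A)\otimes A\to\mathrm{end}(A)$, $L\otimes a\mapsto[L,a]-\hat l(\mathrm{ev}(L\otimes a))$. LIE ALGEBRA in ${}^{H}\mathscr{M}$ ($H$ triangular): an object $\mathfrak{g}$ with an ${}^{H}\mathscr{M}$-morphism $[\cdot,\cdot]:\mathfrak{g}\otimes\mathfrak{g}\to\mathfrak{g}$ that is braided antisymmetric, $[\cdot,\cdot]=-[\cdot,\cdot]\circ\tau$,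 and satisfies the braided Jacobi identity $[\cdot,\cdot]\circ([\cdot,\cdot]\otimes\mathrm{id})\circ(\mathrm{id}+\tau\circ\Phi+\Phi^{-1}\circ\tau)=0$ on $(\mathfrak{g}\otimes\mathfrak{g})\otimes\mathfrak{g}$. *)

theory Defs
  imports Main "HOL-Library.Function_Algebras"
begin

text \<open>
  An element of the \<open>n\<close>-fold tensor power over \<open>k\<close> is given by a representing formal sum: a list
  of words of length \<open>n\<close>, the word \<open>[x\<^sub>1, \<dots>, x\<^sub>n]\<close> standing for the pure tensor
  \<open>x\<^sub>1 \<otimes> \<dots> \<otimes> x\<^sub>n\<close> and the list for the sum of its entries.  Two formal sums represent the same
  tensor iff they are related by the congruence below, so the tensor power is the quotient of the
  free commutative monoid on words of length \<open>n\<close>.  (By \<open>zero\<close> and \<open>add\<close> the quotient is a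
  group, \<open>-x\<^sub>1 \<otimes> \<dots>\<close> being the inverse of \<open>x\<^sub>1 \<otimes> \<dots>\<close>.)  The class sort
  \<open>{comm_ring, monoid_mult}\<close> is that of commutative rings with unit, the zero ring included.
\<close>

inductive teq :: "('k \<Rightarrow> 'h \<Rightarrow> 'h) \<Rightarrow> 'h::ab_group_add list list \<Rightarrow> 'h list list \<Rightarrow> bool"
  for s :: "'k \<Rightarrow> 'h \<Rightarrow> 'h"
where
  refl: "teq s X X"
| sym: "teq s X Y \<Longrightarrow> teq s Y X"
| trans: "teq s X Y \<Longrightarrow> teq s Y Z \<Longrightarrow> teq s X Z"
| append: "teq s X X' \<Longrightarrow> teq s Y Y' \<Longrightarrow> teq s (X @ Y) (X' @ Y')"
| comm: "teq s (X @ Y) (Y @ X)"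
| zero: "teq s [u @ [0] @ v] []"
| add: "teq s [u @ [x + y] @ v] [u @ [x] @ v, u @ [y] @ v]"
| scale: "teq s [u @ [s c x] @ v @ [y] @ w] [u @ [x] @ v @ [s c y] @ w]"

definition tmult :: "'h::times list list \<Rightarrow> 'h list list \<Rightarrow> 'h list list" (infixl "\<odot>" 70)
  where "X \<odot> Y = [map2 (*) u v. u \<leftarrow> X, v \<leftarrow> Y]"

text \<open>
  \<open>k\<close> and \<open>H\<close> are (all of) the types \<open>'k\<close> and \<open>'h\<close>.  The coproduct, the associator, its inverse
  and the \<open>R\<close>-matrix are given by representing formal sums.
\<close>

record ('k, 'h) qhopf =
  hsmul :: "'k \<Rightarrow> 'h \<Rightarrow> 'h"
  cop :: "'h \<Rightarrow> ('h \<times> 'h) list"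
  cou :: "'h \<Rightarrow> 'k"
  phi :: "('h \<times> 'h \<times> 'h) list"
  phi_inv :: "('h \<times> 'h \<times> 'h) list"
  antip :: "'h \<Rightarrow> 'h"
  alp :: 'h
  bet :: 'h
  Rm :: "('h \<times> 'h) list"

definition k_algebra ::
  "('k::{comm_ring,monoid_mult} \<Rightarrow> 'h::{ring,monoid_mult} \<Rightarrow> 'h) \<Rightarrow> bool"
where
  "k_algebra s \<longleftrightarrow>
     (\<forall>c x y. s c (x + y) = s c x + s c y) \<and>
     (\<forall>c d x. s (c + d) x = s c x + s d x) \<and>
     (\<forall>c d x. s (c * d) x = s c (s d x)) \<and>
     (\<forall>x. s 1 x = x) \<and>
     (\<forall>c x y. s c (x * y) = s c x * y \<and> s c (x * y) = x * s c y)"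

definition quasi_bialgebra ::
  "('k::{comm_ring,monoid_mult}, 'h::{ring,monoid_mult}) qhopf \<Rightarrow> bool"
where
  "quasi_bialgebra H \<longleftrightarrow>
    (let s = hsmul H; teqH = teq s;
         P = [[x, y, z]. (x, y, z) \<leftarrow> phi H];
         P' = [[x, y, z]. (x, y, z) \<leftarrow> phi_inv H];
         D = (\<lambda>h. [[a, b]. (a, b) \<leftarrow> cop H h])
     in
     k_algebra s \<and>
     (\<forall>g h. teqH (D (g + h)) (D g @ D h)) \<and>
     (\<forall>c h. teqH (D (s c h)) [[s c a, b]. (a, b) \<leftarrow> cop H h]) \<and>
     (\<forall>g h. teqH (D (g * h)) (D g \<odot> D h)) \<and>
     teqH (D 1) [[1, 1]] \<and>
     (\<forall>g h. cou H (g + h) = cou H g + cou H h) \<and>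
     (\<forall>c h. cou H (s c h) = c * cou H h) \<and>
     (\<forall>g h. cou H (g * h) = cou H g * cou H h) \<and>
     cou H 1 = 1 \<and>
     (\<forall>h. (\<Sum>(a, b)\<leftarrow>cop H h. s (cou H a) b) = h \<and> (\<Sum>(a, b)\<leftarrow>cop H h. s (cou H b) a) = h) \<and>
     teqH (P \<odot> P') [[1, 1, 1]] \<and>
     teqH (P' \<odot> P) [[1, 1, 1]] \<and>
     (\<forall>h. teqH [[a, b1, b2]. (a, b) \<leftarrow> cop H h, (b1, b2) \<leftarrow> cop H b]
           (P \<odot> [[a1, a2, b]. (a, b) \<leftarrow> cop H h, (a1, a2) \<leftarrow> cop H a] \<odot> P')) \<and>
     \<comment> \<open>pentagon\<close>
     teqH ([[x, y, z1, z2]. (x, y, z) \<leftarrow> phi H, (z1, z2) \<leftarrow> cop H z] \<odot>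
           [[x1, x2, y, z]. (x, y, z) \<leftarrow> phi H, (x1, x2) \<leftarrow> cop H x])
          ([[1, x, y, z]. (x, y, z) \<leftarrow> phi H] \<odot>
           [[x, y1, y2, z]. (x, y, z) \<leftarrow> phi H, (y1, y2) \<leftarrow> cop H y] \<odot>
           [[x, y, z, 1]. (x, y, z) \<leftarrow> phi H]) \<and>
     \<comment> \<open>counit normalization of the associator (triangle)\<close>
     teqH [[s (cou H y) x, z]. (x, y, z) \<leftarrow> phi H] [[1, 1]])"

definition quasi_hopf_algebra ::
  "('k::{comm_ring,monoid_mult}, 'h::{ring,monoid_mult}) qhopf \<Rightarrow> bool"
where
  "quasi_hopf_algebra H \<longleftrightarrow>
    (let s = hsmul H; S = antip H; \<alpha> = alp H; \<beta> = bet H in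
     quasi_bialgebra H \<and>
     \<comment> \<open>the antipode is a \<open>k\<close>-algebra anti-automorphism\<close>
     bij S \<and>
     (\<forall>g h. S (g + h) = S g + S h) \<and>
     (\<forall>c h. S (s c h) = s c (S h)) \<and>
     (\<forall>g h. S (g * h) = S h * S g) \<and>
     S 1 = 1 \<and>
     (\<forall>h. (\<Sum>(a, b)\<leftarrow>cop H h. S a * \<alpha> * b) = s (cou H h) \<alpha>) \<and>
     (\<forall>h. (\<Sum>(a, b)\<leftarrow>cop H h. a * \<beta> * S b) = s (cou H h) \<beta>) \<and>
     (\<Sum>(x, y, z)\<leftarrow>phi H. x * \<beta> * S y * \<alpha> * z) = 1 \<and>
     (\<Sum>(x, y, z)\<leftarrow>phi_inv H. S x * \<alpha> * y * \<beta> * S z) = 1)"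

text \<open>
  The hexagons below express, for the braiding \<open>v \<otimes> w \<mapsto> R\<^sup>(\<^sup>2\<^sup>) w \<otimes> R\<^sup>(\<^sup>1\<^sup>) v\<close>, the two
  hexagon identities of a braided monoidal category:
  \<open>(id \<otimes> \<Delta>) R = \<phi>\<^sub>2\<^sub>3\<^sub>1\<^sup>-\<^sup>1 R\<^sub>1\<^sub>3 \<phi>\<^sub>2\<^sub>1\<^sub>3 R\<^sub>1\<^sub>2 \<phi>\<^sup>-\<^sup>1\<close> and
  \<open>(\<Delta> \<otimes> id) R = \<phi>\<^sub>3\<^sub>1\<^sub>2 R\<^sub>1\<^sub>3 \<phi>\<^sub>1\<^sub>3\<^sub>2\<^sup>-\<^sup>1 R\<^sub>2\<^sub>3 \<phi>\<close>,
  where in \<open>\<phi>\<^sub>i\<^sub>j\<^sub>k\<close> the three legs of \<open>\<phi>\<close> are put in the positions \<open>i\<close>, \<open>j\<close>, \<open>k\<close>.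
\<close>

definition quasitriangular ::
  "('k::{comm_ring,monoid_mult}, 'h::{ring,monoid_mult}) qhopf \<Rightarrow> bool"
where
  "quasitriangular H \<longleftrightarrow>
    (let teqH = teq (hsmul H);
         R = [[a, b]. (a, b) \<leftarrow> Rm H];
         R12 = [[a, b, 1]. (a, b) \<leftarrow> Rm H];
         R13 = [[a, 1, b]. (a, b) \<leftarrow> Rm H];
         R23 = [[1, a, b]. (a, b) \<leftarrow> Rm H]
     in
     quasi_hopf_algebra H \<and>
     (\<exists>R'. (\<forall>u\<in>set R'. length u = 2) \<and>
           teqH (R \<odot> R') [[1, 1]] \<and> teqH (R' \<odot> R) [[1, 1]] \<and>
           (\<forall>h. teqH [[b, a]. (a, b) \<leftarrow> cop H h] (R \<odot> [[a, b]. (a, b) \<leftarrow> cop H h] \<odot> R'))) \<and>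
     teqH [[a, b1, b2]. (a, b) \<leftarrow> Rm H, (b1, b2) \<leftarrow> cop H b]
       ([[z, x, y]. (x, y, z) \<leftarrow> phi_inv H] \<odot> R13 \<odot>
        [[y, x, z]. (x, y, z) \<leftarrow> phi H] \<odot> R12 \<odot>
        [[x, y, z]. (x, y, z) \<leftarrow> phi_inv H]) \<and>
     teqH [[a1, a2, b]. (a, b) \<leftarrow> Rm H, (a1, a2) \<leftarrow> cop H a]
       ([[y, z, x]. (x, y, z) \<leftarrow> phi H] \<odot> R13 \<odot>
        [[x, z, y]. (x, y, z) \<leftarrow> phi_inv H] \<odot> R23 \<odot>
        [[x, y, z]. (x, y, z) \<leftarrow> phi H]))"

definition triangular ::
  "('k::{comm_ring,monoid_mult}, 'h::{ring,monoid_mult}) qhopf \<Rightarrow> bool"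
where
  "triangular H \<longleftrightarrow>
    (let R = [[a, b]. (a, b) \<leftarrow> Rm H]; R21 = [[b, a]. (a, b) \<leftarrow> Rm H] in
     quasitriangular H \<and>
     teq (hsmul H) (R \<odot> R21) [[1, 1]] \<and> teq (hsmul H) (R21 \<odot> R) [[1, 1]])"

text \<open>
  An object lives inside an ambient abelian group type; its underlying \<open>k\<close>-module is \<open>carr V\<close>,
  the internal direct sum of the homogeneous components \<open>grade V n\<close>.  Scalar multiplication and
  action are only meaningful on \<open>carr V\<close>.
\<close>

record ('k, 'h, 'v) gmod =
  grade :: "int \<Rightarrow> 'v set"
  smul :: "'k \<Rightarrow> 'v \<Rightarrow> 'v"
  act :: "'h \<Rightarrow> 'v \<Rightarrow> 'v"

definition degs :: "('k, 'h, 'v::ab_group_add, 'm) gmod_scheme \<Rightarrow> int set"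
  where "degs V = {n. grade V n \<noteq> {0}}"

definition carr :: "('k, 'h, 'v::ab_group_add, 'm) gmod_scheme \<Rightarrow> 'v set"
  where "carr V = {(\<Sum>n\<in>degs V. x n) |x. \<forall>n. x n \<in> grade V n}"

definition hcomp :: "('k, 'h, 'v::ab_group_add, 'm) gmod_scheme \<Rightarrow> int \<Rightarrow> 'v \<Rightarrow> 'v"
  where "hcomp V n v = (THE x. (\<forall>n. x n \<in> grade V n) \<and> v = (\<Sum>n\<in>degs V. x n)) n"

definition HM_object ::
  "('k::{comm_ring,monoid_mult}, 'h::{ring,monoid_mult}) qhopf \<Rightarrow>
   ('k, 'h, 'v::ab_group_add, 'm) gmod_scheme \<Rightarrow> bool"
where
  "HM_object H V \<longleftrightarrow>
     finite (degs V) \<and>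
     (\<forall>n. 0 \<in> grade V n) \<and>
     (\<forall>n. \<forall>v\<in>grade V n. \<forall>w\<in>grade V n. v + w \<in> grade V n) \<and>
     (\<forall>n c. \<forall>v\<in>grade V n. smul V c v \<in> grade V n) \<and>
     (\<forall>n h. \<forall>v\<in>grade V n. act V h v \<in> grade V n) \<and>
     (\<forall>x. (\<forall>n. x n \<in> grade V n) \<and> (\<Sum>n\<in>degs V. x n) = 0 \<longrightarrow> (\<forall>n. x n = 0)) \<and>
     (\<forall>c. \<forall>v\<in>carr V. \<forall>w\<in>carr V. smul V c (v + w) = smul V c v + smul V c w) \<and>
     (\<forall>c d. \<forall>v\<in>carr V. smul V (c + d) v = smul V c v + smul V d v) \<and>
     (\<forall>c d. \<forall>v\<in>carr V. smul V (c * d) v = smul V c (smul V d v)) \<and>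
     (\<forall>v\<in>carr V. smul V 1 v = v) \<and>
     (\<forall>h. \<forall>v\<in>carr V. \<forall>w\<in>carr V. act V h (v + w) = act V h v + act V h w) \<and>
     (\<forall>g h. \<forall>v\<in>carr V. act V (g + h) v = act V g v + act V h v) \<and>
     (\<forall>g h. \<forall>v\<in>carr V. act V (g * h) v = act V g (act V h v)) \<and>
     (\<forall>v\<in>carr V. act V 1 v = v) \<and>
     (\<forall>c h. \<forall>v\<in>carr V. act V (hsmul H c h) v = smul V c (act V h v) \<and>
                       act V h (smul V c v) = smul V c (act V h v))"

definition unit_object ::
  "('k::{comm_ring,monoid_mult}, 'h) qhopf \<Rightarrow> ('k, 'h, 'k) gmod"
where
  "unit_object H =
     \<lparr> grade = (\<lambda>n. if n = 0 then UNIV else {0}), smul = (*), act = (\<lambda>h c. cou H h * c) \<rparr>"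

definition klinear ::
  "('k, 'h, 'v::ab_group_add, 'm) gmod_scheme \<Rightarrow> ('k, 'h, 'w::ab_group_add, 'n) gmod_scheme \<Rightarrow>
   ('v \<Rightarrow> 'w) \<Rightarrow> bool"
where
  "klinear V W f \<longleftrightarrow>
     (\<forall>v\<in>carr V. f v \<in> carr W) \<and>
     (\<forall>v\<in>carr V. \<forall>v'\<in>carr V. f (v + v') = f v + f v') \<and>
     (\<forall>c. \<forall>v\<in>carr V. f (smul V c v) = smul W c (f v))"

definition HM_morphism ::
  "('k, 'h, 'v::ab_group_add, 'm) gmod_scheme \<Rightarrow> ('k, 'h, 'w::ab_group_add, 'n) gmod_scheme \<Rightarrow>
   ('v \<Rightarrow> 'w) \<Rightarrow> bool"
where
  "HM_morphism V W f \<longleftrightarrow>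
     klinear V W f \<and>
     (\<forall>n. \<forall>v\<in>grade V n. f v \<in> grade W n) \<and>
     (\<forall>h. \<forall>v\<in>carr V. f (act V h v) = act W h (f v))"

text \<open>
  A linear map \<open>V \<otimes> W \<rightarrow> X\<close> is given by its values \<open>f v w\<close> on pure tensors, i.e. by a
  \<open>k\<close>-bilinear map.  The degree and equivariance conditions refer to the total degree on
  \<open>V \<otimes> W\<close> and to \<open>h \<triangleright> (v \<otimes> w) = (h\<^sub>(\<^sub>1\<^sub>) \<triangleright> v) \<otimes> (h\<^sub>(\<^sub>2\<^sub>) \<triangleright> w)\<close>.
\<close>

definition HM_morphism2 ::
  "('k, 'h) qhopf \<Rightarrow> ('k, 'h, 'v::ab_group_add, 'm) gmod_scheme \<Rightarrow>
   ('k, 'h, 'w::ab_group_add, 'n) gmod_scheme \<Rightarrow> ('k, 'h, 'x::ab_group_add, 'p) gmod_scheme \<Rightarrow>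
   ('v \<Rightarrow> 'w \<Rightarrow> 'x) \<Rightarrow> bool"
where
  "HM_morphism2 H V W X f \<longleftrightarrow>
     (\<forall>v\<in>carr V. klinear W X (\<lambda>w. f v w)) \<and>
     (\<forall>w\<in>carr W. klinear V X (\<lambda>v. f v w)) \<and>
     (\<forall>m n. \<forall>v\<in>grade V m. \<forall>w\<in>grade W n. f v w \<in> grade X (m + n)) \<and>
     (\<forall>h. \<forall>v\<in>carr V. \<forall>w\<in>carr W.
        (\<Sum>(a, b)\<leftarrow>cop H h. f (act V a v) (act W b w)) = act X h (f v w))"

definition ksign :: "int \<Rightarrow> 'v::ab_group_add \<Rightarrow> 'v"
  where "ksign n v = (if even n then v else - v)"

text \<open>The composite \<open>f \<circ> \<tau> : V \<otimes> W \<rightarrow> X\<close> of \<open>f : W \<otimes> V \<rightarrow> X\<close> with the braiding.\<close>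

definition comp_braid ::
  "('k, 'h) qhopf \<Rightarrow> ('k, 'h, 'v::ab_group_add, 'm) gmod_scheme \<Rightarrow>
   ('k, 'h, 'w::ab_group_add, 'n) gmod_scheme \<Rightarrow>
   ('w \<Rightarrow> 'v \<Rightarrow> 'x::ab_group_add) \<Rightarrow> 'v \<Rightarrow> 'w \<Rightarrow> 'x"
where
  "comp_braid H V W f v w =
     (\<Sum>m\<in>degs V. \<Sum>n\<in>degs W. ksign (m * n)
        (\<Sum>(r1, r2)\<leftarrow>Rm H. f (act W r2 (hcomp W n w)) (act V r1 (hcomp V m v))))"

text \<open>Maps defined on \<open>carr V\<close> are represented by functions vanishing outside \<open>carr V\<close>.\<close>

definition on_carr :: "('k, 'h, 'v::ab_group_add, 'm) gmod_scheme \<Rightarrow> ('v \<Rightarrow> 'w::zero) \<Rightarrow> 'v \<Rightarrow> 'w"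
  where "on_carr V f = (\<lambda>v. if v \<in> carr V then f v else 0)"

definition ihom ::
  "('k, 'h) qhopf \<Rightarrow> ('k, 'h, 'v::ab_group_add, 'm) gmod_scheme \<Rightarrow>
   ('k, 'h, 'w::ab_group_add, 'n) gmod_scheme \<Rightarrow> ('k, 'h, 'v \<Rightarrow> 'w) gmod"
where
  "ihom H V W =
     \<lparr> grade = (\<lambda>n. {L. klinear V W L \<and> (\<forall>v. v \<notin> carr V \<longrightarrow> L v = 0) \<and>
                         (\<forall>m. \<forall>v\<in>grade V m. L v \<in> grade W (m + n))}),
       smul = (\<lambda>c L. on_carr V (\<lambda>v. smul W c (L v))),
       act = (\<lambda>h L. on_carr V (\<lambda>v. \<Sum>(a, b)\<leftarrow>cop H h. act W a (L (act V (antip H b) v)))) \<rparr>"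

abbreviation iend where "iend H V \<equiv> ihom H V V"

definition curry_map ::
  "('k, 'h::times) qhopf \<Rightarrow> ('k, 'h, 'v::ab_group_add, 'm) gmod_scheme \<Rightarrow>
   ('k, 'h, 'w::ab_group_add, 'n) gmod_scheme \<Rightarrow>
   ('v \<Rightarrow> 'w \<Rightarrow> 'x::ab_group_add) \<Rightarrow> 'v \<Rightarrow> 'w \<Rightarrow> 'x"
where
  "curry_map H V W f v = on_carr W (\<lambda>w.
     \<Sum>(x, y, z)\<leftarrow>phi_inv H. f (act V x v) (act W (y * bet H * antip H z) w))"

text \<open>
  The same bijection \<open>\<zeta>\<close> for \<open>f : (V \<otimes> V') \<otimes> W \<rightarrow> X\<close>, where \<open>f v v' w\<close> is the value on
  \<open>(v \<otimes> v') \<otimes> w\<close>, and \<open>\<zeta>(f)\<close> is again given by its values on pure tensors.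
\<close>

definition curry_map2 ::
  "('k, 'h::times) qhopf \<Rightarrow> ('k, 'h, 'v::ab_group_add, 'm) gmod_scheme \<Rightarrow>
   ('k, 'h, 'u::ab_group_add, 'p) gmod_scheme \<Rightarrow> ('k, 'h, 'w::ab_group_add, 'n) gmod_scheme \<Rightarrow>
   ('v \<Rightarrow> 'u \<Rightarrow> 'w \<Rightarrow> 'x::ab_group_add) \<Rightarrow> 'v \<Rightarrow> 'u \<Rightarrow> 'w \<Rightarrow> 'x"
where
  "curry_map2 H V V' W f v v' = on_carr W (\<lambda>w.
     \<Sum>(x, y, z)\<leftarrow>phi_inv H. \<Sum>(x1, x2)\<leftarrow>cop H x.
       f (act V x1 v) (act V' x2 v') (act W (y * bet H * antip H z) w))"

definition uncurry_map ::
  "('k, 'h::times) qhopf \<Rightarrow> ('k, 'h, 'w::ab_group_add, 'n) gmod_scheme \<Rightarrow>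
   ('k, 'h, 'x::ab_group_add, 'p) gmod_scheme \<Rightarrow> ('v \<Rightarrow> 'w \<Rightarrow> 'x) \<Rightarrow> 'v \<Rightarrow> 'w \<Rightarrow> 'x"
where
  "uncurry_map H W X g v w =
     (\<Sum>(x, y, z)\<leftarrow>phi H. act X x (g v (act W (antip H y * alp H * z) w)))"

definition ev ::
  "('k, 'h::times) qhopf \<Rightarrow> ('k, 'h, 'v::ab_group_add, 'm) gmod_scheme \<Rightarrow>
   ('k, 'h, 'w::ab_group_add, 'n) gmod_scheme \<Rightarrow> ('v \<Rightarrow> 'w) \<Rightarrow> 'v \<Rightarrow> 'w"
where
  "ev H V W = uncurry_map H V W (\<lambda>L. L)"

definition icomp ::
  "('k, 'h::times) qhopf \<Rightarrow> ('k, 'h, 'v::ab_group_add, 'm) gmod_scheme \<Rightarrow>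
   ('k, 'h, 'w::ab_group_add, 'n) gmod_scheme \<Rightarrow> ('k, 'h, 'x::ab_group_add, 'p) gmod_scheme \<Rightarrow>
   ('w \<Rightarrow> 'x) \<Rightarrow> ('v \<Rightarrow> 'w) \<Rightarrow> 'v \<Rightarrow> 'x"
where
  "icomp H V W X = curry_map2 H (ihom H W X) (ihom H V W) V
     (\<lambda>L L' v. \<Sum>(x, y, z)\<leftarrow>phi H.
        ev H W X (act (ihom H W X) x L) (ev H V W (act (ihom H V W) y L') (act V z v)))"

definition icommutator ::
  "('k, 'h::times) qhopf \<Rightarrow> ('k, 'h, 'v::ab_group_add, 'm) gmod_scheme \<Rightarrow>
   ('v \<Rightarrow> 'v) \<Rightarrow> ('v \<Rightarrow> 'v) \<Rightarrow> 'v \<Rightarrow> 'v"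
where
  "icommutator H V L L' =
     icomp H V V V L L' - comp_braid H (iend H V) (iend H V) (icomp H V V V) L L'"

record ('k, 'h, 'a) galg = "('k, 'h, 'a) gmod" +
  mu :: "'a \<Rightarrow> 'a \<Rightarrow> 'a"
  unit_map :: "'k \<Rightarrow> 'a"

definition HM_algebra ::
  "('k::{comm_ring,monoid_mult}, 'h::{ring,monoid_mult}) qhopf \<Rightarrow>
   ('k, 'h, 'a::ab_group_add) galg \<Rightarrow> bool"
where
  "HM_algebra H A \<longleftrightarrow>
     HM_object H A \<and>
     HM_morphism2 H A A A (mu A) \<and>
     HM_morphism (unit_object H) A (unit_map A) \<and>
     (\<forall>a\<in>carr A. \<forall>b\<in>carr A. \<forall>c\<in>carr A.
        mu A (mu A a b) c =
        (\<Sum>(x, y, z)\<leftarrow>phi H. mu A (act A x a) (mu A (act A y b) (act A z c)))) \<and>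
     (\<forall>a\<in>carr A. mu A (unit_map A 1) a = a \<and> mu A a (unit_map A 1) = a)"

definition braided_commutative_algebra ::
  "('k::{comm_ring,monoid_mult}, 'h::{ring,monoid_mult}) qhopf \<Rightarrow>
   ('k, 'h, 'a::ab_group_add) galg \<Rightarrow> bool"
where
  "braided_commutative_algebra H A \<longleftrightarrow>
     HM_algebra H A \<and>
     (\<forall>a\<in>carr A. \<forall>b\<in>carr A. comp_braid H A A (mu A) a b = mu A a b)"

definition lhat ::
  "('k, 'h::times) qhopf \<Rightarrow> ('k, 'h, 'a::ab_group_add) galg \<Rightarrow> 'a \<Rightarrow> 'a \<Rightarrow> 'a"
  where "lhat H A = curry_map H A A (mu A)"

text \<open>The kernel, in the category of graded modules, of a map defined on \<open>V\<close>.\<close>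

definition ker_object ::
  "('k, 'h, 'v) gmod \<Rightarrow> ('v \<Rightarrow> 'w::zero) \<Rightarrow> ('k, 'h, 'v) gmod"
  where "ker_object V f = V\<lparr> grade := (\<lambda>n. {v \<in> grade V n. f v = 0}) \<rparr>"

definition der ::
  "('k, 'h::times) qhopf \<Rightarrow> ('k, 'h, 'a::ab_group_add) galg \<Rightarrow> ('k, 'h, 'a \<Rightarrow> 'a) gmod"
where
  "der H A = ker_object (iend H A)
     (curry_map H (iend H A) A
        (\<lambda>L a. icommutator H A L (lhat H A a) - lhat H A (ev H A A L a)))"

text \<open>
  The Jacobi identity is an equality of linear maps on \<open>(g \<otimes> g) \<otimes> g\<close>, stated on the generators
  \<open>(a \<otimes> b) \<otimes> c\<close> with \<open>a\<close>, \<open>b\<close>, \<open>c\<close> homogeneous.  The second and third summands are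
  \<open>[[\<cdot>, \<cdot>], \<cdot>]\<close> applied to
  \<open>\<tau> (\<Phi> ((a \<otimes> b) \<otimes> c)) = (-1)\<^bsup>|a| (|b| + |c|)\<^esup>
     (R\<^sup>(\<^sup>2\<^sup>) \<triangleright> (\<phi>\<^sup>(\<^sup>2\<^sup>) \<triangleright> b \<otimes> \<phi>\<^sup>(\<^sup>3\<^sup>) \<triangleright> c)) \<otimes> (R\<^sup>(\<^sup>1\<^sup>) \<triangleright> \<phi>\<^sup>(\<^sup>1\<^sup>) \<triangleright> a)\<close> and to
  \<open>\<Phi>\<^sup>-\<^sup>1 (\<tau> ((a \<otimes> b) \<otimes> c)) = (-1)\<^bsup>(|a| + |b|) |c|\<^esup>
     \<Phi>\<^sup>-\<^sup>1 ((R\<^sup>(\<^sup>2\<^sup>) \<triangleright> c) \<otimes> (R\<^sup>(\<^sup>1\<^sup>) \<triangleright> (a \<otimes> b)))\<close>.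
\<close>

definition lie_algebra ::
  "('k::{comm_ring,monoid_mult}, 'h::{ring,monoid_mult}) qhopf \<Rightarrow>
   ('k, 'h, 'g::ab_group_add) gmod \<Rightarrow> ('g \<Rightarrow> 'g \<Rightarrow> 'g) \<Rightarrow> bool"
where
  "lie_algebra H G br \<longleftrightarrow>
     HM_object H G \<and>
     HM_morphism2 H G G G br \<and>
     (\<forall>a\<in>carr G. \<forall>b\<in>carr G. br a b = - comp_braid H G G br a b) \<and>
     (\<forall>l m n. \<forall>a\<in>grade G l. \<forall>b\<in>grade G m. \<forall>c\<in>grade G n.
        br (br a b) c
        + ksign (l * (m + n))
            (\<Sum>(x, y, z)\<leftarrow>phi H. \<Sum>(r1, r2)\<leftarrow>Rm H. \<Sum>(s, t)\<leftarrow>cop H r2.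
               br (br (act G s (act G y b)) (act G t (act G z c))) (act G r1 (act G x a)))
        + ksign ((l + m) * n)
            (\<Sum>(r1, r2)\<leftarrow>Rm H. \<Sum>(s, t)\<leftarrow>cop H r1. \<Sum>(x, y, z)\<leftarrow>phi_inv H.
               br (br (act G x (act G r2 c)) (act G y (act G s a))) (act G z (act G t b)))
        = 0)"

end

theory Submission
  imports Defs
begin

text \<open>
  Every identity between maps into an internal hom is tested after evaluation: \<open>\<zeta>\<close> is a bijection
  (the two zigzag identities below, which come from the pentagon and the antipode axioms), so the
  antipode never appears again once \<open>ev\<close> and \<open>\<zeta>\<close> are known to be mutually inverse.  In this way
  \<open>end(A)\<close> becomes an associative algebra in the braided category.  The braided Jacobi identity of its
  commutator, and the Leibniz form \<open>[[L, M], N] = [L, [M, N]] - [M, [L, N]] \<circ> \<tau>\<close> of it, are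
  identities in the group ring of the symmetric group on three letters, which acts on trilinear maps by
  the braiding because of the hexagons and \<open>R\<^sub>2\<^sub>1 R = 1\<close>.  Finally \<open>L\<close> is a derivation iff
  \<open>[h L, a] = \<zeta>(\<mu>)(ev(h L \<otimes> a))\<close> for all \<open>h\<close> and \<open>a\<close>, and the Leibniz form shows that this condition is
  stable under the commutator.
\<close>

section \<open>Graded modules\<close>

text \<open>The criterion for derivations ranges over all h for this reason: \<open>ev\<close> at L
  contains \<alpha>, which is not assumed invertible, so the map ev(L \<otimes> -) need not
  determine L. The family of maps ev(p \<triangleright> L \<otimes> -), with p running through H,
  does determine L, and it is what \<zeta> turns back into L. Tensors are classes of formal sums,
  and an axiom between them is applied by evaluating both representatives on a multilinear function
  of the legs, the rest of the expression being that function. Hence the linearity side conditions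
  that accompany almost every rewriting. Koszul signs make sense only for homogeneous arguments,
  whereas composing permutations calls for maps on whole carriers. The permutations therefore act
  without signs, and the signs return as factors 1 or -1 that depend only on the parities of the
  degrees.\<close>

locale qhopf_modules =
  fixes H :: "('k::{comm_ring,monoid_mult}, 'h::{ring,monoid_mult}) qhopf"
begin

context
  fixes V :: "('k, 'h, 'v::ab_group_add, 'm) gmod_scheme"
  assumes V: "HM_object H V"
begin

lemma finite_degs [simp]: "finite (degs V)"
  and zero_in_grade [simp]: "0 \<in> grade V n"
  and add_in_grade [simp]: "v \<in> grade V n \<Longrightarrow> w \<in> grade V n \<Longrightarrow> v + w \<in> grade V n"
  and smul_in_grade [simp]: "v \<in> grade V n \<Longrightarrow> smul V c v \<in> grade V n"
  and act_in_grade [simp]: "v \<in> grade V n \<Longrightarrow> act V h v \<in> grade V n"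
  and grade_direct: "(\<And>n. x n \<in> grade V n) \<Longrightarrow> (\<Sum>n\<in>degs V. x n) = 0 \<Longrightarrow> x n = 0"
  and smul_add [simp]: "v \<in> carr V \<Longrightarrow> w \<in> carr V \<Longrightarrow> smul V c (v + w) = smul V c v + smul V c w"
  and smul_add_left: "v \<in> carr V \<Longrightarrow> smul V (c + d) v = smul V c v + smul V d v"
  and smul_mult: "v \<in> carr V \<Longrightarrow> smul V (c * d) v = smul V c (smul V d v)"
  and smul_one [simp]: "v \<in> carr V \<Longrightarrow> smul V 1 v = v"
  and act_add [simp]: "v \<in> carr V \<Longrightarrow> w \<in> carr V \<Longrightarrow> act V h (v + w) = act V h v + act V h w"
  and act_add_left: "v \<in> carr V \<Longrightarrow> act V (g + h) v = act V g v + act V h v"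
  and act_mult [simp]: "v \<in> carr V \<Longrightarrow> act V (g * h) v = act V g (act V h v)"
  and act_one [simp]: "v \<in> carr V \<Longrightarrow> act V 1 v = v"
  and act_hsmul: "v \<in> carr V \<Longrightarrow> act V (hsmul H c h) v = smul V c (act V h v)"
  and act_smul [simp]: "v \<in> carr V \<Longrightarrow> act V h (smul V c v) = smul V c (act V h v)"
  proof -
  note * = V[unfolded HM_object_def]
  show "finite (degs V)" using * by blast
qed (insert V, unfold HM_object_def, (blast | metis)+)

lemma grade_eq_zero: "v \<in> grade V n \<Longrightarrow> n \<notin> degs V \<Longrightarrow> v = 0"
  by (simp add: degs_def)

lemma carrI: "(\<And>n. x n \<in> grade V n) \<Longrightarrow> (\<Sum>n\<in>degs V. x n) \<in> carr V"
  unfolding carr_def by blast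

lemma carrE:
  assumes "v \<in> carr V"
  obtains x where "\<And>n. x n \<in> grade V n" "v = (\<Sum>n\<in>degs V. x n)"
  using assms unfolding carr_def by blast

text \<open>A degree n outside \<open>degs V\<close> does no harm: its component is
  \<open>{0}\<close>, so both sides are 0.\<close>

lemma sum_degs_single:
  assumes "v \<in> grade V n" shows "(\<Sum>i\<in>degs V. if i = n then v else 0) = v"
  using grade_eq_zero[OF assms] by (auto simp: sum.delta)

lemma grade_subset_carr: "v \<in> grade V n \<Longrightarrow> v \<in> carr V"
  using carrI[of "\<lambda>i. if i = n then v else 0"] sum_degs_single[of v n] by simp

lemma zero_in_carr [simp]: "0 \<in> carr V"
  using grade_subset_carr[of 0 0] by simp

lemma add_in_carr [simp]: assumes "v \<in> carr V" "w \<in> carr V" shows "v + w \<in> carr V"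
proof -
  obtain x where x: "\<And>n. x n \<in> grade V n" "v = (\<Sum>n\<in>degs V. x n)" by (rule carrE[OF assms(1)]) blast
  obtain y where y: "\<And>n. y n \<in> grade V n" "w = (\<Sum>n\<in>degs V. y n)" by (rule carrE[OF assms(2)]) blast
  have "v + w = (\<Sum>n\<in>degs V. x n + y n)" using x y by (simp add: sum.distrib)
  then show ?thesis using x y carrI[of "\<lambda>n. x n + y n"] by simp
qed

lemma sum_in_carr [simp]: "(\<And>i. i \<in> I \<Longrightarrow> f i \<in> carr V) \<Longrightarrow> (\<Sum>i\<in>I. f i) \<in> carr V"
  by (induction I rule: infinite_finite_induct) auto

text \<open>Reduces additive statements on the carrier to homogeneous elements, where degrees and
  Koszul signs are defined.\<close>

lemma carr_induct [consumes 1, case_names hom add]: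
  assumes "v \<in> carr V"
    and hom: "\<And>n v. v \<in> grade V n \<Longrightarrow> P v"
    and add: "\<And>v w. v \<in> carr V \<Longrightarrow> w \<in> carr V \<Longrightarrow> P v \<Longrightarrow> P w \<Longrightarrow> P (v + w)"
  shows "P v"
proof -
  obtain x where x: "\<And>n. x n \<in> grade V n" "v = (\<Sum>n\<in>degs V. x n)" by (rule carrE[OF assms(1)]) blast
  have "P (\<Sum>n\<in>D. x n)" if "finite D" for D
    using that
  proof induction
    case empty then show ?case using hom[of 0 0] by simp
  next
    case (insert n D)
    have "(\<Sum>n\<in>D. x n) \<in> carr V"
      by (rule sum_in_carr) (rule grade_subset_carr[OF x(1)])
    then show ?case using add[of "x n" "\<Sum>n\<in>D. x n"] hom[OF x(1)] insert grade_subset_carr[OF x(1)] by simp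
  qed
  then show ?thesis using x by simp
qed

lemma smul_zero_right [simp]: "smul V c 0 = 0"
  using smul_add[of 0 0 c] by simp

lemma smul_zero_left: "v \<in> carr V \<Longrightarrow> smul V 0 v = 0"
  using smul_add_left[of v 0 0] by simp

lemma act_zero_right [simp]: "act V h 0 = 0"
  using act_add[of 0 0 h] by simp

text \<open>The components are only required to be closed under addition, scalars and the action;
  closure under negation comes from the scalar -1.\<close>

lemma smul_minus_one: assumes "v \<in> carr V" shows "smul V (- 1) v = - v"
proof -
  have "smul V (1 + - 1) v = v + smul V (- 1) v" using assms by (simp only: smul_add_left smul_one)
  then show ?thesis using smul_zero_left[OF assms] by (simp add: eq_neg_iff_add_eq_0 add.commute)
qed

lemma uminus_in_grade [simp]: "v \<in> grade V n \<Longrightarrow> - v \<in> grade V n"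
  using smul_minus_one[OF grade_subset_carr] smul_in_grade[of v n "-1"] by simp

lemma diff_in_grade [simp]: "v \<in> grade V n \<Longrightarrow> w \<in> grade V n \<Longrightarrow> v - w \<in> grade V n"
  using add_in_grade[of v n "- w"] by simp

lemma smul_in_carr [simp]: assumes "v \<in> carr V" shows "smul V c v \<in> carr V"
  using assms by (induction rule: carr_induct) (use grade_subset_carr smul_in_grade in \<open>blast, simp\<close>)

lemma act_in_carr [simp]: assumes "v \<in> carr V" shows "act V h v \<in> carr V"
  using assms by (induction rule: carr_induct) (use grade_subset_carr act_in_grade in \<open>blast, simp\<close>)

lemma uminus_in_carr [simp]: "v \<in> carr V \<Longrightarrow> - v \<in> carr V"
  using smul_minus_one[of v] smul_in_carr[of v "-1"] by simp

lemma diff_in_carr [simp]: "v \<in> carr V \<Longrightarrow> w \<in> carr V \<Longrightarrow> v - w \<in> carr V"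
  using add_in_carr[of v "- w"] by simp

lemma smul_uminus [simp]: "v \<in> carr V \<Longrightarrow> smul V c (- v) = - smul V c v"
  using smul_add[of v "-v" c] by (simp add: eq_neg_iff_add_eq_0 add.commute)

lemma act_uminus [simp]: "v \<in> carr V \<Longrightarrow> act V h (- v) = - act V h v"
  using act_add[of v "-v" h] by (simp add: eq_neg_iff_add_eq_0 add.commute)

lemma smul_diff [simp]: "v \<in> carr V \<Longrightarrow> w \<in> carr V \<Longrightarrow> smul V c (v - w) = smul V c v - smul V c w"
  using smul_add[of v "-w" c] by simp

lemma act_diff [simp]: "v \<in> carr V \<Longrightarrow> w \<in> carr V \<Longrightarrow> act V h (v - w) = act V h v - act V h w"
  using act_add[of v "-w" h] by simp

text \<open>Two homogeneous decompositions differ by a decomposition of 0, which is trivial by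
  \<open>grade_direct\<close>. Any explicit decomposition therefore computes \<open>hcomp\<close>,
  and the definite description is not unfolded again.\<close>

lemma hcomp_eqI:
  assumes "\<And>n. x n \<in> grade V n" "v = (\<Sum>n\<in>degs V. x n)"
  shows "hcomp V n v = x n"
proof -
  have "(THE x. (\<forall>n. x n \<in> grade V n) \<and> v = (\<Sum>n\<in>degs V. x n)) = x"
  proof (rule the_equality)
    show "(\<forall>n. x n \<in> grade V n) \<and> v = sum x (degs V)" using assms by simp
  next
    fix y assume y: "(\<forall>n. y n \<in> grade V n) \<and> v = sum y (degs V)"
    have "y n - x n = 0" for n
      by (rule grade_direct[of "\<lambda>n. y n - x n"]) (use y assms in \<open>simp_all add: sum_subtractf\<close>)
    then show "y = x" by auto
  qed
  then show ?thesis by (simp add: hcomp_def)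
qed

lemma hcomp_in_grade [simp]: assumes "v \<in> carr V" shows "hcomp V n v \<in> grade V n"
proof -
  obtain x where x: "\<And>n. x n \<in> grade V n" "v = (\<Sum>n\<in>degs V. x n)" by (rule carrE[OF assms]) blast
  then show ?thesis using hcomp_eqI[of x v n] by simp
qed

lemma sum_hcomp: assumes "v \<in> carr V" shows "(\<Sum>n\<in>degs V. hcomp V n v) = v"
proof -
  obtain x where x: "\<And>n. x n \<in> grade V n" "v = (\<Sum>n\<in>degs V. x n)" by (rule carrE[OF assms]) blast
  have "hcomp V n v = x n" for n using hcomp_eqI[of x v n] x by simp
  then show ?thesis using x by simp
qed

lemma hcomp_in_carr [simp]: "v \<in> carr V \<Longrightarrow> hcomp V n v \<in> carr V"
  by (rule grade_subset_carr[OF hcomp_in_grade])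

lemma hcomp_grade: "v \<in> grade V n \<Longrightarrow> hcomp V m v = (if m = n then v else 0)"
  using hcomp_eqI[of "\<lambda>i. if i = n then v else 0" v m] sum_degs_single[of v n] by simp

lemma hcomp_add [simp]: "v \<in> carr V \<Longrightarrow> w \<in> carr V \<Longrightarrow> hcomp V n (v + w) = hcomp V n v + hcomp V n w"
  by (rule hcomp_eqI) (simp_all add: sum.distrib sum_hcomp)

lemma smul_sum: "(\<And>i. i \<in> I \<Longrightarrow> f i \<in> carr V) \<Longrightarrow> smul V c (\<Sum>i\<in>I. f i) = (\<Sum>i\<in>I. smul V c (f i))"
  by (induction I rule: infinite_finite_induct) auto

lemma act_sum: "(\<And>i. i \<in> I \<Longrightarrow> f i \<in> carr V) \<Longrightarrow> act V h (\<Sum>i\<in>I. f i) = (\<Sum>i\<in>I. act V h (f i))"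
  by (induction I rule: infinite_finite_induct) auto

lemma hcomp_smul [simp]: "v \<in> carr V \<Longrightarrow> hcomp V n (smul V c v) = smul V c (hcomp V n v)"
  by (rule hcomp_eqI) (simp_all add: smul_sum[symmetric] sum_hcomp)

lemma hcomp_act [simp]: "v \<in> carr V \<Longrightarrow> hcomp V n (act V h v) = act V h (hcomp V n v)"
  by (rule hcomp_eqI) (simp_all add: act_sum[symmetric] sum_hcomp)

end

end

section \<open>Multilinear functions on tensors\<close>

text \<open>The legs are passed as separate arguments, so the operator reads as a binder and nested
  sums over several tensors can be exchanged and distributed by rewriting.\<close>

definition psum :: "('h \<times> 'h) list \<Rightarrow> ('h \<Rightarrow> 'h \<Rightarrow> 'x::comm_monoid_add) \<Rightarrow> 'x" where
  "psum xs f = (\<Sum>(a, b)\<leftarrow>xs. f a b)"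

definition tsum :: "('h \<times> 'h \<times> 'h) list \<Rightarrow> ('h \<Rightarrow> 'h \<Rightarrow> 'h \<Rightarrow> 'x::comm_monoid_add) \<Rightarrow> 'x" where
  "tsum xs f = (\<Sum>(a, b, c)\<leftarrow>xs. f a b c)"

lemma psum_simps [simp]: "psum [] f = 0" "psum ((a, b) # xs) f = f a b + psum xs f"
  by (simp_all add: psum_def)

lemma tsum_simps [simp]: "tsum [] g = 0" "tsum ((a, b, c) # xs) g = g a b c + tsum xs g"
  by (simp_all add: tsum_def)

lemma psum_add: "psum xs (\<lambda>a b. f a b + g a b) = psum xs f + psum xs g"
  by (induction xs) (auto simp: algebra_simps)

lemma tsum_add: "tsum ys (\<lambda>a b c. f' a b c + g' a b c) = tsum ys f' + tsum ys g'"
  by (induction ys) (auto simp: algebra_simps)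

lemma psum_zero [simp]: "psum xs (\<lambda>a b. 0) = 0"
  by (induction xs) auto

lemma tsum_zero [simp]: "tsum xs (\<lambda>a b c. 0) = 0"
  by (induction xs) auto

lemma psum_uminus: "psum xs (\<lambda>a b. - f a b) = - (psum xs f :: 'x::ab_group_add)"
  by (induction xs) auto

lemma tsum_uminus: "tsum xs (\<lambda>a b c. - f a b c) = - (tsum xs f :: 'x::ab_group_add)"
  by (induction xs) auto

lemma psum_diff: "psum xs (\<lambda>a b. f a b - g a b) = psum xs f - (psum xs g :: 'x::ab_group_add)"
  by (induction xs) (auto simp: algebra_simps)

lemma tsum_diff: "tsum xs (\<lambda>a b c. f a b c - g a b c) = tsum xs f - (tsum xs g :: 'x::ab_group_add)"
  by (induction xs) (auto simp: algebra_simps)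

lemma psum_psum: "psum xs (\<lambda>a b. psum ys (\<lambda>c d. f a b c d)) = psum ys (\<lambda>c d. psum xs (\<lambda>a b. f a b c d))"
  by (induction xs) (auto simp: psum_add)

lemma tsum_tsum: "tsum xs (\<lambda>a b e. tsum ys (\<lambda>c d h. f a b e c d h)) = tsum ys (\<lambda>c d h. tsum xs (\<lambda>a b e. f a b e c d h))"
  by (induction xs) (auto simp: tsum_add)

lemma tsum_psum: "tsum xs (\<lambda>a b e. psum ys (\<lambda>c d. f a b e c d)) = psum ys (\<lambda>c d. tsum xs (\<lambda>a b e. f a b e c d))"
  by (induction xs) (auto simp: psum_add)

lemma psum_app: "psum xs (\<lambda>a b. F a b) v = psum xs (\<lambda>a b. F a b v)"
  by (induction xs) auto

text \<open>H regarded as an object of degree 0. It lets one predicate \<open>lin\<close> cover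
  functions from H into modules and maps from H to itself, so that linearity of composites follows
  by simplification.\<close>

definition reg :: "('k, 'h::{ring,monoid_mult}) qhopf \<Rightarrow> ('k, 'h, 'h) gmod" where
  "reg H = \<lparr> grade = (\<lambda>n. if n = 0 then UNIV else {0}), smul = hsmul H, act = (*) \<rparr>"

lemma carr_reg [simp]:
  fixes H :: "('k, 'h::{ring,monoid_mult}) qhopf"
  shows "carr (reg H) = UNIV"
proof -
  have "x \<in> carr (reg H)" for x
  proof -
    let ?f = "\<lambda>n. if n = 0 then x else 0"
    \<comment> \<open>In the zero ring no degree is nontrivial; the empty sum is still correct
      because then x = 0.\<close>
    have "degs (reg H) = (if (UNIV :: 'h set) = {0} then {} else {0})"
      by (auto simp: degs_def reg_def)
    moreover have "x = 0" if "(UNIV :: 'h set) = {0}" using that by blast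
    ultimately have "x = (\<Sum>n\<in>degs (reg H). ?f n)" by auto
    moreover have "\<forall>n. ?f n \<in> grade (reg H) n" by (simp add: reg_def)
    ultimately show ?thesis unfolding carr_def by blast
  qed
  then show ?thesis by blast
qed

lemma smul_reg [simp]: "smul (reg H) = hsmul H" by (simp add: reg_def)

definition lin :: "('k, 'h::{ring,monoid_mult}) qhopf \<Rightarrow> ('k, 'h, 'x::ab_group_add, 'p) gmod_scheme \<Rightarrow> ('h \<Rightarrow> 'x) \<Rightarrow> bool" where
  "lin H X f \<longleftrightarrow> klinear (reg H) X f"

lemma lin_iff: "lin H X f \<longleftrightarrow> (\<forall>h. f h \<in> carr X) \<and> (\<forall>g h. f (g + h) = f g + f h) \<and>
    (\<forall>c h. f (hsmul H c h) = smul X c (f h))"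
  by (auto simp: lin_def klinear_def)

definition lin2 where "lin2 H X f \<longleftrightarrow> (\<forall>b. lin H X (\<lambda>a. f a b)) \<and> (\<forall>a. lin H X (\<lambda>b. f a b))"
definition lin3 where "lin3 H X f \<longleftrightarrow> (\<forall>b c. lin H X (\<lambda>a. f a b c)) \<and> (\<forall>a c. lin H X (\<lambda>b. f a b c))
   \<and> (\<forall>a b. lin H X (\<lambda>c. f a b c))"
definition lin4 where "lin4 H X f \<longleftrightarrow> (\<forall>b c d. lin H X (\<lambda>a. f a b c d)) \<and> (\<forall>a c d. lin H X (\<lambda>b. f a b c d))
   \<and> (\<forall>a b d. lin H X (\<lambda>c. f a b c d)) \<and> (\<forall>a b c. lin H X (\<lambda>d. f a b c d))"

definition multi :: "('k \<Rightarrow> 'h \<Rightarrow> 'h) \<Rightarrow> ('h::ab_group_add list \<Rightarrow> 'x::ab_group_add) \<Rightarrow> bool" where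
  "multi s F \<longleftrightarrow>
     (\<forall>u x y v. F (u @ [x + y] @ v) = F (u @ [x] @ v) + F (u @ [y] @ v)) \<and>
     (\<forall>u c x v y w. F (u @ [s c x] @ v @ [y] @ w) = F (u @ [x] @ v @ [s c y] @ w))"

text \<open>\<open>multi\<close> asks exactly for what the generators \<open>add\<close> and
  \<open>scale\<close> demand. The generator \<open>zero\<close> follows from additivity, and
  \<open>append\<close> and \<open>comm\<close> only concern sums of values in an abelian
  group.\<close>

lemma teq_eval:
  assumes "teq s X Y" and "multi s F"
  shows "(\<Sum>w\<leftarrow>X. F w) = (\<Sum>w\<leftarrow>Y. F w)"
  using assms(1)
proof induction
  case (zero u v)
  have "F (u @ [0 + 0] @ v) = F (u @ [0] @ v) + F (u @ [0] @ v)"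
    using assms(2) unfolding multi_def by blast
  then show ?case by simp
next
  case (add u x y v)
  then show ?case using assms(2) unfolding multi_def by simp
next
  case (scale u c x v y w)
  then show ?case using assms(2) unfolding multi_def by simp
qed simp_all

text \<open>The value 0 on words of the wrong length makes \<open>multi\<close> hold for all words,
  since the words related by its two laws always have equal lengths.\<close>

definition ap2 :: "('h \<Rightarrow> 'h \<Rightarrow> 'x::zero) \<Rightarrow> 'h list \<Rightarrow> 'x" where
  "ap2 f w = (case w of [a, b] \<Rightarrow> f a b | _ \<Rightarrow> 0)"
definition ap3 :: "('h \<Rightarrow> 'h \<Rightarrow> 'h \<Rightarrow> 'x::zero) \<Rightarrow> 'h list \<Rightarrow> 'x" where
  "ap3 f w = (case w of [a, b, c] \<Rightarrow> f a b c | _ \<Rightarrow> 0)"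
definition ap4 :: "('h \<Rightarrow> 'h \<Rightarrow> 'h \<Rightarrow> 'h \<Rightarrow> 'x::zero) \<Rightarrow> 'h list \<Rightarrow> 'x" where
  "ap4 f w = (case w of [a, b, c, d] \<Rightarrow> f a b c d | _ \<Rightarrow> 0)"

lemma ap_simps [simp]: "ap2 f [a, b] = f a b" "ap3 g [a, b, c] = g a b c" "ap4 h [a, b, c, d] = h a b c d"
  by (simp_all add: ap2_def ap3_def ap4_def)

lemma ap_nth:
  "ap2 f w = (if length w = 2 then f (w ! 0) (w ! 1) else 0)"
  "ap3 g w = (if length w = 3 then g (w ! 0) (w ! 1) (w ! 2) else 0)"
  "ap4 h w = (if length w = 4 then h (w ! 0) (w ! 1) (w ! 2) (w ! 3) else 0)"
  by (auto simp: ap2_def ap3_def ap4_def length_Suc_conv numeral_eq_Suc split: list.split)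

lemma nth_append_Cons:
  "(u @ x # v) ! i = (if i < length u then u ! i else if i = length u then x else v ! (i - length u - 1))"
  by (cases "i - length u") (auto simp: nth_append nth_Cons)

lemma multi_ap2:
  fixes H :: "('k, 'h::{ring,monoid_mult}) qhopf" and X :: "('k, 'h, 'x::ab_group_add, 'p) gmod_scheme"
  assumes "lin2 H X f" shows "multi (hsmul H) (ap2 f)"
proof -
  have *: "f (x + y) z = f x z + f y z" "f z (x + y) = f z x + f z y"
    "f (hsmul H c x) y = smul X c (f x y)" "f x (hsmul H c y) = smul X c (f x y)" for x y z c
    using assms unfolding lin2_def lin_iff by auto
  show ?thesis
    unfolding multi_def
  proof (intro conjI allI)
    fix u v :: "'h list" and x y
    show "ap2 f (u @ [x + y] @ v) = ap2 f (u @ [x] @ v) + ap2 f (u @ [y] @ v)"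
    \<comment> \<open>The words have length 2 exactly when one letter accompanies the distinguished
      one; otherwise every term is 0.\<close>
    proof (cases "length u + length v = 1")
      case True
      then have "length u = 0 \<or> length u = 1" by arith
      with True show ?thesis
        by (elim disjE) (simp_all add: ap_nth nth_append_Cons *)
    qed (simp add: ap_nth)
  next
    fix u v w :: "'h list" and c x y
    show "ap2 f (u @ [hsmul H c x] @ v @ [y] @ w) = ap2 f (u @ [x] @ v @ [hsmul H c y] @ w)"
    proof (cases "length u + length v + length w = 0")
      case True
      then have "length u = 0" "length v = 0" by arith+
      with True show ?thesis
        by (simp add: ap_nth nth_append_Cons *)
    qed (auto simp: ap_nth)
  qed
qed

lemma multi_ap3:
  fixes H :: "('k, 'h::{ring,monoid_mult}) qhopf" and X :: "('k, 'h, 'x::ab_group_add, 'p) gmod_scheme"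
  assumes "lin3 H X f" shows "multi (hsmul H) (ap3 f)"
proof -
  have *: "f (x + y) z w = f x z w + f y z w" "f z (x + y) w = f z x w + f z y w"
      "f z w (x + y) = f z w x + f z w y"
    "f (hsmul H c x) y z = smul X c (f x y z)" "f x (hsmul H c y) z = smul X c (f x y z)"
    "f x y (hsmul H c z) = smul X c (f x y z)" for x y z w c
    using assms unfolding lin3_def lin_iff by auto
  show ?thesis
    unfolding multi_def
  proof (intro conjI allI)
    fix u v :: "'h list" and x y
    show "ap3 f (u @ [x + y] @ v) = ap3 f (u @ [x] @ v) + ap3 f (u @ [y] @ v)"
    proof (cases "length u + length v = 2")
      case True
      then have "length u = 0 \<or> length u = 1 \<or> length u = 2" by arith
      with True show ?thesis
        by (elim disjE) (simp_all add: ap_nth nth_append_Cons *)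
    qed (simp add: ap_nth)
  next
    fix u v w :: "'h list" and c x y
    show "ap3 f (u @ [hsmul H c x] @ v @ [y] @ w) = ap3 f (u @ [x] @ v @ [hsmul H c y] @ w)"
    proof (cases "length u + length v + length w = 1")
      case True
      then have "length u = 0 \<or> length u = 1" "length v = 0 \<or> length v = 1" by arith+
      with True show ?thesis
        by (elim disjE) (simp_all add: ap_nth nth_append_Cons *)
    qed (simp add: ap_nth)
  qed
qed

lemma multi_ap4:
  fixes H :: "('k, 'h::{ring,monoid_mult}) qhopf" and X :: "('k, 'h, 'x::ab_group_add, 'p) gmod_scheme"
  assumes "lin4 H X f" shows "multi (hsmul H) (ap4 f)"
proof -
  have *: "f (x + y) z w t = f x z w t + f y z w t" "f z (x + y) w t = f z x w t + f z y w t"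
      "f z w (x + y) t = f z w x t + f z w y t" "f z w t (x + y) = f z w t x + f z w t y"
    "f (hsmul H c x) y z t = smul X c (f x y z t)" "f x (hsmul H c y) z t = smul X c (f x y z t)"
    "f x y (hsmul H c z) t = smul X c (f x y z t)" "f x y z (hsmul H c t) = smul X c (f x y z t)"
    for x y z w t c
    using assms unfolding lin4_def lin_iff by auto
  show ?thesis
    unfolding multi_def
  proof (intro conjI allI)
    fix u v :: "'h list" and x y
    show "ap4 f (u @ [x + y] @ v) = ap4 f (u @ [x] @ v) + ap4 f (u @ [y] @ v)"
    proof (cases "length u + length v = 3")
      case True
      then have "length u = 0 \<or> length u = 1 \<or> length u = 2 \<or> length u = 3" by arith
      with True show ?thesis
        by (elim disjE) (simp_all add: ap_nth nth_append_Cons *)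
    qed (simp add: ap_nth)
  next
    fix u v w :: "'h list" and c x y
    show "ap4 f (u @ [hsmul H c x] @ v @ [y] @ w) = ap4 f (u @ [x] @ v @ [hsmul H c y] @ w)"
    proof (cases "length u + length v + length w = 2")
      case True
      then have "length u = 0 \<or> length u = 1 \<or> length u = 2" "length v = 0 \<or> length v = 1 \<or> length v = 2" by arith+
      with True show ?thesis
        by (elim disjE) (simp_all add: ap_nth nth_append_Cons *)
    qed (simp add: ap_nth)
  qed
qed

section \<open>The axioms evaluated on multilinear functions\<close>

context qhopf_modules
begin

context
  fixes V :: "('k, 'h, 'v::ab_group_add, 'm) gmod_scheme"
  assumes V: "HM_object H V"
begin

lemma psum_in_carr [simp]: "(\<And>a b. f a b \<in> carr V) \<Longrightarrow> psum xs f \<in> carr V"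
  by (induction xs) (auto simp: V)

lemma tsum_in_carr [simp]: "(\<And>a b c. g a b c \<in> carr V) \<Longrightarrow> tsum ys g \<in> carr V"
  by (induction ys) (auto simp: V)

lemma psum_in_grade [simp]: "(\<And>a b. f a b \<in> grade V n) \<Longrightarrow> psum xs f \<in> grade V n"
  by (induction xs) (auto simp: V)

lemma tsum_in_grade [simp]: "(\<And>a b c. g a b c \<in> grade V n) \<Longrightarrow> tsum ys g \<in> grade V n"
  by (induction ys) (auto simp: V)

lemma act_psum [simp]: "(\<And>a b. f a b \<in> carr V) \<Longrightarrow> act V h (psum xs f) = psum xs (\<lambda>a b. act V h (f a b))"
  by (induction xs) (auto simp: V)

lemma act_tsum [simp]: "(\<And>a b c. g a b c \<in> carr V) \<Longrightarrow> act V h (tsum ys g) = tsum ys (\<lambda>a b c. act V h (g a b c))"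
  by (induction ys) (auto simp: V)

lemma smul_psum: "(\<And>a b. f a b \<in> carr V) \<Longrightarrow> smul V k (psum xs f) = psum xs (\<lambda>a b. smul V k (f a b))"
  by (induction xs) (auto simp: V)

lemma smul_tsum: "(\<And>a b c. g a b c \<in> carr V) \<Longrightarrow> smul V k (tsum ys g) = tsum ys (\<lambda>a b c. smul V k (g a b c))"
  by (induction ys) (auto simp: V)

lemma lin_psum [simp]:
  "(\<And>a b. lin H V (\<lambda>x. f a b x)) \<Longrightarrow> lin H V (\<lambda>x. psum xs (\<lambda>a b. f a b x))"
  by (auto simp: lin_iff psum_add smul_psum)

lemma lin_tsum [simp]:
  "(\<And>a b c. lin H V (\<lambda>x. g a b c x)) \<Longrightarrow> lin H V (\<lambda>x. tsum ys (\<lambda>a b c. g a b c x))"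
  by (auto simp: lin_iff tsum_add smul_tsum)

lemma lin_act_left [simp]: "lin H (reg H) e \<Longrightarrow> v \<in> carr V \<Longrightarrow> lin H V (\<lambda>x. act V (e x) v)"
  by (auto simp: lin_iff act_add_left[OF V] act_hsmul[OF V] V)

lemma lin_act_right [simp]: "lin H V g \<Longrightarrow> lin H V (\<lambda>x. act V h (g x))"
  by (auto simp: lin_iff V)

lemma smul_commute: "v \<in> carr V \<Longrightarrow> smul V c (smul V d v) = smul V d (smul V c v)"
  by (simp add: V smul_mult[OF V, symmetric] mult.commute)

lemma lin_smul [simp]: "lin H V g \<Longrightarrow> lin H V (\<lambda>x. smul V k (g x))"
  by (auto simp: lin_iff V smul_commute)

lemma lin_psum_apply: "lin H V f \<Longrightarrow> f (psum xs e) = psum xs (\<lambda>a b. f (e a b))"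
proof (induction xs)
  case Nil
  then have "f (0 + 0) = f 0 + f 0" unfolding lin_iff by blast
  then show ?case by simp
qed (auto simp: lin_iff)

lemma lin_tsum_apply: "lin H V f \<Longrightarrow> f (tsum ys d) = tsum ys (\<lambda>a b c. f (d a b c))"
proof (induction ys)
  case Nil
  then have "f (0 + 0) = f 0 + f 0" unfolding lin_iff by blast
  then show ?case by simp
qed (auto simp: lin_iff)

end

end

lemma sum_list_concat_map: "(\<Sum>w\<leftarrow>concat (map g xs). F w) = (\<Sum>x\<leftarrow>xs. \<Sum>w\<leftarrow>g x. F w)"
  by (induction xs) auto

lemma sum_list_tmult: "(\<Sum>w\<leftarrow>X \<odot> Y. F w) = (\<Sum>u\<leftarrow>X. \<Sum>v\<leftarrow>Y. F (map2 (*) u v))"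
  by (induction X) (auto simp: tmult_def o_def)

lemmas eval_simps = sum_list_concat_map sum_list_tmult psum_def tsum_def case_prod_unfold o_def

locale quasi_hopf = qhopf_modules H
  for H :: "('k::{comm_ring,monoid_mult}, 'h::{ring,monoid_mult}) qhopf" +
  assumes qh: "quasi_hopf_algebra H"
begin

abbreviation "DD h \<equiv> psum (cop H h)"
abbreviation "PP \<equiv> tsum (phi H)"
abbreviation "QQ \<equiv> tsum (phi_inv H)"
abbreviation "RR \<equiv> psum (Rm H)"
abbreviation "S \<equiv> antip H"
abbreviation "\<epsilon> \<equiv> cou H"
abbreviation "\<alpha> \<equiv> alp H"
abbreviation "\<beta> \<equiv> bet H"

lemma S_add [simp]: "S (g + h) = S g + S h"
  and S_hsmul [simp]: "S (hsmul H c h) = hsmul H c (S h)"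
  and S_mult [simp]: "S (g * h) = S h * S g"
  and S_one [simp]: "S 1 = 1"
  and S_cop_alpha: "DD h (\<lambda>a b. S a * \<alpha> * b) = hsmul H (\<epsilon> h) \<alpha>"
  and S_cop_beta: "DD h (\<lambda>a b. a * \<beta> * S b) = hsmul H (\<epsilon> h) \<beta>"
  and S_phi: "PP (\<lambda>x y z. x * \<beta> * S y * \<alpha> * z) = 1"
  and S_phi_inv: "QQ (\<lambda>x y z. S x * \<alpha> * y * \<beta> * S z) = 1"
  and qb: "quasi_bialgebra H"
  using qh unfolding quasi_hopf_algebra_def Let_def psum_def tsum_def by auto

lemma cou_add [simp]: "\<epsilon> (g + h) = \<epsilon> g + \<epsilon> h"
  and cou_hsmul [simp]: "\<epsilon> (hsmul H c h) = c * \<epsilon> h"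
  and cou_mult [simp]: "\<epsilon> (g * h) = \<epsilon> g * \<epsilon> h"
  and cou_one [simp]: "\<epsilon> 1 = 1"
  and cou_cop_left: "DD h (\<lambda>a b. hsmul H (\<epsilon> a) b) = h"
  and cou_cop_right: "DD h (\<lambda>a b. hsmul H (\<epsilon> b) a) = h"
  and kalg: "k_algebra (hsmul H)"
  using qb unfolding quasi_bialgebra_def Let_def psum_def tsum_def by simp_all

lemma hsmul_simps: "hsmul H c (x + y) = hsmul H c x + hsmul H c y"
   "hsmul H (c + d) x = hsmul H c x + hsmul H d x"
   "hsmul H (c * d) x = hsmul H c (hsmul H d x)"
   "hsmul H 1 x = x"
   "hsmul H c x * y = hsmul H c (x * y)"
   "x * hsmul H c y = hsmul H c (x * y)"
  using kalg unfolding k_algebra_def by metis+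

lemma lin_reg [simp]: "lin H (reg H) (\<lambda>x. x)"
  "lin H (reg H) e \<Longrightarrow> lin H (reg H) (\<lambda>x. c * e x)"
  "lin H (reg H) e \<Longrightarrow> lin H (reg H) (\<lambda>x. e x * c)"
  "lin H (reg H) e \<Longrightarrow> lin H (reg H) (\<lambda>x. S (e x))"
  by (auto simp: lin_iff algebra_simps hsmul_simps)

lemma lin_smul_cou [simp]:
  "HM_object H X \<Longrightarrow> lin H (reg H) e \<Longrightarrow> v \<in> carr X \<Longrightarrow> lin H X (\<lambda>x. smul X (\<epsilon> (e x)) v)"
  by (auto simp: lin_iff smul_add_left smul_mult)

lemma cop_add: "lin2 H X f \<Longrightarrow> DD (g + h) f = DD g f + DD h f"
  using qb teq_eval[OF _ multi_ap2, of "H" "[[a, b]. (a, b) \<leftarrow> cop H (g + h)]"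
      "[[a, b]. (a, b) \<leftarrow> cop H g] @ [[a, b]. (a, b) \<leftarrow> cop H h]" X f]
  unfolding quasi_bialgebra_def Let_def by (simp add: eval_simps)

lemma cop_hsmul: "HM_object H X \<Longrightarrow> lin2 H X f \<Longrightarrow> DD (hsmul H c h) f = smul X c (DD h f)"
  using qb teq_eval[OF _ multi_ap2, of "H" "[[a, b]. (a, b) \<leftarrow> cop H (hsmul H c h)]"
      "[[hsmul H c a, b]. (a, b) \<leftarrow> cop H h]" X f]
  unfolding quasi_bialgebra_def Let_def
  by (simp add: smul_psum lin2_def lin_iff) (simp add: eval_simps)

lemma lin_cop [simp]:
  "HM_object H X \<Longrightarrow> lin2 H X f \<Longrightarrow> lin H (reg H) e \<Longrightarrow> lin H X (\<lambda>h. DD (e h) f)"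
  by (simp add: lin_iff cop_add[of X] cop_hsmul) (simp add: lin2_def lin_iff)

lemma cop_mult: "lin2 H X f \<Longrightarrow> DD (g * h) f = DD g (\<lambda>a b. DD h (\<lambda>c d. f (a * c) (b * d)))"
  using qb teq_eval[OF _ multi_ap2, of "H" "[[a, b]. (a, b) \<leftarrow> cop H (g * h)]"
      "[[a, b]. (a, b) \<leftarrow> cop H g] \<odot> [[a, b]. (a, b) \<leftarrow> cop H h]" X f]
  unfolding quasi_bialgebra_def Let_def by (simp add: eval_simps)

lemma cop_one: "lin2 H X f \<Longrightarrow> DD 1 f = f 1 1"
  using qb teq_eval[OF _ multi_ap2, of "H" "[[a, b]. (a, b) \<leftarrow> cop H 1]" "[[1, 1]]" X f]
  unfolding quasi_bialgebra_def Let_def by (simp add: eval_simps)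

text \<open>This and the next five facts push an equation between elements of H through a linear f,
  so that it can be applied to a subterm deep inside a product or an action.\<close>

lemma counit_left: "HM_object H X \<Longrightarrow> lin H X f \<Longrightarrow> DD h (\<lambda>a b. smul X (\<epsilon> a) (f b)) = f h"
  using lin_psum_apply[of X f "cop H h" "\<lambda>a b. hsmul H (\<epsilon> a) b"] cou_cop_left[of h]
  by (simp add: lin_iff)

lemma counit_right: "HM_object H X \<Longrightarrow> lin H X f \<Longrightarrow> DD h (\<lambda>a b. smul X (\<epsilon> b) (f a)) = f h"
  using lin_psum_apply[of X f "cop H h" "\<lambda>a b. hsmul H (\<epsilon> b) a"] cou_cop_right[of h]
  by (simp add: lin_iff)

lemma antipode_alpha:
  "HM_object H X \<Longrightarrow> lin H X f \<Longrightarrow> DD h (\<lambda>a b. f (S a * \<alpha> * b)) = smul X (\<epsilon> h) (f \<alpha>)"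
  using lin_psum_apply[of X f "cop H h" "\<lambda>a b. S a * \<alpha> * b"] S_cop_alpha[of h]
  by (simp add: lin_iff)

lemma antipode_beta:
  "HM_object H X \<Longrightarrow> lin H X f \<Longrightarrow> DD h (\<lambda>a b. f (a * \<beta> * S b)) = smul X (\<epsilon> h) (f \<beta>)"
  using lin_psum_apply[of X f "cop H h" "\<lambda>a b. a * \<beta> * S b"] S_cop_beta[of h]
  by (simp add: lin_iff)

lemma antipode_phi: "HM_object H X \<Longrightarrow> lin H X f \<Longrightarrow> PP (\<lambda>x y z. f (x * \<beta> * S y * \<alpha> * z)) = f 1"
  using lin_tsum_apply[of X f "phi H" "\<lambda>x y z. x * \<beta> * S y * \<alpha> * z"] S_phi by simp

lemma antipode_phi_inv: "HM_object H X \<Longrightarrow> lin H X f \<Longrightarrow> QQ (\<lambda>x y z. f (S x * \<alpha> * y * \<beta> * S z)) = f 1"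
  using lin_tsum_apply[of X f "phi_inv H" "\<lambda>x y z. S x * \<alpha> * y * \<beta> * S z"] S_phi_inv by simp

lemma phi_phi_inv:
  "lin3 H X f \<Longrightarrow> PP (\<lambda>x y z. QQ (\<lambda>x' y' z'. f (x * x') (y * y') (z * z'))) = f 1 1 1"
  using qb teq_eval[OF _ multi_ap3, of "H" "[[x, y, z]. (x, y, z) \<leftarrow> phi H] \<odot> [[x, y, z]. (x, y, z) \<leftarrow> phi_inv H]" "[[1, 1, 1]]" X f]
  unfolding quasi_bialgebra_def Let_def by (simp add: eval_simps)

lemma phi_inv_phi:
  "lin3 H X f \<Longrightarrow> QQ (\<lambda>x y z. PP (\<lambda>x' y' z'. f (x * x') (y * y') (z * z'))) = f 1 1 1"
  using qb teq_eval[OF _ multi_ap3, of "H" "[[x, y, z]. (x, y, z) \<leftarrow> phi_inv H] \<odot> [[x, y, z]. (x, y, z) \<leftarrow> phi H]" "[[1, 1, 1]]" X f]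
  unfolding quasi_bialgebra_def Let_def by (simp add: eval_simps)

lemma coassoc:
  assumes "lin3 H X f"
  shows "DD h (\<lambda>a b. DD b (\<lambda>b1 b2. f a b1 b2)) =
    PP (\<lambda>x y z. DD h (\<lambda>a b. DD a (\<lambda>a1 a2. QQ (\<lambda>x' y' z'. f (x * a1 * x') (y * a2 * y') (z * b * z')))))"
proof -
  have "teq (hsmul H) [[a, b1, b2]. (a, b) \<leftarrow> cop H h, (b1, b2) \<leftarrow> cop H b]
           ([[x, y, z]. (x, y, z) \<leftarrow> phi H] \<odot> [[a1, a2, b]. (a, b) \<leftarrow> cop H h, (a1, a2) \<leftarrow> cop H a] \<odot> [[x, y, z]. (x, y, z) \<leftarrow> phi_inv H])"
    using qb unfolding quasi_bialgebra_def Let_def by blast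
  from teq_eval[OF this multi_ap3, OF assms] show ?thesis
    by (simp add: eval_simps)
qed

lemma pentagon:
  assumes "lin4 H X f"
  shows "PP (\<lambda>x y z. DD z (\<lambda>z1 z2. PP (\<lambda>x' y' z'. DD x' (\<lambda>x1 x2. f (x * x1) (y * x2) (z1 * y') (z2 * z'))))) =
    PP (\<lambda>x y z. PP (\<lambda>x' y' z'. DD y' (\<lambda>y1 y2. PP (\<lambda>u v w. f (x' * u) (x * y1 * v) (y * y2 * w) (z * z')))))"
proof -
  have "teq (hsmul H) ([[x, y, z1, z2]. (x, y, z) \<leftarrow> phi H, (z1, z2) \<leftarrow> cop H z] \<odot>
           [[x1, x2, y, z]. (x, y, z) \<leftarrow> phi H, (x1, x2) \<leftarrow> cop H x])
          ([[1, x, y, z]. (x, y, z) \<leftarrow> phi H] \<odot>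
           [[x, y1, y2, z]. (x, y, z) \<leftarrow> phi H, (y1, y2) \<leftarrow> cop H y] \<odot>
           [[x, y, z, 1]. (x, y, z) \<leftarrow> phi H])"
    using qb unfolding quasi_bialgebra_def Let_def by blast
  from teq_eval[OF this multi_ap4, OF assms] show ?thesis
    by (simp add: eval_simps)
qed

lemma triangle:
  assumes "HM_object H X" "lin2 H X f"
  shows "PP (\<lambda>x y z. smul X (\<epsilon> y) (f x z)) = f 1 1"
proof -
  have "teq (hsmul H) [[hsmul H (cou H y) x, z]. (x, y, z) \<leftarrow> phi H] [[1, 1]]"
    using qb unfolding quasi_bialgebra_def Let_def by blast
  from teq_eval[OF this multi_ap2, OF assms(2)] have "PP (\<lambda>x y z. f (hsmul H (cou H y) x) z) = f 1 1"
    by (simp add: eval_simps)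
  then show ?thesis using assms by (simp add: lin2_def lin_iff)
qed

end

lemma psum_cong: "(\<And>a b. f a b = g a b) \<Longrightarrow> psum xs f = psum xs g"
  by presburger

lemma tsum_cong: "(\<And>a b c. f a b c = g a b c) \<Longrightarrow> tsum xs f = tsum xs g"
  by presburger

context quasi_hopf
begin

text \<open>
  Oriented exchange rules; the plain exchange lemmas would loop in the simplifier, since it does not
  recognise them as permutative.
\<close>

lemma sum_norm:
  "QQ (\<lambda>a b c. PP (\<lambda>d e f. g1 a b c d e f)) = PP (\<lambda>d e f. QQ (\<lambda>a b c. g1 a b c d e f))"
  "RR (\<lambda>a b. PP (\<lambda>d e f. g2 a b d e f)) = PP (\<lambda>d e f. RR (\<lambda>a b. g2 a b d e f))"
  "RR (\<lambda>a b. QQ (\<lambda>d e f. g2 a b d e f)) = QQ (\<lambda>d e f. RR (\<lambda>a b. g2 a b d e f))"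
  "DD h (\<lambda>a b. PP (\<lambda>d e f. g2 a b d e f)) = PP (\<lambda>d e f. DD h (\<lambda>a b. g2 a b d e f))"
  "DD h (\<lambda>a b. QQ (\<lambda>d e f. g2 a b d e f)) = QQ (\<lambda>d e f. DD h (\<lambda>a b. g2 a b d e f))"
  "DD h (\<lambda>a b. RR (\<lambda>d e. g3 a b d e)) = RR (\<lambda>d e. DD h (\<lambda>a b. g3 a b d e))"
  by (rule tsum_tsum tsum_psum[symmetric] psum_psum)+

section \<open>Counit normalizations of the associator and its inverse\<close>

lemma triangle_inv:
  assumes X [simp]: "HM_object H X" and f: "lin2 H X f"
  shows "QQ (\<lambda>x y z. smul X (\<epsilon> y) (f x z)) = f 1 1"
proof -
  have [simp]: "lin H X (\<lambda>x. f (e x) b)" "lin H X (\<lambda>x. f b (e x))" "f a b \<in> carr X" if "lin H (reg H) e" for e a b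
    using f that by (auto simp: lin2_def lin_iff)
  have [simp]: "f a b \<in> carr X" for a b using f by (auto simp: lin2_def lin_iff)
  have "f 1 1 = PP (\<lambda>x y z. QQ (\<lambda>x' y' z'. smul X (\<epsilon> (y * y')) (f (x * x') (z * z'))))"
    by (subst phi_phi_inv[of X]) (simp_all add: lin3_def)
  also have "\<dots> = PP (\<lambda>x y z. smul X (\<epsilon> y) (QQ (\<lambda>x' y' z'. smul X (\<epsilon> y') (f (x * x') (z * z')))))"
    by (simp add: smul_tsum smul_mult)
  also have "\<dots> = QQ (\<lambda>x y z. smul X (\<epsilon> y) (f x z))"
    by (subst triangle[of X]) (simp_all add: lin2_def)
  finally show ?thesis ..
qed

text \<open>The triangle axiom concerns the middle leg. Applying \<epsilon> to the third leg of the
  pentagon gives \<phi> = \<phi> (u \<otimes> 1) with u = (id \<otimes> id \<otimes>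
  \<epsilon>)(\<phi>), which is \<open>key\<close>; multiplying by \<phi>^-1 on the left leaves u =
  1.\<close>

lemma phi_counit:
  assumes X [simp]: "HM_object H X" and f: "lin2 H X f"
  shows "PP (\<lambda>x y z. smul X (\<epsilon> z) (f x y)) = f 1 1"
proof -
  have key: "PP g = PP (\<lambda>x y z. PP (\<lambda>u v w. smul X (\<epsilon> w) (g (x * u) (y * v) z)))"
    if g: "lin3 H X g" for g
  proof -
    have [simp]: "lin H X (\<lambda>x. g (e x) b c)" "lin H X (\<lambda>x. g b (e x) c)" "lin H X (\<lambda>x. g b c (e x))"
      if "lin H (reg H) e" for e b c
      using g that by (auto simp: lin3_def lin_iff)
    have [simp]: "g a b c \<in> carr X" for a b c using g by (auto simp: lin3_def lin_iff)
    have "PP g = PP (\<lambda>x y z. DD z (\<lambda>z1 z2. smul X (\<epsilon> z1) (g x y z2)))"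
      by (simp add: counit_left)
    \<comment> \<open>The triangle read backwards creates a second copy of \<phi>, so that the
      expression becomes the left side of the pentagon with \<epsilon> on its third leg.\<close>
    also have "\<dots> = PP (\<lambda>x y z. DD z (\<lambda>z1 z2. smul X (\<epsilon> z1) (PP (\<lambda>x' y' z'. smul X (\<epsilon> y') (DD x' (\<lambda>x1 x2. g (x * x1) (y * x2) (z2 * z')))))))"
      by (subst triangle[of X]) (simp_all add: lin2_def cop_one[of X])
    also have "\<dots> = PP (\<lambda>x y z. DD z (\<lambda>z1 z2. PP (\<lambda>x' y' z'. DD x' (\<lambda>x1 x2. smul X (\<epsilon> (z1 * y')) (g (x * x1) (y * x2) (z2 * z'))))))"
      by (simp add: smul_tsum smul_psum smul_mult)
    also have "\<dots> = PP (\<lambda>x y z. PP (\<lambda>x' y' z'. DD y' (\<lambda>y1 y2. PP (\<lambda>u v w. smul X (\<epsilon> (y * y2 * w)) (g (x' * u) (x * y1 * v) (z * z'))))))"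
      by (rule pentagon[of X "\<lambda>a b c d. smul X (\<epsilon> c) (g a b d)"]) (simp add: lin4_def)
    also have "\<dots> = PP (\<lambda>x y z. smul X (\<epsilon> y) (PP (\<lambda>x' y' z'. DD y' (\<lambda>y1 y2. smul X (\<epsilon> y2) (PP (\<lambda>u v w. smul X (\<epsilon> w) (g (x' * u) (x * y1 * v) (z * z'))))))))"
      by (simp add: smul_tsum smul_psum smul_mult)
    also have "\<dots> = PP (\<lambda>x' y' z'. DD y' (\<lambda>y1 y2. smul X (\<epsilon> y2) (PP (\<lambda>u v w. smul X (\<epsilon> w) (g (x' * u) (y1 * v) z')))))"
      by (subst triangle[of X]) (simp_all add: lin2_def mult.assoc)
    also have "\<dots> = PP (\<lambda>x' y' z'. PP (\<lambda>u v w. smul X (\<epsilon> w) (g (x' * u) (y' * v) z')))"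
      by (subst counit_right[of X]) simp_all
    finally show ?thesis .
  qed
  have [simp]: "lin H X (\<lambda>x. f (e x) b)" "lin H X (\<lambda>x. f b (e x))" if "lin H (reg H) e" for e b
    using f that by (auto simp: lin2_def lin_iff)
  have [simp]: "f a b \<in> carr X" for a b using f by (auto simp: lin2_def lin_iff)
  define k where "k a b c = smul X (\<epsilon> c) (f a b)" for a b c
  have [simp]: "lin H X (\<lambda>x. k (e x) b c)" "lin H X (\<lambda>x. k b (e x) c)" "lin H X (\<lambda>x. k b c (e x))" "k a b c \<in> carr X"
    if "lin H (reg H) e" for e a b c
    using that by (auto simp: k_def)
  have [simp]: "k a b c \<in> carr X" for a b c by (simp add: k_def)
  have "f 1 1 = k 1 1 1" by (simp add: k_def)
  also have "\<dots> = QQ (\<lambda>p q r. PP (\<lambda>x y z. k (p * x) (q * y) (r * z)))"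
    by (rule phi_inv_phi[of X, symmetric]) (simp add: lin3_def)
  also have "\<dots> = PP (\<lambda>x y z. QQ (\<lambda>p q r. k (p * x) (q * y) (r * z)))"
    by (rule tsum_tsum)
  also have "\<dots> = PP (\<lambda>x y z. PP (\<lambda>u v w. smul X (\<epsilon> w) (QQ (\<lambda>p q r. k (p * (x * u)) (q * (y * v)) (r * z)))))"
    by (rule key) (simp add: lin3_def)
  also have "\<dots> = QQ (\<lambda>p q r. PP (\<lambda>x y z. PP (\<lambda>u v w. smul X (\<epsilon> w) (k ((p * x) * u) ((q * y) * v) (r * z)))))"
    by (simp only: mult.assoc) (simp add: smul_tsum sum_norm)
  also have "\<dots> = PP (\<lambda>u v w. smul X (\<epsilon> w) (k (1 * u) (1 * v) 1))"
    by (rule phi_inv_phi[of X]) (simp add: lin3_def)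
  finally show ?thesis by (simp add: k_def)
qed

lemma phi_inv_counit:
  assumes X [simp]: "HM_object H X" and f: "lin2 H X f"
  shows "QQ (\<lambda>x y z. smul X (\<epsilon> z) (f x y)) = f 1 1"
proof -
  have [simp]: "lin H X (\<lambda>x. f (e x) b)" "lin H X (\<lambda>x. f b (e x))" if "lin H (reg H) e" for e b
    using f that by (auto simp: lin2_def lin_iff)
  have [simp]: "f a b \<in> carr X" for a b using f by (auto simp: lin2_def lin_iff)
  have "f 1 1 = PP (\<lambda>x y z. QQ (\<lambda>x' y' z'. smul X (\<epsilon> (z * z')) (f (x * x') (y * y'))))"
    by (subst phi_phi_inv[of X]) (simp_all add: lin3_def)
  also have "\<dots> = PP (\<lambda>x y z. smul X (\<epsilon> z) (QQ (\<lambda>x' y' z'. smul X (\<epsilon> z') (f (x * x') (y * y')))))"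
    by (simp add: smul_tsum smul_mult)
  also have "\<dots> = QQ (\<lambda>x y z. smul X (\<epsilon> z) (f x y))"
    by (subst phi_counit[of X]) (simp_all add: lin2_def)
  finally show ?thesis ..
qed

section \<open>Rearranged pentagons and the zigzag identities\<close>

text \<open>
  \<open>(\<Delta> \<otimes> id \<otimes> id)(\<phi>) (\<phi>\<^sup>-\<^sup>1 \<otimes> 1) = (id \<otimes> id \<otimes> \<Delta>)(\<phi>\<^sup>-\<^sup>1) (1 \<otimes> \<phi>) (id \<otimes> \<Delta> \<otimes> id)(\<phi>)\<close>
\<close>

lemma pentagon_left:
  assumes X [simp]: "HM_object H X" and G: "lin4 H X G"
  shows "PP (\<lambda>x y z. QQ (\<lambda>x' y' z'. DD x (\<lambda>a b. G (a * x') (b * y') (y * z') z))) =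
    QQ (\<lambda>x y z. DD z (\<lambda>z1 z2. PP (\<lambda>x' y' z'. PP (\<lambda>u v w. DD v (\<lambda>v1 v2.
      G (x * u) (y * x' * v1) (z1 * y' * v2) (z2 * z' * w))))))"
proof -
  have [simp]: "lin H X (\<lambda>x. G (e x) b c d)" "lin H X (\<lambda>x. G b (e x) c d)" "lin H X (\<lambda>x. G b c (e x) d)"
    "lin H X (\<lambda>x. G b c d (e x))" if "lin H (reg H) e" for e b c d
    using G that by (auto simp: lin4_def lin_iff)
  \<comment> \<open>\<open>1\<close> inserts (id \<otimes> id \<otimes> \<Delta>)(\<phi>^-1 \<phi>)
    = 1 on the left, whose second factor completes one side of the pentagon; after the pentagon is
    applied, \<open>2\<close> cancels \<phi> \<phi>^-1 in the first three legs.\<close>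
  have 1: "QQ (\<lambda>p q r. PP (\<lambda>x y z. DD z (\<lambda>z1 z2. DD r (\<lambda>r1 r2. K (p * x) (q * y) (r1 * z1) (r2 * z2))))) = K 1 1 1 1"
    if K: "lin4 H X K" for K
  proof -
    have [simp]: "lin H X (\<lambda>x. K (e x) b c d)" "lin H X (\<lambda>x. K b (e x) c d)" "lin H X (\<lambda>x. K b c (e x) d)"
      "lin H X (\<lambda>x. K b c d (e x))" if "lin H (reg H) e" for e b c d
      using K that by (auto simp: lin4_def lin_iff)
    have *: "DD z (\<lambda>z1 z2. DD r (\<lambda>r1 r2. K a b (r1 * z1) (r2 * z2))) = DD (r * z) (\<lambda>c d. K a b c d)" for a b r z
      by (subst psum_psum, rule cop_mult[of X, symmetric]) (simp add: lin2_def)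
    have "QQ (\<lambda>p q r. PP (\<lambda>x y z. DD (r * z) (\<lambda>c d. K (p * x) (q * y) c d))) = DD 1 (\<lambda>c d. K 1 1 c d)"
      by (rule phi_inv_phi[of X]) (simp_all add: lin3_def lin2_def)
    also have "\<dots> = K 1 1 1 1" by (rule cop_one[of X]) (simp add: lin2_def)
    finally show ?thesis by (simp only: *)
  qed
  have 2: "PP (\<lambda>u v w. QQ (\<lambda>p' q' r'. G (a * (u * p')) (b * (v * q')) (c * (w * r')) d)) = G a b c d" for a b c d
    by (subst phi_phi_inv[of X]) (simp_all add: lin3_def)
  have "PP (\<lambda>x' y' z'. QQ (\<lambda>p' q' r'. DD x' (\<lambda>x1 x2. G (x1 * p') (x2 * q') (y' * r') z'))) =
    QQ (\<lambda>p q r. PP (\<lambda>x y z. DD z (\<lambda>z1 z2. DD r (\<lambda>r1 r2.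
      PP (\<lambda>x' y' z'. QQ (\<lambda>p' q' r'. DD x' (\<lambda>x1 x2.
           G ((p * x) * (x1 * p')) ((q * y) * (x2 * q')) ((r1 * z1) * (y' * r')) ((r2 * z2) * z'))))))))"
    by (subst 1) (simp_all add: lin4_def)
  also have "\<dots> = PP (\<lambda>x y z. DD z (\<lambda>z1 z2. PP (\<lambda>x' y' z'. DD x' (\<lambda>x1 x2.
       QQ (\<lambda>p q r. DD r (\<lambda>r1 r2. QQ (\<lambda>p' q' r'.
         G (p * (x * x1) * p') (q * (y * x2) * q') (r1 * (z1 * y') * r') (r2 * (z2 * z')))))))))"
    by (simp only: sum_norm mult.assoc) (rule tsum_cong psum_cong psum_psum)+
  also have "\<dots> = PP (\<lambda>x y z. PP (\<lambda>x' y' z'. DD y' (\<lambda>y1 y2. PP (\<lambda>u v w.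
       QQ (\<lambda>p q r. DD r (\<lambda>r1 r2. QQ (\<lambda>p' q' r'.
         G (p * (x' * u) * p') (q * (x * y1 * v) * q') (r1 * (y * y2 * w) * r') (r2 * (z * z')))))))))"
    by (rule pentagon[of X]) (simp add: lin4_def lin2_def)
  also have "\<dots> = QQ (\<lambda>p q r. DD r (\<lambda>r1 r2. PP (\<lambda>x y z. PP (\<lambda>x' y' z'. DD y' (\<lambda>y1 y2.
      PP (\<lambda>u v w. QQ (\<lambda>p' q' r'.
         G (p * x' * (u * p')) (q * x * y1 * (v * q')) (r1 * y * y2 * (w * r')) (r2 * z * z'))))))))"
    by (simp only: sum_norm mult.assoc) (rule tsum_cong psum_cong psum_psum)+
  also have "\<dots> = QQ (\<lambda>p q r. DD r (\<lambda>r1 r2. PP (\<lambda>x y z. PP (\<lambda>x' y' z'. DD y' (\<lambda>y1 y2.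
         G (p * x') (q * x * y1) (r1 * y * y2) (r2 * z * z'))))))"
    by (simp only: 2)
  finally show ?thesis .
qed

text \<open>
  \<open>(\<phi> \<otimes> 1) (\<Delta> \<otimes> id \<otimes> id)(\<phi>\<^sup>-\<^sup>1) = (id \<otimes> \<Delta> \<otimes> id)(\<phi>\<^sup>-\<^sup>1) (1 \<otimes> \<phi>\<^sup>-\<^sup>1) (id \<otimes> id \<otimes> \<Delta>)(\<phi>)\<close>
\<close>

lemma pentagon_right:
  assumes X [simp]: "HM_object H X" and G: "lin4 H X G"
  shows "PP (\<lambda>x y z. QQ (\<lambda>x' y' z'. DD x' (\<lambda>a b. G (x * a) (y * b) (z * y') z'))) =
    QQ (\<lambda>x y z. DD y (\<lambda>y1 y2. QQ (\<lambda>x' y' z'. PP (\<lambda>u v w. DD w (\<lambda>w1 w2.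
      G (x * u) (y1 * x' * v) (y2 * y' * w1) (z * z' * w2))))))"
proof -
  have [simp]: "lin H X (\<lambda>x. G (e x) b c d)" "lin H X (\<lambda>x. G b (e x) c d)" "lin H X (\<lambda>x. G b c (e x) d)"
    "lin H X (\<lambda>x. G b c d (e x))" if "lin H (reg H) e" for e b c d
    using G that by (auto simp: lin4_def lin_iff)
  \<comment> \<open>\<open>1\<close> appends (\<Delta> \<otimes> id \<otimes> id)(\<phi> \<phi>^-1)
    = 1 to the right-hand side, which completes the pentagon. Of its outcome, 1 \<otimes> \<phi>
    cancels against 1 \<otimes> \<phi>^-1, and \<open>2\<close> then removes (id \<otimes> \<Delta>
    \<otimes> id)(\<phi>^-1 \<phi>).\<close>
  have 1: "PP (\<lambda>x y z. QQ (\<lambda>p q r. DD x (\<lambda>x1 x2. DD p (\<lambda>p1 p2. G (a * (x1 * p1)) (b * (x2 * p2)) (c * (y * q)) (d * (z * r)))))) = G a b c d"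
    for a b c d
  proof -
    have *: "DD x (\<lambda>x1 x2. DD p (\<lambda>p1 p2. G (a * (x1 * p1)) (b * (x2 * p2)) c' d')) = DD (x * p) (\<lambda>k l. G (a * k) (b * l) c' d')" for c' d' x p
      by (rule cop_mult[of X, symmetric]) (simp add: lin2_def)
    have "PP (\<lambda>x y z. QQ (\<lambda>p q r. DD (x * p) (\<lambda>k l. G (a * k) (b * l) (c * (y * q)) (d * (z * r))))) =
        DD 1 (\<lambda>k l. G (a * k) (b * l) (c * 1) (d * 1))"
      by (rule phi_phi_inv[of X]) (simp_all add: lin3_def lin2_def)
    also have "\<dots> = G a b c d" by (subst cop_one[of X]) (simp_all add: lin2_def)
    finally show ?thesis by (simp only: *)
  qed
  have 2: "QQ (\<lambda>p q r. PP (\<lambda>x y z. DD y (\<lambda>y1 y2. DD q (\<lambda>q1 q2. K (p * x) (q1 * y1) (q2 * y2) (r * z))))) = K 1 1 1 1"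
    if K: "lin4 H X K" for K
  proof -
    have [simp]: "lin H X (\<lambda>x. K (e x) b c d)" "lin H X (\<lambda>x. K b (e x) c d)" "lin H X (\<lambda>x. K b c (e x) d)"
      "lin H X (\<lambda>x. K b c d (e x))" if "lin H (reg H) e" for e b c d
      using K that by (auto simp: lin4_def lin_iff)
    have *: "DD y (\<lambda>y1 y2. DD q (\<lambda>q1 q2. K a (q1 * y1) (q2 * y2) b)) = DD (q * y) (\<lambda>c d. K a c d b)" for a b q y
      by (subst psum_psum, rule cop_mult[of X, symmetric]) (simp add: lin2_def)
    have "QQ (\<lambda>p q r. PP (\<lambda>x y z. DD (q * y) (\<lambda>c d. K (p * x) c d (r * z)))) = DD 1 (\<lambda>c d. K 1 c d 1)"
      by (rule phi_inv_phi[of X]) (simp_all add: lin3_def lin2_def)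
    also have "\<dots> = K 1 1 1 1" by (rule cop_one[of X]) (simp add: lin2_def)
    finally show ?thesis by (simp only: *)
  qed
  let ?f = "\<lambda>a b c d. QQ (\<lambda>x y z. DD y (\<lambda>y1 y2. QQ (\<lambda>x' y' z'. QQ (\<lambda>p q r. DD p (\<lambda>p1 p2.
      G (x * a * p1) (y1 * x' * b * p2) (y2 * y' * c * q) (z * z' * d * r))))))"
  have "QQ (\<lambda>x y z. DD y (\<lambda>y1 y2. QQ (\<lambda>x' y' z'. PP (\<lambda>u v w. DD w (\<lambda>w1 w2.
      G (x * u) (y1 * x' * v) (y2 * y' * w1) (z * z' * w2)))))) =
    QQ (\<lambda>x y z. DD y (\<lambda>y1 y2. QQ (\<lambda>x' y' z'. PP (\<lambda>u v w. DD w (\<lambda>w1 w2.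
      PP (\<lambda>k l m. QQ (\<lambda>p q r. DD k (\<lambda>k1 k2. DD p (\<lambda>p1 p2.
      G (x * u * (k1 * p1)) (y1 * x' * v * (k2 * p2)) (y2 * y' * w1 * (l * q)) (z * z' * w2 * (m * r))))))))))) "
    by (simp only: 1)
  also have "\<dots> = PP (\<lambda>x y z. DD z (\<lambda>z1 z2. PP (\<lambda>x' y' z'. DD x' (\<lambda>x1 x2. ?f (x * x1) (y * x2) (z1 * y') (z2 * z')))))"
    by (simp only: sum_norm mult.assoc, rule tsum_cong, rule tsum_cong, rule tsum_cong, rule tsum_cong, rule tsum_cong,
      rule HOL.trans[OF psum_psum], rule psum_cong, rule psum_psum)
  also have "\<dots> = PP (\<lambda>x y z. PP (\<lambda>x' y' z'. DD y' (\<lambda>y1 y2. PP (\<lambda>u v w. ?f (x' * u) (x * y1 * v) (y * y2 * w) (z * z')))))"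
    by (rule pentagon[of X]) (simp add: lin4_def lin2_def)
  also have "\<dots> = QQ (\<lambda>x' y' z'. PP (\<lambda>k' l' m'. PP (\<lambda>k l m. PP (\<lambda>u v w. QQ (\<lambda>x y z. QQ (\<lambda>p q r.
      DD l (\<lambda>l1 l2. DD y (\<lambda>y1 y2. DD p (\<lambda>p1 p2. G (x * k * (u * p1)) (y1 * ((x' * k') * (l1 * (v * p2))))
         (y2 * ((y' * l') * (l2 * (w * q)))) (z * ((z' * m') * (m * r))))))))))))"
    by (simp only: sum_norm mult.assoc, rule tsum_cong, rule tsum_cong, rule tsum_cong, rule tsum_tsum)
  also have "\<dots> = PP (\<lambda>k l m. PP (\<lambda>u v w. QQ (\<lambda>x y z. QQ (\<lambda>p q r.
      DD l (\<lambda>l1 l2. DD y (\<lambda>y1 y2. DD p (\<lambda>p1 p2. G (x * k * (u * p1)) (y1 * (1 * (l1 * (v * p2))))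
         (y2 * (1 * (l2 * (w * q)))) (z * (1 * (m * r))))))))))"
    by (rule phi_inv_phi[of X]) (simp add: lin3_def lin2_def)
  also have "\<dots> = QQ (\<lambda>x y z. PP (\<lambda>k l m. DD l (\<lambda>l1 l2. DD y (\<lambda>y1 y2.
     PP (\<lambda>u v w. QQ (\<lambda>p q r. DD p (\<lambda>p1 p2. G ((x * k) * (u * p1)) ((y1 * l1) * (v * p2))
         ((y2 * l2) * (w * q)) ((z * m) * r))))))))"
    by (simp only: sum_norm mult.assoc mult_1_left)
  also have "\<dots> = PP (\<lambda>u v w. QQ (\<lambda>p q r. DD p (\<lambda>p1 p2. G (1 * (u * p1)) (1 * (v * p2)) (1 * (w * q)) (1 * r))))"
    by (rule 2) (simp add: lin4_def lin2_def)
  finally show ?thesis by simp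
qed

text \<open>The identity behind ev(\<zeta>(f)(v) \<otimes> w) = f(v \<otimes> w). Legs b, c, d of
  \<open>pentagon_left\<close> are contracted to b \<beta> S(c) \<alpha> d. The antipode axioms then
  collapse both coproducts, and the three associators disappear by \<open>triangle\<close>,
  \<open>antipode_phi\<close> and \<open>phi_inv_counit\<close>.\<close>

lemma zigzag_left:
  assumes X [simp]: "HM_object H X" and F: "lin2 H X F"
  shows "PP (\<lambda>x y z. QQ (\<lambda>x' y' z'. DD x (\<lambda>a b. F (a * x') (b * y' * \<beta> * S z' * S y * \<alpha> * z)))) = F 1 1"
proof -
  have [simp]: "lin H X (\<lambda>x. F (e x) b)" "lin H X (\<lambda>x. F b (e x))" if "lin H (reg H) e" for e b
    using F that by (auto simp: lin2_def lin_iff)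
  have [simp]: "F a b \<in> carr X" for a b using F by (auto simp: lin2_def lin_iff)
  have "PP (\<lambda>x y z. QQ (\<lambda>x' y' z'. DD x (\<lambda>a b. F (a * x') (b * y' * \<beta> * S z' * S y * \<alpha> * z)))) =
    PP (\<lambda>x y z. QQ (\<lambda>x' y' z'. DD x (\<lambda>a b. F (a * x') (b * y' * \<beta> * S (y * z') * \<alpha> * z))))"
    by (simp add: mult.assoc)
  also have "\<dots> = QQ (\<lambda>x y z. DD z (\<lambda>z1 z2. PP (\<lambda>x' y' z'. PP (\<lambda>u v w. DD v (\<lambda>v1 v2.
      F (x * u) (y * x' * v1 * \<beta> * S (z1 * y' * v2) * \<alpha> * (z2 * z' * w)))))))"
    by (rule pentagon_left[of X "\<lambda>a b c d. F a (b * \<beta> * S c * \<alpha> * d)"]) (simp_all add: lin4_def)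
  also have "\<dots> = QQ (\<lambda>x y z. DD z (\<lambda>z1 z2. PP (\<lambda>x' y' z'. PP (\<lambda>u v w. DD v (\<lambda>v1 v2.
      F (x * u) (y * x' * (v1 * \<beta> * S v2) * S y' * S z1 * \<alpha> * z2 * z' * w))))))"
    by (simp add: mult.assoc)
  also have "\<dots> = QQ (\<lambda>x y z. DD z (\<lambda>z1 z2. PP (\<lambda>x' y' z'. PP (\<lambda>u v w. smul X (\<epsilon> v)
      (F (x * u) (y * x' * \<beta> * S y' * S z1 * \<alpha> * z2 * z' * w))))))"
  proof -
    have *: "DD v (\<lambda>v1 v2. F a (b * (v1 * \<beta> * S v2) * c1 * c2 * \<alpha> * c3 * c4 * c5)) =
        smul X (\<epsilon> v) (F a (b * \<beta> * c1 * c2 * \<alpha> * c3 * c4 * c5))" for v a b c1 c2 c3 c4 c5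
      by (rule antipode_beta) simp_all
    show ?thesis by (simp only: *)
  qed
  also have "\<dots> = QQ (\<lambda>x y z. DD z (\<lambda>z1 z2. PP (\<lambda>x' y' z'.
      F x (y * x' * \<beta> * S y' * S z1 * \<alpha> * z2 * z'))))"
  proof -
    have *: "PP (\<lambda>u v w. smul X (\<epsilon> v) (F (a * u) (b * w))) = F a b" for a b
      by (subst triangle[of X]) (simp_all add: lin2_def)
    show ?thesis by (simp only: *)
  qed
  also have "\<dots> = QQ (\<lambda>x y z. PP (\<lambda>x' y' z'. DD z (\<lambda>z1 z2.
      F x (y * x' * \<beta> * S y' * (S z1 * \<alpha> * z2) * z'))))"
    by (simp only: sum_norm mult.assoc)
  also have "\<dots> = QQ (\<lambda>x y z. PP (\<lambda>x' y' z'. smul X (\<epsilon> z) (F x (y * (x' * \<beta> * S y' * \<alpha> * z')))))"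
  proof -
    have *: "DD z (\<lambda>z1 z2. F a (b * (S z1 * \<alpha> * z2) * c)) = smul X (\<epsilon> z) (F a (b * \<alpha> * c))" for z a b c
      by (rule antipode_alpha) simp_all
    show ?thesis by (simp only: *) (simp only: mult.assoc)
  qed
  also have "\<dots> = QQ (\<lambda>x y z. smul X (\<epsilon> z) (F x y))"
  proof -
    have *: "PP (\<lambda>x' y' z'. smul X c (F a (b * (x' * \<beta> * S y' * \<alpha> * z')))) = smul X c (F a b)" for a b c
      by (subst antipode_phi[of X]) simp_all
    show ?thesis by (simp only: *)
  qed
  also have "\<dots> = F 1 1"
    by (rule phi_inv_counit) (simp_all add: lin2_def)
  finally show ?thesis .
qed

text \<open>The identity behind \<zeta>(ev) = id: the mirror contraction S(b) \<alpha> c \<beta>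
  S(d) of \<open>pentagon_right\<close>. Here the associators disappear by
  \<open>phi_counit\<close>, \<open>antipode_phi_inv\<close> and
  \<open>triangle_inv\<close>.\<close>

lemma zigzag_right:
  assumes X [simp]: "HM_object H X" and F: "lin2 H X F"
  shows "PP (\<lambda>x y z. QQ (\<lambda>x' y' z'. DD x' (\<lambda>a b. F (x * a) (S b * S y * \<alpha> * z * y' * \<beta> * S z')))) = F 1 1"
proof -
  have [simp]: "lin H X (\<lambda>x. F (e x) b)" "lin H X (\<lambda>x. F b (e x))" if "lin H (reg H) e" for e b
    using F that by (auto simp: lin2_def lin_iff)
  have [simp]: "F a b \<in> carr X" for a b using F by (auto simp: lin2_def lin_iff)
  have "PP (\<lambda>x y z. QQ (\<lambda>x' y' z'. DD x' (\<lambda>a b. F (x * a) (S b * S y * \<alpha> * z * y' * \<beta> * S z')))) =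
     PP (\<lambda>x y z. QQ (\<lambda>x' y' z'. DD x' (\<lambda>a b. F (x * a) (S (y * b) * \<alpha> * (z * y') * \<beta> * S z'))))"
    by (simp add: mult.assoc)
  also have "\<dots> = QQ (\<lambda>x y z. DD y (\<lambda>y1 y2. QQ (\<lambda>x' y' z'. PP (\<lambda>u v w. DD w (\<lambda>w1 w2.
      F (x * u) (S (y1 * x' * v) * \<alpha> * (y2 * y' * w1) * \<beta> * S (z * z' * w2)))))))"
    by (rule pentagon_right[of X "\<lambda>a b c d. F a (S b * \<alpha> * c * \<beta> * S d)"]) (simp_all add: lin4_def)
  also have "\<dots> = QQ (\<lambda>x y z. DD y (\<lambda>y1 y2. QQ (\<lambda>x' y' z'. PP (\<lambda>u v w. DD w (\<lambda>w1 w2.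
      F (x * u) (S v * S x' * S y1 * \<alpha> * y2 * y' * (w1 * \<beta> * S w2) * S z' * S z))))))"
    by (simp add: mult.assoc)
  also have "\<dots> = QQ (\<lambda>x y z. DD y (\<lambda>y1 y2. QQ (\<lambda>x' y' z'. PP (\<lambda>u v w. smul X (\<epsilon> w)
      (F (x * u) (S v * S x' * S y1 * \<alpha> * y2 * y' * \<beta> * S z' * S z))))))"
  proof -
    have *: "DD w (\<lambda>w1 w2. F a (b1 * b2 * b3 * \<alpha> * b4 * b5 * (w1 * \<beta> * S w2) * c1 * c2)) =
        smul X (\<epsilon> w) (F a (b1 * b2 * b3 * \<alpha> * b4 * b5 * \<beta> * c1 * c2))" for w a b1 b2 b3 b4 b5 c1 c2
      by (rule antipode_beta) simp_all
    show ?thesis by (simp only: *)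
  qed
  also have "\<dots> = QQ (\<lambda>x y z. DD y (\<lambda>y1 y2. QQ (\<lambda>x' y' z'.
      F x (S x' * S y1 * \<alpha> * y2 * y' * \<beta> * S z' * S z))))"
  proof -
    have *: "PP (\<lambda>u v w. smul X (\<epsilon> w) (F (a * u) (S v * b1 * b2 * \<alpha> * b3 * b4 * \<beta> * b5 * b6))) =
        F a (b1 * b2 * \<alpha> * b3 * b4 * \<beta> * b5 * b6)" for a b1 b2 b3 b4 b5 b6
      by (subst phi_counit[of X]) (simp_all add: lin2_def)
    show ?thesis by (simp only: *)
  qed
  also have "\<dots> = QQ (\<lambda>x y z. QQ (\<lambda>x' y' z'. DD y (\<lambda>y1 y2.
      F x (S x' * (S y1 * \<alpha> * y2) * y' * \<beta> * S z' * S z))))"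
    by (simp only: sum_norm mult.assoc)
  also have "\<dots> = QQ (\<lambda>x y z. QQ (\<lambda>x' y' z'. smul X (\<epsilon> y) (F x (S x' * \<alpha> * y' * \<beta> * S z' * S z))))"
  proof -
    have *: "DD y (\<lambda>y1 y2. F a (b * (S y1 * \<alpha> * y2) * c1 * \<beta> * c2 * c3)) =
        smul X (\<epsilon> y) (F a (b * \<alpha> * c1 * \<beta> * c2 * c3))" for y a b c1 c2 c3
      by (rule antipode_alpha) simp_all
    show ?thesis by (simp only: *)
  qed
  also have "\<dots> = QQ (\<lambda>x y z. smul X (\<epsilon> y) (F x (S z)))"
  proof -
    have *: "QQ (\<lambda>x' y' z'. smul X c (F a (S x' * \<alpha> * y' * \<beta> * S z' * b))) = smul X c (F a b)" for a b c
      by (subst antipode_phi_inv[of X]) simp_all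
    show ?thesis by (simp only: *)
  qed
  also have "\<dots> = F 1 1"
    by (subst triangle_inv[of X]) (simp_all add: lin2_def)
  finally show ?thesis .
qed

end

section \<open>Internal homs\<close>

lemma sum_fun_apply: "(\<Sum>i\<in>I. f i) v = (\<Sum>i\<in>I. f i v)"
  by (induction I rule: infinite_finite_induct) auto

context qhopf_modules
begin

lemma HM_objectI:
  assumes "finite (degs V)"
    and "\<And>n. 0 \<in> grade V n"
    and "\<And>n v w. v \<in> grade V n \<Longrightarrow> w \<in> grade V n \<Longrightarrow> v + w \<in> grade V n"
    and "\<And>n c v. v \<in> grade V n \<Longrightarrow> smul V c v \<in> grade V n"
    and "\<And>n h v. v \<in> grade V n \<Longrightarrow> act V h v \<in> grade V n"
    and "\<And>x n. (\<And>n. x n \<in> grade V n) \<Longrightarrow> (\<Sum>n\<in>degs V. x n) = 0 \<Longrightarrow> x n = 0"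
    and "\<And>c v w. v \<in> carr V \<Longrightarrow> w \<in> carr V \<Longrightarrow> smul V c (v + w) = smul V c v + smul V c w"
    and "\<And>c d v. v \<in> carr V \<Longrightarrow> smul V (c + d) v = smul V c v + smul V d v"
    and "\<And>c d v. v \<in> carr V \<Longrightarrow> smul V (c * d) v = smul V c (smul V d v)"
    and "\<And>v. v \<in> carr V \<Longrightarrow> smul V 1 v = v"
    and "\<And>h v w. v \<in> carr V \<Longrightarrow> w \<in> carr V \<Longrightarrow> act V h (v + w) = act V h v + act V h w"
    and "\<And>g h v. v \<in> carr V \<Longrightarrow> act V (g + h) v = act V g v + act V h v"
    and "\<And>g h v. v \<in> carr V \<Longrightarrow> act V (g * h) v = act V g (act V h v)"
    and "\<And>v. v \<in> carr V \<Longrightarrow> act V 1 v = v"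
    and "\<And>c h v. v \<in> carr V \<Longrightarrow> act V (hsmul H c h) v = smul V c (act V h v)"
    and "\<And>c h v. v \<in> carr V \<Longrightarrow> act V h (smul V c v) = smul V c (act V h v)"
  shows "HM_object H V"
  unfolding HM_object_def
  by (intro conjI allI ballI impI,
    rule assms(1), rule assms(2), (rule assms(3); assumption), (rule assms(4); assumption),
    (rule assms(5); assumption), (elim conjE, rule assms(6), erule spec, assumption), (rule assms(7); assumption), (rule assms(8); assumption),
    (rule assms(9); assumption), (rule assms(10); assumption), (rule assms(11); assumption), (rule assms(12); assumption),
    (rule assms(13); assumption), (rule assms(14); assumption), (rule assms(15); assumption), (rule assms(16); assumption))

context
  fixes V :: "('k, 'h, 'v::ab_group_add, 'm) gmod_scheme"
    and W :: "('k, 'h, 'w::ab_group_add, 'n) gmod_scheme"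
  assumes V [simp]: "HM_object H V" and W [simp]: "HM_object H W"
begin

lemma klinear_in_carr: "klinear V W L \<Longrightarrow> v \<in> carr V \<Longrightarrow> L v \<in> carr W"
  and klinear_add: "klinear V W L \<Longrightarrow> v \<in> carr V \<Longrightarrow> v' \<in> carr V \<Longrightarrow> L (v + v') = L v + L v'"
  and klinear_smul: "klinear V W L \<Longrightarrow> v \<in> carr V \<Longrightarrow> L (smul V c v) = smul W c (L v)"
  by (auto simp: klinear_def)

lemma klinear_zero: "klinear V W L \<Longrightarrow> L 0 = 0"
  using klinear_add[of L 0 0] by simp

lemma klinear_psum:
  "klinear V W L \<Longrightarrow> (\<And>a b. f a b \<in> carr V) \<Longrightarrow> L (psum xs f) = psum xs (\<lambda>a b. L (f a b))"
  by (induction xs) (auto simp: klinear_zero klinear_add)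

lemma klinear_tsum:
  "klinear V W L \<Longrightarrow> (\<And>a b c. g a b c \<in> carr V) \<Longrightarrow> L (tsum ys g) = tsum ys (\<lambda>a b c. L (g a b c))"
  by (induction ys) (auto simp: klinear_zero klinear_add)

lemma klinear_uminus: "klinear V W L \<Longrightarrow> v \<in> carr V \<Longrightarrow> L (- v) = - L v"
  using klinear_add[of L v "- v"] by (simp add: klinear_zero eq_neg_iff_add_eq_0 add.commute)

lemma klinear_diff: "klinear V W L \<Longrightarrow> v \<in> carr V \<Longrightarrow> v' \<in> carr V \<Longrightarrow> L (v - v') = L v - L v'"
  using klinear_add[of L v "- v'"] by (simp add: klinear_uminus)

lemma lin_klinear: "klinear V W L \<Longrightarrow> lin H V g \<Longrightarrow> lin H W (\<lambda>x. L (g x))"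
  by (auto simp: lin_iff klinear_in_carr klinear_add klinear_smul)

lemma klinear_const_zero [simp]: "klinear V W (\<lambda>v. 0)"
  by (simp add: klinear_def)

lemma klinear_plus: "klinear V W L \<Longrightarrow> klinear V W M \<Longrightarrow> klinear V W (\<lambda>v. L v + M v)"
  by (simp add: klinear_def algebra_simps)

lemma klinear_sum:
  "(\<And>i. i \<in> I \<Longrightarrow> klinear V W (f i)) \<Longrightarrow> klinear V W (\<lambda>v. \<Sum>i\<in>I. f i v)"
  by (induction I rule: infinite_finite_induct) (auto simp: klinear_plus)

lemma klinear_psumI:
  "(\<And>a b. klinear V W (f a b)) \<Longrightarrow> klinear V W (\<lambda>v. psum xs (\<lambda>a b. f a b v))"
  by (induction xs) (auto simp: klinear_plus)

lemma klinear_tsumI: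
  "(\<And>a b c. klinear V W (g a b c)) \<Longrightarrow> klinear V W (\<lambda>v. tsum ys (\<lambda>a b c. g a b c v))"
  by (induction ys) (auto simp: klinear_plus)

lemma klinear_on_carr [simp]: "klinear V W (on_carr V L) \<longleftrightarrow> klinear V W L"
  by (auto simp: klinear_def on_carr_def)

lemma klinear_smulI: "klinear V W L \<Longrightarrow> klinear V W (\<lambda>v. smul W c (L v))"
  by (auto simp: klinear_def smul_commute)

lemma klinear_actI: "klinear V W L \<Longrightarrow> klinear V W (\<lambda>v. act W g (L (act V h v)))"
  by (auto simp: klinear_def)

lemma ihom_grade_iff: "L \<in> grade (ihom H V W) n \<longleftrightarrow> klinear V W L \<and> (\<forall>v. v \<notin> carr V \<longrightarrow> L v = 0) \<and>
    (\<forall>m. \<forall>v\<in>grade V m. L v \<in> grade W (m + n))"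
  by (simp add: ihom_def)

lemma ihom_smul: "smul (ihom H V W) c L = on_carr V (\<lambda>v. smul W c (L v))"
  by (simp add: ihom_def)

lemma ihom_act: "act (ihom H V W) h L = on_carr V (\<lambda>v. psum (cop H h) (\<lambda>a b. act W a (L (act V (antip H b) v))))"
  by (simp add: ihom_def psum_def)

lemma ihom_carrD:
  assumes "L \<in> carr (ihom H V W)"
  shows "klinear V W L" "v \<notin> carr V \<Longrightarrow> L v = 0"
proof -
  obtain x where x: "\<And>n. x n \<in> grade (ihom H V W) n" "L = (\<Sum>n\<in>degs (ihom H V W). x n)"
    using assms unfolding carr_def by blast
  have L: "L = (\<lambda>v. \<Sum>n\<in>degs (ihom H V W). x n v)"
    by (rule ext) (simp add: x(2) sum_fun_apply)
  show "klinear V W L" unfolding L by (rule klinear_sum) (use x(1) in \<open>simp add: ihom_grade_iff\<close>)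
  show "L v = 0" if "v \<notin> carr V" using x(1) that by (simp add: L ihom_grade_iff)
qed

lemma hom_ext:
  assumes "\<And>v. v \<notin> carr V \<Longrightarrow> L v = 0" "\<And>v. v \<notin> carr V \<Longrightarrow> M v = 0" "\<And>v. v \<in> carr V \<Longrightarrow> L v = M v"
  shows "L = M"
  using assms by fastforce

lemma hom_eq_zeroI:
  assumes "L \<in> grade (ihom H V W) n" "\<And>m v. v \<in> grade V m \<Longrightarrow> L v = 0"
  shows "L = 0"
proof
  fix v
  have "L v = 0" if "v \<in> carr V"
    using that
  proof (induction rule: carr_induct[OF V, consumes 1, case_names hom add])
    case (add v w)
    then show ?case using klinear_add[of L v w] assms(1) by (simp add: ihom_grade_iff)
  qed (rule assms(2))
  then show "L v = 0 v" using assms(1) by (auto simp: ihom_grade_iff)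
qed

text \<open>A nonzero homogeneous map is nonzero on some homogeneous vector, which forces its degree
  to be a difference of occurring degrees. This gives boundedness of the internal hom.\<close>

lemma ihom_degs: "degs (ihom H V W) \<subseteq> (\<lambda>(l, m). l - m) ` (degs W \<times> degs V)"
proof
  fix n assume n: "n \<in> degs (ihom H V W)"
  have "0 \<in> grade (ihom H V W) n" by (auto simp: ihom_grade_iff zero_fun_def)
  then obtain L where L: "L \<in> grade (ihom H V W) n" "L \<noteq> 0"
    using n by (auto simp: degs_def)
  then obtain m v where v: "v \<in> grade V m" "L v \<noteq> 0" using hom_eq_zeroI[of L n] by blast
  then have "L v \<in> grade W (m + n)" using L by (simp add: ihom_grade_iff)
  then have "m + n \<in> degs W" using v(2) grade_eq_zero[OF W, of "L v" "m + n"] by auto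
  moreover have "v \<noteq> 0" using v(2) klinear_zero[of L] L by (auto simp: ihom_grade_iff)
  then have "m \<in> degs V" using v(1) grade_eq_zero[OF V, of v m] by auto
  ultimately show "n \<in> (\<lambda>(l, m). l - m) ` (degs W \<times> degs V)"
    by (intro image_eqI[of _ _ "(m + n, m)"]) auto
qed

text \<open>Evaluation at a vector of degree m turns the family into a homogeneous family of W,
  shifted by m, so directness in W applies.\<close>

lemma ihom_direct:
  assumes x: "\<And>n. x n \<in> grade (ihom H V W) n" and sum: "(\<Sum>n\<in>degs (ihom H V W). x n) = 0"
  shows "x n = 0"
proof (rule hom_eq_zeroI[OF x])
  fix m v assume v: "v \<in> grade V m"
  have fin: "finite (degs (ihom H V W))"
    by (rule finite_subset[OF ihom_degs]) simp
  define y where "y l = x (l - m) v" for l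
  have y: "y l \<in> grade W l" for l
    using x[of "l - m"] v by (simp add: y_def ihom_grade_iff) (metis add_diff_cancel_left' diff_add_cancel add.commute)
  \<comment> \<open>The degrees of W and the shifted degrees of the internal hom may differ; both
    sums are compared on the union, where the additional terms vanish.\<close>
  define T where "T = degs W \<union> (\<lambda>n. n + m) ` degs (ihom H V W)"
  have T: "finite T" using fin by (simp add: T_def)
  have "(\<Sum>l\<in>degs W. y l) = (\<Sum>l\<in>T. y l)"
    by (rule sum.mono_neutral_left[OF T]) (auto simp: T_def intro: grade_eq_zero[OF W y])
  also have "\<dots> = (\<Sum>l\<in>(\<lambda>n. n + m) ` degs (ihom H V W). y l)"
  proof (rule sum.mono_neutral_right[OF T])
    show "\<forall>l\<in>T - (\<lambda>n. n + m) ` degs (ihom H V W). y l = 0"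
    proof
      fix l assume "l \<in> T - (\<lambda>n. n + m) ` degs (ihom H V W)"
      then have "l - m \<notin> degs (ihom H V W)" by force
      then show "y l = 0" using x[of "l - m"] by (auto simp: degs_def y_def)
    qed
  qed (auto simp: T_def)
  also have "\<dots> = (\<Sum>n\<in>degs (ihom H V W). x n v)"
    by (subst sum.reindex) (auto simp: y_def inj_on_def)
  also have "\<dots> = (\<Sum>n\<in>degs (ihom H V W). x n) v"
    by (simp add: sum_fun_apply)
  finally have "(\<Sum>l\<in>degs W. y l) = 0" by (simp add: sum)
  from grade_direct[OF W y this, of "m + n"] show "x n v = 0" by (simp add: y_def)
qed

end

end

context quasi_hopf
begin

context
  fixes V :: "('k, 'h, 'v::ab_group_add, 'm) gmod_scheme"
    and W :: "('k, 'h, 'w::ab_group_add, 'n) gmod_scheme"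
  assumes V [simp]: "HM_object H V" and W [simp]: "HM_object H W"
begin

text \<open>The laws in the H argument are the coproduct laws evaluated on the bilinear function of
  \<open>actL\<close>; for products, the reversal by S matches the order of composition.\<close>

lemma HM_object_ihom [simp]: "HM_object H (ihom H V W)"
proof -
  let ?E = "ihom H V W"
  note smulE = ihom_smul[OF V W] and actE = ihom_act[OF V W] and gradeE = ihom_grade_iff[OF V W]
  have actL: "lin2 H W (\<lambda>a b. act W a (L (act V (S b) v)))" if "klinear V W L" "v \<in> carr V" for L v
    using that lin_klinear[OF V W that(1), of "\<lambda>b. act V (S b) v"]
    by (simp add: lin2_def klinear_in_carr[OF V W])
  have app: "L v \<in> carr W" if "L \<in> carr ?E" "v \<in> carr V" for L v
    using klinear_in_carr[OF V W ihom_carrD(1)[OF V W that(1)] that(2)] .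
  have out: "L v = 0" if "L \<in> carr ?E" "v \<notin> carr V" for L v
    using ihom_carrD(2)[OF V W that] .
  note lin = ihom_carrD(1)[OF V W]
  show ?thesis
  proof (rule HM_objectI)
    show "finite (degs ?E)"
      by (rule finite_subset[OF ihom_degs[OF V W]]) simp
    show "0 \<in> grade ?E n" for n
      by (auto simp: gradeE zero_fun_def V W)
    show "L + M \<in> grade ?E n" if "L \<in> grade ?E n" "M \<in> grade ?E n" for L M n
      using that by (auto simp: gradeE plus_fun_def klinear_plus[OF V W])
    show "smul ?E c L \<in> grade ?E n" if "L \<in> grade ?E n" for L n c
      using that by (auto simp: gradeE smulE klinear_smulI[OF V W] klinear_on_carr[OF V W])
        (auto simp: on_carr_def)
    show "act ?E h L \<in> grade ?E n" if L: "L \<in> grade ?E n" for L n h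
    proof -
      have "klinear V W (\<lambda>v. DD h (\<lambda>a b. act W a (L (act V (S b) v))))"
        using L by (intro klinear_psumI[OF V W] klinear_actI[OF V W]) (simp add: gradeE)
      then show ?thesis
        using L by (auto simp: gradeE actE klinear_on_carr[OF V W]) (auto simp: on_carr_def)
    qed
    show "x n = 0" if "\<And>n. x n \<in> grade ?E n" "(\<Sum>n\<in>degs ?E. x n) = 0" for x n
      using ihom_direct[OF V W that] .
    show "smul ?E c (L + M) = smul ?E c L + smul ?E c M" if "L \<in> carr ?E" "M \<in> carr ?E" for c L M
      using that by (auto simp: smulE on_carr_def app fun_eq_iff)
    show "smul ?E (c + d) L = smul ?E c L + smul ?E d L" if "L \<in> carr ?E" for c d L
      using that by (auto simp: smulE on_carr_def app fun_eq_iff smul_add_left)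
    show "smul ?E (c * d) L = smul ?E c (smul ?E d L)" if "L \<in> carr ?E" for c d L
      using that by (auto simp: smulE on_carr_def app fun_eq_iff smul_mult)
    show "smul ?E 1 L = L" if "L \<in> carr ?E" for L
      using that by (auto simp: smulE on_carr_def app fun_eq_iff out)
    show "act ?E h (L + M) = act ?E h L + act ?E h M" if "L \<in> carr ?E" "M \<in> carr ?E" for h L M
      using that by (auto simp: actE on_carr_def app fun_eq_iff psum_add)
    show "act ?E (g + h) L = act ?E g L + act ?E h L" if "L \<in> carr ?E" for g h L
      using that by (auto simp: actE on_carr_def fun_eq_iff cop_add[OF actL[OF lin]])
    show "act ?E (g * h) L = act ?E g (act ?E h L)" if "L \<in> carr ?E" for g h L
      using that by (auto simp: actE on_carr_def fun_eq_iff cop_mult[OF actL[OF lin]] app)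
    show "act ?E 1 L = L" if "L \<in> carr ?E" for L
      using that by (auto simp: actE on_carr_def fun_eq_iff cop_one[OF actL[OF lin]] app out)
    show "act ?E (hsmul H c h) L = smul ?E c (act ?E h L)" if "L \<in> carr ?E" for c h L
      using that by (auto simp: actE smulE on_carr_def fun_eq_iff cop_hsmul[OF W actL[OF lin]])
    show "act ?E h (smul ?E c L) = smul ?E c (act ?E h L)" if "L \<in> carr ?E" for c h L
      using that by (auto simp: actE smulE on_carr_def fun_eq_iff app smul_psum)
  qed
qed

end

end

section \<open>Bilinear morphisms\<close>

context qhopf_modules
begin

context
  fixes V :: "('k, 'h, 'v::ab_group_add, 'm) gmod_scheme"
    and W :: "('k, 'h, 'w::ab_group_add, 'n) gmod_scheme"
    and X :: "('k, 'h, 'x::ab_group_add, 'p) gmod_scheme"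
    and f :: "'v \<Rightarrow> 'w \<Rightarrow> 'x"
  assumes V [simp]: "HM_object H V" and W [simp]: "HM_object H W" and X [simp]: "HM_object H X"
    and f: "HM_morphism2 H V W X f"
begin

lemma morphism2_klinear: "v \<in> carr V \<Longrightarrow> klinear W X (\<lambda>w. f v w)" "w \<in> carr W \<Longrightarrow> klinear V X (\<lambda>v. f v w)"
  using f by (auto simp: HM_morphism2_def)

lemma morphism2_in_carr: "v \<in> carr V \<Longrightarrow> w \<in> carr W \<Longrightarrow> f v w \<in> carr X"
  using klinear_in_carr[OF W X morphism2_klinear(1)] .

lemma morphism2_in_grade: "v \<in> grade V m \<Longrightarrow> w \<in> grade W n \<Longrightarrow> f v w \<in> grade X (m + n)"
  using f by (simp add: HM_morphism2_def)

lemma morphism2_act: "v \<in> carr V \<Longrightarrow> w \<in> carr W \<Longrightarrow>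
    act X h (f v w) = psum (cop H h) (\<lambda>a b. f (act V a v) (act W b w))"
  using f by (simp add: HM_morphism2_def psum_def)

lemma morphism2_left:
  assumes w: "w \<in> carr W"
  shows "v \<in> carr V \<Longrightarrow> v' \<in> carr V \<Longrightarrow> f (v + v') w = f v w + f v' w"
    "v \<in> carr V \<Longrightarrow> v' \<in> carr V \<Longrightarrow> f (v - v') w = f v w - f v' w"
    "v \<in> carr V \<Longrightarrow> f (- v) w = - f v w"
    "f 0 w = 0"
    "v \<in> carr V \<Longrightarrow> f (smul V c v) w = smul X c (f v w)"
    "(\<And>a b. F a b \<in> carr V) \<Longrightarrow> f (psum xs F) w = psum xs (\<lambda>a b. f (F a b) w)"
    "(\<And>a b c. G a b c \<in> carr V) \<Longrightarrow> f (tsum ys G) w = tsum ys (\<lambda>a b c. f (G a b c) w)"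
    "lin H V g \<Longrightarrow> lin H X (\<lambda>x. f (g x) w)"
  by (rule klinear_add[OF V X morphism2_klinear(2)[OF w]] klinear_diff[OF V X morphism2_klinear(2)[OF w]]
      klinear_uminus[OF V X morphism2_klinear(2)[OF w]] klinear_zero[OF V X morphism2_klinear(2)[OF w]]
      klinear_smul[OF V X morphism2_klinear(2)[OF w]] klinear_psum[OF V X morphism2_klinear(2)[OF w]]
      klinear_tsum[OF V X morphism2_klinear(2)[OF w]] lin_klinear[OF V X morphism2_klinear(2)[OF w]]; assumption)+

lemma morphism2_right:
  assumes v: "v \<in> carr V"
  shows "w \<in> carr W \<Longrightarrow> w' \<in> carr W \<Longrightarrow> f v (w + w') = f v w + f v w'"
    "w \<in> carr W \<Longrightarrow> w' \<in> carr W \<Longrightarrow> f v (w - w') = f v w - f v w'"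
    "w \<in> carr W \<Longrightarrow> f v (- w) = - f v w"
    "f v 0 = 0"
    "w \<in> carr W \<Longrightarrow> f v (smul W c w) = smul X c (f v w)"
    "(\<And>a b. F a b \<in> carr W) \<Longrightarrow> f v (psum xs F) = psum xs (\<lambda>a b. f v (F a b))"
    "(\<And>a b c. G a b c \<in> carr W) \<Longrightarrow> f v (tsum ys G) = tsum ys (\<lambda>a b c. f v (G a b c))"
    "lin H W g \<Longrightarrow> lin H X (\<lambda>x. f v (g x))"
  by (rule klinear_add[OF W X morphism2_klinear(1)[OF v]] klinear_diff[OF W X morphism2_klinear(1)[OF v]]
      klinear_uminus[OF W X morphism2_klinear(1)[OF v]] klinear_zero[OF W X morphism2_klinear(1)[OF v]]
      klinear_smul[OF W X morphism2_klinear(1)[OF v]] klinear_psum[OF W X morphism2_klinear(1)[OF v]]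
      klinear_tsum[OF W X morphism2_klinear(1)[OF v]] lin_klinear[OF W X morphism2_klinear(1)[OF v]]; assumption)+

lemmas morphism2_simps = morphism2_in_carr morphism2_in_grade morphism2_left morphism2_right

end

end

section \<open>Evaluation and currying as mutually inverse operations\<close>

context quasi_hopf
begin

text \<open>Quasi-coassociativity multiplied by \<phi> on the right. In this form it expresses the
  equivariance of the associator \<Phi>.\<close>

lemma coassoc_phi:
  assumes X [simp]: "HM_object H X" and F: "lin3 H X F"
  shows "DD h (\<lambda>a b. DD b (\<lambda>b1 b2. PP (\<lambda>x y z. F (a * x) (b1 * y) (b2 * z)))) =
    PP (\<lambda>x y z. DD h (\<lambda>a b. DD a (\<lambda>a1 a2. F (x * a1) (y * a2) (z * b))))"
proof -
  have [simp]: "lin H X (\<lambda>x. F (e x) b c)" "lin H X (\<lambda>x. F b (e x) c)" "lin H X (\<lambda>x. F b c (e x))"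
    if "lin H (reg H) e" for e b c
    using F that by (auto simp: lin3_def lin_iff)
  have *: "QQ (\<lambda>x' y' z'. PP (\<lambda>u v w. F (a * (x' * u)) (b * (y' * v)) (c * (z' * w)))) = F a b c" for a b c
    by (subst phi_inv_phi[of X]) (simp_all add: lin3_def)
  have "DD h (\<lambda>a b. DD b (\<lambda>b1 b2. PP (\<lambda>u v w. F (a * u) (b1 * v) (b2 * w)))) =
    PP (\<lambda>x y z. DD h (\<lambda>a b. DD a (\<lambda>a1 a2. QQ (\<lambda>x' y' z'.
       PP (\<lambda>u v w. F (x * a1 * x' * u) (y * a2 * y' * v) (z * b * z' * w))))))"
    by (rule coassoc[of X]) (simp add: lin3_def)
  also have "\<dots> = PP (\<lambda>x y z. DD h (\<lambda>a b. DD a (\<lambda>a1 a2. QQ (\<lambda>x' y' z'.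
       PP (\<lambda>u v w. F (x * a1 * (x' * u)) (y * a2 * (y' * v)) (z * b * (z' * w)))))))"
    by (simp only: mult.assoc)
  finally show ?thesis by (simp only: *)
qed

lemma coassoc_phi_inv:
  assumes X [simp]: "HM_object H X" and F: "lin3 H X F"
  shows "DD h (\<lambda>a b. DD a (\<lambda>a1 a2. QQ (\<lambda>x y z. F (a1 * x) (a2 * y) (b * z)))) =
    QQ (\<lambda>x y z. DD h (\<lambda>a b. DD b (\<lambda>b1 b2. F (x * a) (y * b1) (z * b2))))"
proof -
  have [simp]: "lin H X (\<lambda>x. F (e x) b c)" "lin H X (\<lambda>x. F b (e x) c)" "lin H X (\<lambda>x. F b c (e x))"
    if "lin H (reg H) e" for e b c
    using F that by (auto simp: lin3_def lin_iff)
  have "QQ (\<lambda>u v w. DD h (\<lambda>a b. DD b (\<lambda>b1 b2. F (u * a) (v * b1) (w * b2)))) =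
     QQ (\<lambda>u v w. PP (\<lambda>x y z. DD h (\<lambda>a b. DD a (\<lambda>a1 a2. QQ (\<lambda>x' y' z'.
       F (u * (x * a1 * x')) (v * (y * a2 * y')) (w * (z * b * z')))))))"
    by (subst coassoc[of X]) (simp_all add: lin3_def)
  also have "\<dots> = QQ (\<lambda>u v w. PP (\<lambda>x y z. DD h (\<lambda>a b. DD a (\<lambda>a1 a2. QQ (\<lambda>x' y' z'.
       F ((u * x) * (a1 * x')) ((v * y) * (a2 * y')) ((w * z) * (b * z')))))))"
    by (simp only: mult.assoc)
  also have "\<dots> = DD h (\<lambda>a b. DD a (\<lambda>a1 a2. QQ (\<lambda>x' y' z'.
       F (1 * (a1 * x')) (1 * (a2 * y')) (1 * (b * z')))))"
    by (rule phi_inv_phi[of X]) (simp add: lin3_def lin2_def)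
  finally show ?thesis by simp
qed

text \<open>
  \<open>\<zeta>\<close> applied to the universal argument: a linear map \<open>V \<otimes> W \<rightarrow> X\<close> and a fixed \<open>v\<close> (or a fixed \<open>v \<otimes> v'\<close>)
  give the family \<open>p \<mapsto> f ((p \<triangleright> v) \<otimes> -)\<close> indexed by \<open>H\<close>, so one lemma serves both currying maps.
\<close>

definition gcurry where
  "gcurry W f = on_carr W (\<lambda>w. QQ (\<lambda>x y z. f x (act W (y * \<beta> * S z) w)))"

text \<open>What equivariance of a map becomes once its first argument is frozen: the index p
  already acts on that argument, so a further element multiplies p from the left.\<close>

definition equivariant_family where
  "equivariant_family V W f \<longleftrightarrow>
     (\<forall>v\<in>carr V. lin H W (\<lambda>p. f p v)) \<and> (\<forall>p. klinear V W (f p)) \<and>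
     (\<forall>g p. \<forall>v\<in>carr V. act W g (f p v) = DD g (\<lambda>a b. f (a * p) (act V b v)))"

lemma curry_map_gcurry: "curry_map H V W f v = gcurry W (\<lambda>p. f (act V p v))"
  by (simp add: curry_map_def gcurry_def tsum_def)

lemma curry_map2_gcurry:
  "curry_map2 H V V' W f v v' = gcurry W (\<lambda>p w. DD p (\<lambda>a b. f (act V a v) (act V' b v') w))"
  by (simp add: curry_map2_def gcurry_def tsum_def psum_def)

lemma ev_eq: "ev H V W L v = PP (\<lambda>x y z. act W x (L (act V (S y * \<alpha> * z) v)))"
  by (simp add: ev_def uncurry_map_def tsum_def)

context
  fixes V :: "('k, 'h, 'v::ab_group_add, 'm) gmod_scheme"
    and W :: "('k, 'h, 'w::ab_group_add, 'n) gmod_scheme"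
  assumes V [simp]: "HM_object H V" and W [simp]: "HM_object H W"
begin

lemma ihom_act_app: "v \<in> carr V \<Longrightarrow> act (ihom H V W) h L v = DD h (\<lambda>a b. act W a (L (act V (S b) v)))"
  by (simp add: ihom_act[OF V W] on_carr_def)

lemma ihom_smul_app: "v \<in> carr V \<Longrightarrow> smul (ihom H V W) c L v = smul W c (L v)"
  by (simp add: ihom_smul[OF V W] on_carr_def)

text \<open>The substance is equivariance. The action on L puts S of a coproduct leg inside,
  \<open>coassoc_phi\<close> brings that leg and the one acting on v to the two sides of \<alpha>,
  and the antipode axiom turns them into a counit.\<close>

lemma HM_morphism2_ev: "HM_morphism2 H (ihom H V W) V W (ev H V W)"
proof -
  note lin = ihom_carrD(1)[OF V W]
  have app: "L v \<in> carr W" if "L \<in> carr (ihom H V W)" "v \<in> carr V" for L v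
    using klinear_in_carr[OF V W ihom_carrD(1)[OF V W that(1)] that(2)] .
  have linL: "lin H W (\<lambda>x. L (g x))" if "L \<in> carr (ihom H V W)" "lin H V g" for L g
    using lin_klinear[OF V W lin[OF that(1)] that(2)] .
  have 1: "klinear V W (\<lambda>v. ev H V W L v)" if "L \<in> carr (ihom H V W)" for L
    unfolding ev_eq by (intro klinear_tsumI[OF V W] klinear_actI[OF V W] lin that)
  have 2: "klinear (ihom H V W) W (\<lambda>L. ev H V W L v)" if "v \<in> carr V" for v
    using that unfolding klinear_def ev_eq
    by (auto simp: tsum_add smul_tsum ihom_smul_app app simp del: act_mult)
  have 3: "ev H V W L v \<in> grade W (m + n)" if "L \<in> grade (ihom H V W) m" "v \<in> grade V n" for L v m n
    unfolding ev_eq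
  proof (intro tsum_in_grade[OF W] act_in_grade[OF W])
    fix x y z
    have "act V (S y * \<alpha> * z) v \<in> grade V n" using that by simp
    then show "L (act V (S y * \<alpha> * z) v) \<in> grade W (m + n)"
      using that(1) unfolding ihom_grade_iff[OF V W] add.commute[of m n] by blast
  qed
  have 4: "DD h (\<lambda>a b. ev H V W (act (ihom H V W) a L) (act V b v)) = act W h (ev H V W L v)"
    if L: "L \<in> carr (ihom H V W)" and v: "v \<in> carr V" for h L v
  proof -
    note [simp] = app[OF L] linL[OF L]
    define F where "F p q r = act W p (L (act V (S q * \<alpha> * r) v))" for p q r
    have [simp]: "lin H W (\<lambda>x. F (e x) b c)" "lin H W (\<lambda>x. F b (e x) c)" "lin H W (\<lambda>x. F b c (e x))"
      if "lin H (reg H) e" for e b c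
      using that L v by (auto simp: F_def simp del: act_mult)
    have FW [simp]: "F a b c \<in> carr W" for a b c using L v by (simp add: F_def)
    have "DD h (\<lambda>a b. ev H V W (act (ihom H V W) a L) (act V b v)) =
       DD h (\<lambda>a b. PP (\<lambda>x y z. DD a (\<lambda>a1 a2. F (x * a1) (y * a2) (z * b))))"
      using L v by (simp add: ev_eq ihom_act_app F_def mult.assoc)
    also have "\<dots> = PP (\<lambda>x y z. DD h (\<lambda>a b. DD a (\<lambda>a1 a2. F (x * a1) (y * a2) (z * b))))"
      by (rule sum_norm)
    also have "\<dots> = DD h (\<lambda>a b. DD b (\<lambda>b1 b2. PP (\<lambda>x y z. F (a * x) (b1 * y) (b2 * z))))"
      by (rule coassoc_phi[OF W, symmetric]) (simp add: lin3_def)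
    also have "\<dots> = PP (\<lambda>x y z. DD h (\<lambda>a b. DD b (\<lambda>b1 b2. F (a * x) (b1 * y) (b2 * z))))"
      by (simp only: sum_norm)
    also have "\<dots> = PP (\<lambda>x y z. DD h (\<lambda>a b. smul W (\<epsilon> b) (F (a * x) y z)))"
    proof -
      have "DD b (\<lambda>b1 b2. F a (b1 * y) (b2 * z)) = smul W (\<epsilon> b) (F a y z)" for a b y z
        using antipode_alpha[OF W, of "\<lambda>p. act W a (L (act V (S y * p * z) v))" b] L v
        by (simp add: F_def mult.assoc)
      then show ?thesis by (simp only:)
    qed
    also have "\<dots> = PP (\<lambda>x y z. F (h * x) y z)"
    proof -
      have "DD h (\<lambda>a b. smul W (\<epsilon> b) (F (a * x) y z)) = F (h * x) y z" for x y z
        by (rule counit_right[OF W]) simp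
      then show ?thesis by (simp only:)
    qed
    also have "\<dots> = act W h (ev H V W L v)"
      using L v by (simp add: ev_eq F_def)
    finally show ?thesis .
  qed
  show ?thesis
    unfolding HM_morphism2_def using 1 2 3 4 by (auto simp: psum_def)
qed

lemmas ev_simps [simp] = morphism2_simps[OF HM_object_ihom[OF V W] V W HM_morphism2_ev]
lemmas ev_act = morphism2_act[OF HM_object_ihom[OF V W] V W HM_morphism2_ev]

context
  fixes f
  assumes f: "equivariant_family V W f"
begin

lemma family_simps [simp]:
  "v \<in> carr V \<Longrightarrow> f p v \<in> carr W"
  "v \<in> carr V \<Longrightarrow> lin H (reg H) e \<Longrightarrow> lin H W (\<lambda>x. f (e x) v)"
  "lin H V g \<Longrightarrow> lin H W (\<lambda>x. f p (g x))"
proof -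
  note * = f[unfolded equivariant_family_def]
  show "v \<in> carr V \<Longrightarrow> f p v \<in> carr W" using * by (auto simp: lin_iff)
  show "v \<in> carr V \<Longrightarrow> lin H (reg H) e \<Longrightarrow> lin H W (\<lambda>x. f (e x) v)" using * by (auto simp: lin_iff)
  show "lin H V g \<Longrightarrow> lin H W (\<lambda>x. f p (g x))" using * lin_klinear[OF V W, of "f p" g] by blast
qed

lemma family_act: "v \<in> carr V \<Longrightarrow> act W g (f p v) = DD g (\<lambda>a b. f (a * p) (act V b v))"
  using f by (simp add: equivariant_family_def)

lemma gcurry_klinear: "klinear V W (gcurry V f)"
  unfolding gcurry_def klinear_on_carr[OF V W]
proof (rule klinear_tsumI[OF V W])
  fix x y z
  have "klinear V W (f x)" using f by (simp add: equivariant_family_def)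
  then show "klinear V W (\<lambda>w. f x (act V (y * \<beta> * S z) w))"
    by (auto simp: klinear_def)
qed

lemma gcurry_in_grade:
  assumes "\<And>p m v. v \<in> grade V m \<Longrightarrow> f p v \<in> grade W (m + n)"
  shows "gcurry V f \<in> grade (ihom H V W) n"
  unfolding ihom_grade_iff[OF V W]
proof (intro conjI allI ballI impI gcurry_klinear)
  fix m v assume v: "v \<in> grade V m"
  then have "v \<in> carr V" by (rule grade_subset_carr[OF V])
  then show "gcurry V f v \<in> grade W (m + n)"
    using v by (simp add: gcurry_def on_carr_def assms del: act_mult)
qed (simp add: gcurry_def on_carr_def)

lemma ev_gcurry:
  assumes v: "v \<in> carr V"
  shows "ev H V W (gcurry V f) v = f 1 v"
proof -
  have "ev H V W (gcurry V f) v =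
    PP (\<lambda>x y z. QQ (\<lambda>x' y' z'. DD x (\<lambda>a b. f (a * x') (act V (b * y' * \<beta> * S z' * S y * \<alpha> * z) v))))"
    using v by (simp add: ev_eq gcurry_def on_carr_def family_act)
  also have "\<dots> = f 1 (act V 1 v)"
    using v by (intro zigzag_left[OF W]) (simp add: lin2_def)
  finally show ?thesis using v by simp
qed

lemma act_gcurry: "act (ihom H V W) h (gcurry V f) = gcurry V (\<lambda>p. f (p * h))"
proof (rule hom_ext[OF V W])
  fix v assume v: "v \<in> carr V"
  define F where "F p q r = f p (act V (q * \<beta> * S r) v)" for p q r
  have [simp]: "lin H W (\<lambda>x. F (e x) b c)" "lin H W (\<lambda>x. F b (e x) c)" "lin H W (\<lambda>x. F b c (e x))"
    if "lin H (reg H) e" for e b c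
    using that v by (auto simp: F_def simp del: act_mult)
  have FW [simp]: "F a b c \<in> carr W" for a b c using v by (simp add: F_def)
  have "act (ihom H V W) h (gcurry V f) v =
      DD h (\<lambda>a b. QQ (\<lambda>x y z. DD a (\<lambda>a1 a2. F (a1 * x) (a2 * y) (b * z))))"
    using v by (simp add: ihom_act_app gcurry_def on_carr_def F_def family_act)
  also have "\<dots> = DD h (\<lambda>a b. DD a (\<lambda>a1 a2. QQ (\<lambda>x y z. F (a1 * x) (a2 * y) (b * z))))"
    by (simp only: sum_norm)
  also have "\<dots> = QQ (\<lambda>x y z. DD h (\<lambda>a b. DD b (\<lambda>b1 b2. F (x * a) (y * b1) (z * b2))))"
    by (rule coassoc_phi_inv[OF W]) (simp add: lin3_def)
  also have "\<dots> = QQ (\<lambda>x y z. DD h (\<lambda>a b. smul W (\<epsilon> b) (F (x * a) y z)))"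
  proof -
    have "DD b (\<lambda>b1 b2. F a (y * b1) (z * b2)) = smul W (\<epsilon> b) (F a y z)" for a b y z
      using antipode_beta[OF W, of "\<lambda>p. f a (act V (y * p * S z) v)" b] v
      by (simp add: F_def mult.assoc)
    then show ?thesis by (simp only:)
  qed
  also have "\<dots> = QQ (\<lambda>x y z. F (x * h) y z)"
  proof -
    have "DD h (\<lambda>a b. smul W (\<epsilon> b) (F (x * a) y z)) = F (x * h) y z" for x y z
      by (rule counit_right[OF W]) simp
    then show ?thesis by (simp only:)
  qed
  also have "\<dots> = gcurry V (\<lambda>p. f (p * h)) v"
    using v by (simp add: gcurry_def on_carr_def F_def)
  finally show "act (ihom H V W) h (gcurry V f) v = gcurry V (\<lambda>p. f (p * h)) v" .
qed (auto simp: ihom_act[OF V W] gcurry_def on_carr_def)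

end

lemma gcurry_ev:
  assumes L: "L \<in> carr (ihom H V W)"
  shows "gcurry V (\<lambda>p. ev H V W (act (ihom H V W) p L)) = L"
proof (rule hom_ext[OF V W])
  fix v assume v: "v \<in> carr V"
  have linL [simp]: "lin H W (\<lambda>x. L (g x))" if "lin H V g" for g
    using lin_klinear[OF V W ihom_carrD(1)[OF V W L] that] .
  have app [simp]: "L v \<in> carr W" if "v \<in> carr V" for v
    using klinear_in_carr[OF V W ihom_carrD(1)[OF V W L] that] .
  have "gcurry V (\<lambda>p. ev H V W (act (ihom H V W) p L)) v =
     QQ (\<lambda>x' y' z'. PP (\<lambda>x y z. DD x' (\<lambda>a b. act W (x * a) (L (act V (S b * S y * \<alpha> * z * y' * \<beta> * S z') v)))))"
    using v L by (simp add: gcurry_def on_carr_def ev_eq ihom_act_app)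
  also have "\<dots> = PP (\<lambda>x y z. QQ (\<lambda>x' y' z'. DD x' (\<lambda>a b. act W (x * a) (L (act V (S b * S y * \<alpha> * z * y' * \<beta> * S z') v)))))"
    by (rule tsum_tsum)
  also have "\<dots> = act W 1 (L (act V 1 v))"
    using v L by (intro zigzag_right[OF W]) (simp add: lin2_def)
  finally show "gcurry V (\<lambda>p. ev H V W (act (ihom H V W) p L)) v = L v" using v by simp
qed (use L in \<open>auto simp: gcurry_def on_carr_def ihom_carrD(2)[OF V W]\<close>)

text \<open>By \<open>gcurry_ev\<close> an element of the internal hom is rebuilt from these
  evaluations. This is the test used for equations such as \<open>icomp_assoc\<close>.\<close>

lemma ihom_eqI:
  assumes "L \<in> carr (ihom H V W)" "M \<in> carr (ihom H V W)"
    and "\<And>p v. v \<in> carr V \<Longrightarrow> ev H V W (act (ihom H V W) p L) v = ev H V W (act (ihom H V W) p M) v"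
  shows "L = M"
proof -
  have "gcurry V (\<lambda>p. ev H V W (act (ihom H V W) p L)) = gcurry V (\<lambda>p. ev H V W (act (ihom H V W) p M))"
    unfolding gcurry_def on_carr_def using assms(3) by (intro ext) simp
  then show ?thesis using assms(1,2) by (simp add: gcurry_ev)
qed

end

end

section \<open>Internal composition\<close>

context quasi_hopf
begin

definition comp_family where
  "comp_family V L M p v = DD p (\<lambda>a b. PP (\<lambda>x y z. ev H V V (act (iend H V) (x * a) L) (ev H V V (act (iend H V) (y * b) M) (act V z v))))"

context
  fixes V :: "('k, 'h, 'v::ab_group_add, 'm) gmod_scheme"
  assumes V [simp]: "HM_object H V"
begin

abbreviation "E \<equiv> iend H V"
abbreviation "EV \<equiv> ev H V V"
abbreviation comp (infixl "\<bullet>" 70) where "L \<bullet> M \<equiv> icomp H V V V L M"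

text \<open>Two uses of \<open>ev_act\<close> distribute g by (id \<otimes> \<Delta>)\<Delta>;
  \<open>coassoc_phi\<close> converts this to (\<Delta> \<otimes> id)\<Delta>, as the bracketing (L
  \<otimes> M) \<otimes> v requires.\<close>

lemma ev_ev_act:
  assumes L: "L \<in> carr E" and M: "M \<in> carr E" and v: "v \<in> carr V"
  shows "act V g (PP (\<lambda>x y z. EV (act E x L) (EV (act E y M) (act V z v)))) =
    DD g (\<lambda>a b. DD a (\<lambda>a1 a2. PP (\<lambda>x y z. EV (act E (x * a1) L) (EV (act E (y * a2) M) (act V (z * b) v)))))"
proof -
  let ?F = "\<lambda>p q r. EV (act E p L) (EV (act E q M) (act V r v))"
  have "act V g (PP ?F) = PP (\<lambda>x y z. DD g (\<lambda>a b. DD b (\<lambda>b1 b2. ?F (a * x) (b1 * y) (b2 * z))))"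
    using L M v by (simp add: ev_act)
  also have "\<dots> = DD g (\<lambda>a b. DD b (\<lambda>b1 b2. PP (\<lambda>x y z. ?F (a * x) (b1 * y) (b2 * z))))"
    by (simp only: sum_norm)
  also have "\<dots> = PP (\<lambda>x y z. DD g (\<lambda>a b. DD a (\<lambda>a1 a2. ?F (x * a1) (y * a2) (z * b))))"
    by (rule coassoc_phi[OF V]) (use L M v in \<open>simp add: lin3_def\<close>)
  also have "\<dots> = DD g (\<lambda>a b. DD a (\<lambda>a1 a2. PP (\<lambda>x y z. ?F (x * a1) (y * a2) (z * b))))"
    by (simp only: sum_norm)
  finally show ?thesis .
qed

lemma icomp_gcurry:
  assumes "L \<in> carr E" "M \<in> carr E"
  shows "L \<bullet> M = gcurry V (comp_family V L M)"
proof -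
  have "L \<bullet> M = gcurry V (\<lambda>p w. DD p (\<lambda>a b. PP (\<lambda>x y z. EV (act E x (act E a L)) (EV (act E y (act E b M)) (act V z w)))))"
    by (simp add: icomp_def curry_map2_gcurry tsum_def)
  then show ?thesis
    using assms by (simp add: comp_family_def[abs_def])
qed

lemma equivariant_comp_family:
  assumes L [simp]: "L \<in> carr E" and M [simp]: "M \<in> carr E"
  shows "equivariant_family V V (comp_family V L M)"
  unfolding equivariant_family_def
proof (intro conjI ballI allI)
  fix v assume v [simp]: "v \<in> carr V"
  show "lin H V (\<lambda>p. comp_family V L M p v)"
    unfolding comp_family_def by (rule lin_cop[OF V]) (simp_all add: lin2_def del: act_mult)
next
  fix p
  show "klinear V V (comp_family V L M p)"
    unfolding comp_family_def
  proof (intro klinear_psumI[OF V V] klinear_tsumI[OF V V])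
    fix a b x y z
    show "klinear V V (\<lambda>v. EV (act E (x * a) L) (EV (act E (y * b) M) (act V z v)))"
      by (simp add: klinear_def)
  qed
next
  fix g p v assume v [simp]: "v \<in> carr V"
  let ?F = "\<lambda>p q r. EV (act E p L) (EV (act E q M) (act V r v))"
  have "act V g (comp_family V L M p v) = DD p (\<lambda>a b. act V g (PP (\<lambda>x y z. EV (act E x (act E a L)) (EV (act E y (act E b M)) (act V z v)))))"
    by (simp add: comp_family_def)
  also have "\<dots> = DD p (\<lambda>a b. DD g (\<lambda>c d. DD c (\<lambda>c1 c2. PP (\<lambda>x y z. ?F (x * c1 * a) (y * c2 * b) (z * d)))))"
    by (subst ev_ev_act) simp_all
  also have "\<dots> = DD g (\<lambda>c d. DD c (\<lambda>c1 c2. DD p (\<lambda>a b. PP (\<lambda>x y z. ?F (x * c1 * a) (y * c2 * b) (z * d)))))"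
    by (rule HOL.trans[OF psum_psum], rule psum_cong, rule psum_psum)
  also have "\<dots> = DD g (\<lambda>c d. DD (c * p) (\<lambda>a b. PP (\<lambda>x y z. ?F (x * a) (y * b) (z * d))))"
    by (subst cop_mult[OF lin2_def[THEN iffD2], of V]) (simp_all add: mult.assoc)
  also have "\<dots> = DD g (\<lambda>a b. comp_family V L M (a * p) (act V b v))"
    by (simp add: comp_family_def)
  finally show "act V g (comp_family V L M p v) = DD g (\<lambda>a b. comp_family V L M (a * p) (act V b v))" .
qed

lemma icomp_in_grade:
  assumes L: "L \<in> grade E m" and M: "M \<in> grade E n"
  shows "L \<bullet> M \<in> grade E (m + n)"
proof -
  have LM: "L \<in> carr E" "M \<in> carr E"
    using L M by (auto intro!: grade_subset_carr[OF HM_object_ihom[OF V V]])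
  show ?thesis
    unfolding icomp_gcurry[OF LM]
  proof (rule gcurry_in_grade[OF V V equivariant_comp_family[OF LM]])
    fix p k v assume v: "v \<in> grade V k"
    have *: "k + (m + n) = m + (n + k)" by simp
    show "comp_family V L M p v \<in> grade V (k + (m + n))"
      unfolding comp_family_def *
      by (intro psum_in_grade[OF V] tsum_in_grade[OF V] ev_simps(2)[OF V V] act_in_grade[OF V]
          act_in_grade[OF HM_object_ihom[OF V V]] L M v)
  qed
qed

text \<open>The defining property of internal composition: after evaluation \<beta> and the inverse
  associator of the currying are gone.\<close>

lemma ev_icomp:
  assumes "L \<in> carr E" "M \<in> carr E" "v \<in> carr V"
  shows "EV (L \<bullet> M) v = PP (\<lambda>x y z. EV (act E x L) (EV (act E y M) (act V z v)))"
proof -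
  have "EV (L \<bullet> M) v = comp_family V L M 1 v"
    using assms by (simp add: icomp_gcurry ev_gcurry[OF V V equivariant_comp_family])
  also have "\<dots> = PP (\<lambda>x y z. EV (act E (x * 1) L) (EV (act E (y * 1) M) (act V z v)))"
    unfolding comp_family_def by (rule cop_one[of V]) (use assms in \<open>simp add: lin2_def del: act_mult\<close>)
  finally show ?thesis by simp
qed

lemma HM_morphism2_icomp: "HM_morphism2 H E E E (icomp H V V V)"
proof -
  have E: "HM_object H E" by simp
  have fam: "comp_family V L M p v \<in> carr V" if "L \<in> carr E" "M \<in> carr E" "v \<in> carr V" for L M p v
    using that unfolding comp_family_def by (simp del: act_mult)
  have bilin: "(L + L') \<bullet> M = L \<bullet> M + L' \<bullet> M" "L \<bullet> (M + M') = L \<bullet> M + L \<bullet> M'"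
    "smul E c L \<bullet> M = smul E c (L \<bullet> M)" "L \<bullet> smul E c M = smul E c (L \<bullet> M)"
    if "L \<in> carr E" "L' \<in> carr E" "M \<in> carr E" "M' \<in> carr E" for L L' M M' c
  proof -
    have "comp_family V (L + L') M p v = comp_family V L M p v + comp_family V L' M p v"
      "comp_family V L (M + M') p v = comp_family V L M p v + comp_family V L M' p v"
      "comp_family V (smul E c L) M p v = smul V c (comp_family V L M p v)"
      "comp_family V L (smul E c M) p v = smul V c (comp_family V L M p v)" if "v \<in> carr V" for p v
      using that \<open>L \<in> carr E\<close> \<open>L' \<in> carr E\<close> \<open>M \<in> carr E\<close> \<open>M' \<in> carr E\<close>
      unfolding comp_family_def by (simp_all add: tsum_add psum_add smul_tsum smul_psum del: act_mult)
    moreover have "smul E c N v = (if v \<in> carr V then smul V c (N v) else 0)" for N v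
      by (simp add: ihom_smul[OF V V] on_carr_def)
    ultimately show "(L + L') \<bullet> M = L \<bullet> M + L' \<bullet> M" "L \<bullet> (M + M') = L \<bullet> M + L \<bullet> M'"
      "smul E c L \<bullet> M = smul E c (L \<bullet> M)" "L \<bullet> smul E c M = smul E c (L \<bullet> M)"
      using that by (auto simp: icomp_gcurry gcurry_def on_carr_def fun_eq_iff tsum_add smul_tsum fam simp del: act_mult)
  qed
  \<comment> \<open>\<open>icomp_in_grade\<close> covers homogeneous factors only; bilinearity
    extends closure to the carrier by induction on each factor.\<close>
  have *: "L \<bullet> M \<in> carr E" if L: "L \<in> carr E" and M: "M \<in> carr E" for L M
  proof -
    show ?thesis
      using L
    proof (induction rule: carr_induct[OF E, consumes 1, case_names hom add])
      case L: (hom m L)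
      then have L': "L \<in> carr E" by (rule grade_subset_carr[OF E])
      show ?case
        using M
      proof (induction rule: carr_induct[OF E, consumes 1, case_names hom add])
        case (hom n M)
        show ?case by (rule grade_subset_carr[OF E icomp_in_grade[OF L hom]])
      next
        case (add M M')
        show ?case unfolding bilin(2)[OF L' L' add(1,2)] by (rule add_in_carr[OF E add(3,4)])
      qed
    next
      case (add L L')
      show ?case unfolding bilin(1)[OF add(1,2) M M] by (rule add_in_carr[OF E add(3,4)])
    qed
  qed
  have act: "DD h (\<lambda>a b. act E a L \<bullet> act E b M) = act E h (L \<bullet> M)" if L [simp]: "L \<in> carr E" and M [simp]: "M \<in> carr E" for h L M
  proof -
    have fm: "comp_family V L M (p * h) v = DD h (\<lambda>a b. comp_family V (act E a L) (act E b M) p v)" if v [simp]: "v \<in> carr V" for p v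
    proof -
      have "comp_family V L M (p * h) v = DD p (\<lambda>a b. DD h (\<lambda>c d. PP (\<lambda>x y z. EV (act E (x * (a * c)) L) (EV (act E (y * (b * d)) M) (act V z v)))))"
        unfolding comp_family_def by (rule cop_mult[of V]) (simp add: lin2_def del: act_mult)
      also have "\<dots> = DD h (\<lambda>c d. DD p (\<lambda>a b. PP (\<lambda>x y z. EV (act E (x * (a * c)) L) (EV (act E (y * (b * d)) M) (act V z v)))))"
        by (rule psum_psum)
      finally show ?thesis by (simp add: comp_family_def)
    qed
    have "act E h (L \<bullet> M) = gcurry V (\<lambda>p. comp_family V L M (p * h))"
      by (simp add: icomp_gcurry act_gcurry[OF V V equivariant_comp_family])
    also have "\<dots> = DD h (\<lambda>a b. gcurry V (comp_family V (act E a L) (act E b M)))"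
      by (rule ext) (simp add: psum_app gcurry_def on_carr_def fm tsum_psum)
    finally show ?thesis by (simp add: icomp_gcurry)
  qed
  show ?thesis
    unfolding HM_morphism2_def klinear_def
    using * bilin act icomp_in_grade by (simp add: psum_def)
qed

lemmas icomp_simps [simp] = morphism2_simps[OF HM_object_ihom[OF V V] HM_object_ihom[OF V V] HM_object_ihom[OF V V] HM_morphism2_icomp]
lemmas icomp_act = morphism2_act[OF HM_object_ihom[OF V V] HM_object_ihom[OF V V] HM_object_ihom[OF V V] HM_morphism2_icomp]

text \<open>After evaluation both bracketings are threefold nested evaluations of L, M, N at v; they
  differ precisely by the two sides of the pentagon.\<close>

lemma icomp_assoc_ev:
  assumes L [simp]: "L \<in> carr E" and M [simp]: "M \<in> carr E" and N [simp]: "N \<in> carr E" and v [simp]: "v \<in> carr V"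
  shows "EV (L \<bullet> M \<bullet> N) v = PP (\<lambda>x y z. EV (act E x L \<bullet> (act E y M \<bullet> act E z N)) v)"
proof -
  define G where "G a b c d = EV (act E a L) (EV (act E b M) (EV (act E c N) (act V d v)))" for a b c d
  have "EV (L \<bullet> M \<bullet> N) v =
     PP (\<lambda>x y z. DD x (\<lambda>a b. PP (\<lambda>x' y' z'. DD z' (\<lambda>z1 z2. G (x' * a) (y' * b) (z1 * y) (z2 * z)))))"
    by (simp add: ev_icomp icomp_act ev_act G_def)
  also have "\<dots> = PP (\<lambda>x' y' z'. DD z' (\<lambda>z1 z2. PP (\<lambda>x y z. DD x (\<lambda>a b. G (x' * a) (y' * b) (z1 * y) (z2 * z)))))"
    by (simp only: sum_norm) (rule HOL.trans[OF tsum_tsum], rule tsum_cong, rule tsum_cong, rule psum_psum)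
  also have "\<dots> = PP (\<lambda>x y z. PP (\<lambda>x' y' z'. DD y' (\<lambda>y1 y2. PP (\<lambda>u v w. G (x' * u) (x * y1 * v) (y * y2 * w) (z * z')))))"
    by (rule pentagon[of V]) (simp add: lin4_def G_def)
  also have "\<dots> = PP (\<lambda>u v w. PP (\<lambda>x' y' z'. DD y' (\<lambda>y1 y2. PP (\<lambda>x y z. G (x' * u) (x * y1 * v) (y * y2 * w) (z * z')))))"
    by (simp only: sum_norm) (rule HOL.trans[OF tsum_tsum], rule HOL.trans[OF tsum_cong[OF tsum_tsum]], rule tsum_tsum)
  also have "\<dots> = PP (\<lambda>x y z. EV (act E x L \<bullet> (act E y M \<bullet> act E z N)) v)"
    by (simp add: ev_icomp icomp_act ev_act G_def)
  finally show ?thesis .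
qed

text \<open>The evaluated identity has to be known for every p acting on both sides;
  \<open>coassoc_phi\<close> carries the legs of p across the associator.\<close>

lemma icomp_assoc:
  assumes L [simp]: "L \<in> carr E" and M [simp]: "M \<in> carr E" and N [simp]: "N \<in> carr E"
  shows "L \<bullet> M \<bullet> N = PP (\<lambda>x y z. act E x L \<bullet> (act E y M \<bullet> act E z N))"
proof (rule ihom_eqI[OF V V])
  fix p v assume v [simp]: "v \<in> carr V"
  let ?F = "\<lambda>a b c. EV (act E a L \<bullet> (act E b M \<bullet> act E c N)) v"
  have "EV (act E p (L \<bullet> M \<bullet> N)) v = DD p (\<lambda>a b. DD a (\<lambda>c d. PP (\<lambda>x y z. ?F (x * c) (y * d) (z * b))))"
    by (simp add: icomp_act icomp_assoc_ev)
  also have "\<dots> = PP (\<lambda>x y z. DD p (\<lambda>a b. DD a (\<lambda>c d. ?F (x * c) (y * d) (z * b))))"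
    by (simp only: sum_norm)
  also have "\<dots> = DD p (\<lambda>a b. DD b (\<lambda>c d. PP (\<lambda>x y z. ?F (a * x) (c * y) (d * z))))"
    by (rule coassoc_phi[OF V, symmetric]) (simp add: lin3_def)
  also have "\<dots> = PP (\<lambda>x y z. DD p (\<lambda>a b. DD b (\<lambda>c d. ?F (a * x) (c * y) (d * z))))"
    by (simp only: sum_norm)
  also have "\<dots> = EV (act E p (PP (\<lambda>x y z. act E x L \<bullet> (act E y M \<bullet> act E z N)))) v"
    by (simp add: icomp_act)
  finally show "EV (act E p (L \<bullet> M \<bullet> N)) v = EV (act E p (PP (\<lambda>x y z. act E x L \<bullet> (act E y M \<bullet> act E z N)))) v" .
qed simp_all

end

end

section \<open>The braiding\<close>

lemma ksign_simps [simp]: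
  "ksign n (a + b) = ksign n a + ksign n b"
  "ksign n (a - b) = ksign n a - ksign n b"
  "ksign n (- a) = - ksign n a"
  "ksign n 0 = 0"
  by (simp_all add: ksign_def)

lemma ksign_psum: "ksign n (psum xs f) = psum xs (\<lambda>a b. ksign n (f a b))"
  by (simp add: ksign_def psum_uminus)

lemma ksign_tsum: "ksign n (tsum xs f) = tsum xs (\<lambda>a b c. ksign n (f a b c))"
  by (simp add: ksign_def tsum_uminus)

lemma (in qhopf_modules) ksign_closed:
  assumes "HM_object H X"
  shows "x \<in> carr X \<Longrightarrow> ksign n x \<in> carr X"
    "x \<in> grade X m \<Longrightarrow> ksign n x \<in> grade X m"
    "x \<in> carr X \<Longrightarrow> smul X c (ksign n x) = ksign n (smul X c x)"
    "x \<in> carr X \<Longrightarrow> act X h (ksign n x) = ksign n (act X h x)"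
  using assms by (auto simp: ksign_def)

lemma psum_sum: "psum xs (\<lambda>a b. \<Sum>i\<in>I. f i a b) = (\<Sum>i\<in>I. psum xs (f i))"
  by (induction xs) (auto simp: sum.distrib)

locale triangular_qhopf = quasi_hopf H
  for H :: "('k::{comm_ring,monoid_mult}, 'h::{ring,monoid_mult}) qhopf" +
  assumes tri: "triangular H"
begin

lemma qt: "quasitriangular H"
  using tri by (simp add: triangular_def Let_def)

text \<open>The axiom for the opposite coproduct multiplied by R on the right. It gives both
  equivariance and naturality of the braiding.\<close>

lemma R_cop:
  assumes X [simp]: "HM_object H X" and F: "lin2 H X F"
  shows "RR (\<lambda>r1 r2. DD h (\<lambda>a b. F (r1 * a) (r2 * b))) = DD h (\<lambda>a b. RR (\<lambda>r1 r2. F (b * r1) (a * r2)))"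
proof -
  have [simp]: "lin H X (\<lambda>x. F (e x) b)" "lin H X (\<lambda>x. F b (e x))" if "lin H (reg H) e" for e b
    using F that by (auto simp: lin2_def lin_iff)
  obtain R' where len: "\<forall>u\<in>set R'. length u = 2"
    and R': "teq (hsmul H) (R' \<odot> [[a, b]. (a, b) \<leftarrow> Rm H]) [[1, 1]]"
    and D: "\<And>h. teq (hsmul H) [[b, a]. (a, b) \<leftarrow> cop H h] ([[a, b]. (a, b) \<leftarrow> Rm H] \<odot> [[a, b]. (a, b) \<leftarrow> cop H h] \<odot> R')"
    using qt unfolding quasitriangular_def Let_def by blast
  \<comment> \<open>The inverse of R is given as a list of words. Their length 2 allows it to be
    read as a list of pairs, to which the evaluation lemmas apply.\<close>
  define xs where "xs = map (\<lambda>u. (u ! 0, u ! 1)) R'"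
  have "R' = [[a, b]. (a, b) \<leftarrow> xs]"
    unfolding xs_def using len
    by (induction R') (auto simp: numeral_2_eq_2 length_Suc_conv)
  note R' = R'[unfolded this] and D = D[unfolded this]
  have inv: "psum xs (\<lambda>a b. RR (\<lambda>r1 r2. K (a * r1) (b * r2))) = K 1 1" if "lin2 H X K" for K
    using teq_eval[OF R' multi_ap2[OF that]] by (simp add: eval_simps)
  have op: "DD h (\<lambda>a b. K b a) = RR (\<lambda>r1 r2. DD h (\<lambda>a b. psum xs (\<lambda>x y. K (r1 * a * x) (r2 * b * y))))"
    if "lin2 H X K" for K
    using teq_eval[OF D multi_ap2[OF that], of h] by (simp add: eval_simps)
  have *: "psum xs (\<lambda>x y. RR (\<lambda>s1 s2. F (a * (x * s1)) (b * (y * s2)))) = F a b" for a b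
    using inv[of "\<lambda>x y. F (a * x) (b * y)"] by (simp add: lin2_def)
  have "DD h (\<lambda>a b. RR (\<lambda>r1 r2. F (b * r1) (a * r2))) =
     RR (\<lambda>r1 r2. DD h (\<lambda>a b. psum xs (\<lambda>x y. RR (\<lambda>s1 s2. F (r1 * a * x * s1) (r2 * b * y * s2)))))"
    by (rule op) (simp add: lin2_def)
  also have "\<dots> = RR (\<lambda>r1 r2. DD h (\<lambda>a b. F (r1 * a) (r2 * b)))"
    by (simp only: mult.assoc[of "_ * _"] *)
  finally show ?thesis ..
qed

lemma R_R21:
  assumes "lin2 H X F"
  shows "RR (\<lambda>a b. RR (\<lambda>c d. F (a * d) (b * c))) = F 1 1"
proof -
  have "teq (hsmul H) ([[a, b]. (a, b) \<leftarrow> Rm H] \<odot> [[b, a]. (a, b) \<leftarrow> Rm H]) [[1, 1]]"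
    using tri by (simp add: triangular_def Let_def)
  from teq_eval[OF this multi_ap2, OF assms] show ?thesis by (simp add: eval_simps)
qed

lemma hexagon_right:
  assumes "lin3 H X F"
  shows "RR (\<lambda>a b. DD b (\<lambda>b1 b2. F a b1 b2)) =
    QQ (\<lambda>x y z. RR (\<lambda>a b. PP (\<lambda>x' y' z'. RR (\<lambda>c d. QQ (\<lambda>u v w.
      F (z * a * y' * c * u) (x * x' * d * v) (y * b * z' * w))))))"
proof -
  have "teq (hsmul H) [[a, b1, b2]. (a, b) \<leftarrow> Rm H, (b1, b2) \<leftarrow> cop H b]
       ([[z, x, y]. (x, y, z) \<leftarrow> phi_inv H] \<odot> [[a, 1, b]. (a, b) \<leftarrow> Rm H] \<odot>
        [[y, x, z]. (x, y, z) \<leftarrow> phi H] \<odot> [[a, b, 1]. (a, b) \<leftarrow> Rm H] \<odot>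
        [[x, y, z]. (x, y, z) \<leftarrow> phi_inv H])"
    using qt unfolding quasitriangular_def Let_def by blast
  from teq_eval[OF this multi_ap3, OF assms] show ?thesis by (simp add: eval_simps)
qed

lemma hexagon_left:
  assumes "lin3 H X F"
  shows "RR (\<lambda>a b. DD a (\<lambda>a1 a2. F a1 a2 b)) =
    PP (\<lambda>x y z. RR (\<lambda>a b. QQ (\<lambda>x' y' z'. RR (\<lambda>c d. PP (\<lambda>u v w.
      F (y * a * x' * u) (z * z' * c * v) (x * b * y' * d * w))))))"
proof -
  have "teq (hsmul H) [[a1, a2, b]. (a, b) \<leftarrow> Rm H, (a1, a2) \<leftarrow> cop H a]
       ([[y, z, x]. (x, y, z) \<leftarrow> phi H] \<odot> [[a, 1, b]. (a, b) \<leftarrow> Rm H] \<odot>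
        [[x, z, y]. (x, y, z) \<leftarrow> phi_inv H] \<odot> [[1, a, b]. (a, b) \<leftarrow> Rm H] \<odot>
        [[x, y, z]. (x, y, z) \<leftarrow> phi H])"
    using qt unfolding quasitriangular_def Let_def by blast
  from teq_eval[OF this multi_ap3, OF assms] show ?thesis by (simp add: eval_simps)
qed

context
  fixes V :: "('k, 'h, 'v::ab_group_add, 'm) gmod_scheme"
    and W :: "('k, 'h, 'w::ab_group_add, 'n) gmod_scheme"
    and X :: "('k, 'h, 'x::ab_group_add, 'p) gmod_scheme"
    and f :: "'w \<Rightarrow> 'v \<Rightarrow> 'x"
  assumes V [simp]: "HM_object H V" and W [simp]: "HM_object H W" and X [simp]: "HM_object H X"
    and f: "HM_morphism2 H W V X f"
begin

lemma comp_braid_eq: "comp_braid H V W f v w = (\<Sum>m\<in>degs V. \<Sum>n\<in>degs W. ksign (m * n)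
    (RR (\<lambda>r1 r2. f (act W r2 (hcomp W n w)) (act V r1 (hcomp V m v)))))"
  by (simp add: comp_braid_def psum_def)

lemma comp_braid_hom:
  assumes v: "v \<in> grade V m" and w: "w \<in> grade W n"
  shows "comp_braid H V W f v w = ksign (m * n) (RR (\<lambda>r1 r2. f (act W r2 w) (act V r1 v)))"
proof -
  note [simp] = morphism2_simps[OF W V X f]
  have [simp]: "v \<in> carr V" "w \<in> carr W" using v w grade_subset_carr[OF V] grade_subset_carr[OF W] by blast+
  let ?x = "ksign (m * n) (RR (\<lambda>r1 r2. f (act W r2 w) (act V r1 v)))"
  have "ksign (m * j) (RR (\<lambda>r1 r2. f (act W r2 (hcomp W j w)) (act V r1 v))) = (if j = n then ?x else 0)" for j
    by (simp add: hcomp_grade[OF W w])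
  \<comment> \<open>If n does not occur in \<open>degs W\<close>, all terms of the sum vanish, and
    \<open>?x\<close> is 0 as well because w = 0.\<close>
  then have "(\<Sum>j\<in>degs W. ksign (m * j) (RR (\<lambda>r1 r2. f (act W r2 (hcomp W j w)) (act V r1 v)))) = ?x"
    using grade_eq_zero[OF W w] by (auto simp: sum.delta)
  then have "(\<Sum>j\<in>degs W. ksign (i * j) (RR (\<lambda>r1 r2. f (act W r2 (hcomp W j w)) (act V r1 (hcomp V i v))))) =
      (if i = m then ?x else 0)" for i
    by (simp add: hcomp_grade[OF V v])
  then have "comp_braid H V W f v w = (\<Sum>i\<in>degs V. if i = m then ?x else 0)"
    by (simp add: comp_braid_eq)
  also have "\<dots> = ?x"
    using grade_eq_zero[OF V v] by (auto simp: sum.delta)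
  finally show ?thesis .
qed

lemma HM_morphism2_comp_braid: "HM_morphism2 H V W X (comp_braid H V W f)"
proof -
  note [simp] = morphism2_simps[OF W V X f] ksign_closed[OF X]
  have 1: "comp_braid H V W f v w \<in> carr X" if "v \<in> carr V" "w \<in> carr W" for v w
    using that by (simp add: comp_braid_eq)
  have 2: "comp_braid H V W f (v + v') w = comp_braid H V W f v w + comp_braid H V W f v' w"
    "comp_braid H V W f (smul V c v) w = smul X c (comp_braid H V W f v w)"
    if "v \<in> carr V" "v' \<in> carr V" "w \<in> carr W" for v v' w c
    using that by (simp_all add: comp_braid_eq psum_add sum.distrib smul_psum smul_sum)
  have 3: "comp_braid H V W f v (w + w') = comp_braid H V W f v w + comp_braid H V W f v w'"
    "comp_braid H V W f v (smul W c w) = smul X c (comp_braid H V W f v w)"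
    if "v \<in> carr V" "w \<in> carr W" "w' \<in> carr W" for v w w' c
    using that by (simp_all add: comp_braid_eq psum_add sum.distrib smul_psum smul_sum)
  have 4: "comp_braid H V W f v w \<in> grade X (m + n)" if "v \<in> grade V m" "w \<in> grade W n" for v w m n
    unfolding comp_braid_hom[OF that] add.commute[of m n]
    by (intro ksign_closed[OF X] psum_in_grade[OF X] morphism2_in_grade[OF W V X f] act_in_grade that V W)
  have 5: "DD h (\<lambda>a b. comp_braid H V W f (act V a v) (act W b w)) = act X h (comp_braid H V W f v w)"
    if [simp]: "v \<in> carr V" "w \<in> carr W" for v w h
  proof -
    have *: "DD h (\<lambda>a b. RR (\<lambda>r1 r2. f (act W r2 (act W b w)) (act V r1 (act V a v)))) =
       RR (\<lambda>r1 r2. act X h (f (act W r2 w) (act V r1 v)))"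
      if [simp]: "v \<in> carr V" "w \<in> carr W" for v w
    proof -
      have "DD h (\<lambda>a b. RR (\<lambda>r1 r2. f (act W r2 (act W b w)) (act V r1 (act V a v)))) =
         RR (\<lambda>r1 r2. DD h (\<lambda>a b. f (act W (r2 * b) w) (act V (r1 * a) v)))"
        by (simp add: psum_psum[of "cop H h" "Rm H"])
      also have "\<dots> = DD h (\<lambda>a b. RR (\<lambda>r1 r2. f (act W (a * r2) w) (act V (b * r1) v)))"
        by (rule R_cop[OF X]) (simp add: lin2_def del: act_mult)
      also have "\<dots> = RR (\<lambda>r1 r2. DD h (\<lambda>a b. f (act W (a * r2) w) (act V (b * r1) v)))"
        by (rule psum_psum)
      also have "\<dots> = RR (\<lambda>r1 r2. act X h (f (act W r2 w) (act V r1 v)))"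
        by (simp add: morphism2_act[OF W V X f])
      finally show ?thesis .
    qed
    show ?thesis
      by (simp add: comp_braid_eq psum_sum act_sum ksign_psum[symmetric] *)
  qed
  show ?thesis
    unfolding HM_morphism2_def klinear_def using 1 2 3 4 5 by (simp add: psum_def)
qed

end

section \<open>Permutations acting on trilinear maps\<close>

context
  fixes V :: "('k, 'h, 'v::ab_group_add) gmod"
    and X :: "('k, 'h, 'x::ab_group_add) gmod"
begin

text \<open>Vanishing outside the carrier makes equality of trilinear maps an equality of functions,
  so that relations between the operators below can be used as rewrite rules.\<close>

definition trilinear :: "('v \<Rightarrow> 'v \<Rightarrow> 'v \<Rightarrow> 'x) \<Rightarrow> bool" where
  "trilinear G \<longleftrightarrow>
     (\<forall>b\<in>carr V. \<forall>c\<in>carr V. klinear V X (\<lambda>a. G a b c)) \<and>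
     (\<forall>a\<in>carr V. \<forall>c\<in>carr V. klinear V X (\<lambda>b. G a b c)) \<and>
     (\<forall>a\<in>carr V. \<forall>b\<in>carr V. klinear V X (\<lambda>c. G a b c)) \<and>
     (\<forall>a b c. \<not> (a \<in> carr V \<and> b \<in> carr V \<and> c \<in> carr V) \<longrightarrow> G a b c = 0)"

definition on_carr3 :: "('v \<Rightarrow> 'v \<Rightarrow> 'v \<Rightarrow> 'x) \<Rightarrow> 'v \<Rightarrow> 'v \<Rightarrow> 'v \<Rightarrow> 'x" where
  "on_carr3 F a b c = (if a \<in> carr V \<and> b \<in> carr V \<and> c \<in> carr V then F a b c else 0)"

text \<open>
  Composition of a trilinear map with, in this order, \<open>\<tau> \<otimes> id\<close>, \<open>id \<otimes> \<tau>\<close>, \<open>\<Phi>\<close>, \<open>\<Phi>\<^sup>-\<^sup>1\<close>, the braiding of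
  \<open>a \<otimes> b\<close> past \<open>c\<close> and the braiding of \<open>a\<close> past \<open>b \<otimes> c\<close>, all without the Koszul signs; those are put
  back when the maps are applied to homogeneous elements.
\<close>

definition "opS G = on_carr3 (\<lambda>a b c. RR (\<lambda>r1 r2. G (act V r2 b) (act V r1 a) c))"
definition "opT G = on_carr3 (\<lambda>a b c. RR (\<lambda>r1 r2. G a (act V r2 c) (act V r1 b)))"
definition "opPhi G = on_carr3 (\<lambda>a b c. PP (\<lambda>x y z. G (act V x a) (act V y b) (act V z c)))"
definition "opPsi G = on_carr3 (\<lambda>a b c. QQ (\<lambda>x y z. G (act V x a) (act V y b) (act V z c)))"
definition "opD G = on_carr3 (\<lambda>a b c. RR (\<lambda>r1 r2. DD r1 (\<lambda>s t. G (act V r2 c) (act V s a) (act V t b))))"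
definition "opE G = on_carr3 (\<lambda>a b c. RR (\<lambda>r1 r2. DD r2 (\<lambda>s t. G (act V s b) (act V t c) (act V r1 a))))"
text \<open>The transposition of the last two factors, transported by \<Phi> to the bracketing (a
  \<otimes> b) \<otimes> c. Together with \<open>opS\<close> it generates the action of the
  symmetric group.\<close>

definition "opU G = opPhi (opT (opPsi G))"

lemma on_carr3_app [simp]: "a \<in> carr V \<Longrightarrow> b \<in> carr V \<Longrightarrow> c \<in> carr V \<Longrightarrow> on_carr3 F a b c = F a b c"
  by (simp add: on_carr3_def)

context
  assumes V [simp]: "HM_object H V" and X [simp]: "HM_object H X"
begin

context
  fixes G
  assumes G: "trilinear G"
begin

lemma trilinear_simps:
  assumes "a \<in> carr V" "b \<in> carr V" "c \<in> carr V"
  shows "G a b c \<in> carr X"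
  "a' \<in> carr V \<Longrightarrow> G (a + a') b c = G a b c + G a' b c"
  "b' \<in> carr V \<Longrightarrow> G a (b + b') c = G a b c + G a b' c"
  "c' \<in> carr V \<Longrightarrow> G a b (c + c') = G a b c + G a b c'"
  "G (smul V k a) b c = smul X k (G a b c)"
  "G a (smul V k b) c = smul X k (G a b c)"
  "G a b (smul V k c) = smul X k (G a b c)"
  using G assms unfolding trilinear_def klinear_def by auto

lemma trilinear_lin:
  "lin H V g \<Longrightarrow> b \<in> carr V \<Longrightarrow> c \<in> carr V \<Longrightarrow> lin H X (\<lambda>x. G (g x) b c)"
  "lin H V g \<Longrightarrow> a \<in> carr V \<Longrightarrow> c \<in> carr V \<Longrightarrow> lin H X (\<lambda>x. G a (g x) c)"
  "lin H V g \<Longrightarrow> a \<in> carr V \<Longrightarrow> b \<in> carr V \<Longrightarrow> lin H X (\<lambda>x. G a b (g x))"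
  by (auto simp: lin_iff trilinear_simps)

lemma trilinear_outside: "\<not> (a \<in> carr V \<and> b \<in> carr V \<and> c \<in> carr V) \<Longrightarrow> G a b c = 0"
  using G unfolding trilinear_def by blast

end

lemma trilinear_on_carr3I:
  assumes "\<And>b c. b \<in> carr V \<Longrightarrow> c \<in> carr V \<Longrightarrow> klinear V X (\<lambda>a. F a b c)"
    "\<And>a c. a \<in> carr V \<Longrightarrow> c \<in> carr V \<Longrightarrow> klinear V X (\<lambda>b. F a b c)"
    "\<And>a b. a \<in> carr V \<Longrightarrow> b \<in> carr V \<Longrightarrow> klinear V X (\<lambda>c. F a b c)"
  shows "trilinear (on_carr3 F)"
  using assms unfolding trilinear_def klinear_def by (auto simp: on_carr3_def V)

lemma trilinear_ops [simp]:
  assumes "trilinear G"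
  shows "trilinear (opS G)" "trilinear (opT G)" "trilinear (opPhi G)" "trilinear (opPsi G)"
    "trilinear (opD G)" "trilinear (opE G)" "trilinear (opU G)"
proof -
  have *: "trilinear (opT G)" "trilinear (opPhi G)" "trilinear (opPsi G)" if "trilinear G" for G
    unfolding opT_def opPhi_def opPsi_def
    by (auto simp: trilinear_simps[OF that] intro!: trilinear_on_carr3I simp: klinear_def psum_add tsum_add smul_psum smul_tsum)
  show "trilinear (opT G)" "trilinear (opPhi G)" "trilinear (opPsi G)" using * assms by auto
  show "trilinear (opU G)" unfolding opU_def using * assms by auto
  show "trilinear (opS G)" "trilinear (opD G)" "trilinear (opE G)"
    unfolding opS_def opD_def opE_def
    by (auto simp: trilinear_simps[OF assms] intro!: trilinear_on_carr3I simp: klinear_def psum_add tsum_add smul_psum smul_tsum)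
qed

lemma trilinear_ext:
  assumes "trilinear F" "trilinear G"
    "\<And>a b c. a \<in> carr V \<Longrightarrow> b \<in> carr V \<Longrightarrow> c \<in> carr V \<Longrightarrow> F a b c = G a b c"
  shows "F = G"
proof (intro ext)
  fix a b c
  show "F a b c = G a b c"
    using assms(3)[of a b c] trilinear_outside[OF assms(1), of a b c] trilinear_outside[OF assms(2), of a b c]
    by metis
qed

lemma opS_opS: assumes [simp]: "trilinear G" shows "opS (opS G) = G"
proof (rule trilinear_ext)
  note [simp] = trilinear_simps[OF assms] trilinear_lin[OF assms]
  fix a b c assume [simp]: "a \<in> carr V" "b \<in> carr V" "c \<in> carr V"
  have "opS (opS G) a b c = RR (\<lambda>r1 r2. RR (\<lambda>s1 s2. G (act V (s2 * r1) a) (act V (s1 * r2) b) c))"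
    by (simp add: opS_def)
  also have "\<dots> = RR (\<lambda>s1 s2. RR (\<lambda>r1 r2. G (act V (s2 * r1) a) (act V (s1 * r2) b) c))"
    by (rule psum_psum)
  also have "\<dots> = G (act V 1 a) (act V 1 b) c"
    by (rule R_R21[of X "\<lambda>p q. G (act V q a) (act V p b) c"]) (simp add: lin2_def del: act_mult)
  finally show "opS (opS G) a b c = G a b c" by simp
qed simp_all

lemma opT_opT: assumes [simp]: "trilinear G" shows "opT (opT G) = G"
proof (rule trilinear_ext)
  note [simp] = trilinear_simps[OF assms] trilinear_lin[OF assms]
  fix a b c assume [simp]: "a \<in> carr V" "b \<in> carr V" "c \<in> carr V"
  have "opT (opT G) a b c = RR (\<lambda>r1 r2. RR (\<lambda>s1 s2. G a (act V (s2 * r1) b) (act V (s1 * r2) c)))"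
    by (simp add: opT_def)
  also have "\<dots> = RR (\<lambda>s1 s2. RR (\<lambda>r1 r2. G a (act V (s2 * r1) b) (act V (s1 * r2) c)))"
    by (rule psum_psum)
  also have "\<dots> = G a (act V 1 b) (act V 1 c)"
    by (rule R_R21[of X "\<lambda>p q. G a (act V q b) (act V p c)"]) (simp add: lin2_def del: act_mult)
  finally show "opT (opT G) a b c = G a b c" by simp
qed simp_all

lemma opPhi_opPsi: assumes [simp]: "trilinear G" shows "opPhi (opPsi G) = G"
proof (rule trilinear_ext)
  note [simp] = trilinear_simps[OF assms] trilinear_lin[OF assms]
  fix a b c assume [simp]: "a \<in> carr V" "b \<in> carr V" "c \<in> carr V"
  have "opPhi (opPsi G) a b c = PP (\<lambda>x y z. QQ (\<lambda>x' y' z'. G (act V (x' * x) a) (act V (y' * y) b) (act V (z' * z) c)))"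
    by (simp add: opPhi_def opPsi_def)
  also have "\<dots> = QQ (\<lambda>x' y' z'. PP (\<lambda>x y z. G (act V (x' * x) a) (act V (y' * y) b) (act V (z' * z) c)))"
    by (rule tsum_tsum)
  also have "\<dots> = G (act V 1 a) (act V 1 b) (act V 1 c)"
    by (rule phi_inv_phi[of X]) (simp add: lin3_def del: act_mult)
  finally show "opPhi (opPsi G) a b c = G a b c" by simp
qed simp_all

lemma opPsi_opPhi: assumes [simp]: "trilinear G" shows "opPsi (opPhi G) = G"
proof (rule trilinear_ext)
  note [simp] = trilinear_simps[OF assms] trilinear_lin[OF assms]
  fix a b c assume [simp]: "a \<in> carr V" "b \<in> carr V" "c \<in> carr V"
  have "opPsi (opPhi G) a b c = QQ (\<lambda>x y z. PP (\<lambda>x' y' z'. G (act V (x' * x) a) (act V (y' * y) b) (act V (z' * z) c)))"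
    by (simp add: opPhi_def opPsi_def)
  also have "\<dots> = PP (\<lambda>x' y' z'. QQ (\<lambda>x y z. G (act V (x' * x) a) (act V (y' * y) b) (act V (z' * z) c)))"
    by (rule tsum_tsum)
  also have "\<dots> = G (act V 1 a) (act V 1 b) (act V 1 c)"
    by (rule phi_phi_inv[of X]) (simp add: lin3_def del: act_mult)
  finally show "opPsi (opPhi G) a b c = G a b c" by simp
qed simp_all

text \<open>Naturality of the braiding past c: exchanging a and b before the pair crosses c is the
  same as exchanging them afterwards. The algebraic content is \<open>R_cop\<close>.\<close>

lemma opS_opD: assumes [simp]: "trilinear G" shows "opS (opD G) = opD (opT G)"
proof (rule trilinear_ext)
  note [simp] = trilinear_simps[OF assms] trilinear_lin[OF assms]
  fix a b c assume [simp]: "a \<in> carr V" "b \<in> carr V" "c \<in> carr V"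
  have "opS (opD G) a b c = RR (\<lambda>r1 r2. RR (\<lambda>s1 s2. DD s1 (\<lambda>s t. G (act V s2 c) (act V (s * r2) b) (act V (t * r1) a))))"
    by (simp add: opS_def opD_def)
  also have "\<dots> = RR (\<lambda>s1 s2. DD s1 (\<lambda>s t. RR (\<lambda>r1 r2. G (act V s2 c) (act V (s * r2) b) (act V (t * r1) a))))"
    by (rule HOL.trans[OF psum_psum], rule psum_cong, rule psum_psum)
  also have "\<dots> = RR (\<lambda>s1 s2. RR (\<lambda>r1 r2. DD s1 (\<lambda>s t. G (act V s2 c) (act V (r2 * t) b) (act V (r1 * s) a))))"
    by (rule psum_cong, rule R_cop[OF X, symmetric]) (simp add: lin2_def del: act_mult)
  also have "\<dots> = RR (\<lambda>s1 s2. DD s1 (\<lambda>s t. RR (\<lambda>r1 r2. G (act V s2 c) (act V (r2 * t) b) (act V (r1 * s) a))))"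
    by (rule psum_cong, rule psum_psum)
  also have "\<dots> = opD (opT G) a b c"
    by (simp add: opT_def opD_def)
  finally show "opS (opD G) a b c = opD (opT G) a b c" .
qed simp_all

text \<open>The hexagon for \<Delta> \<otimes> id in operator form; the leftmost associator on its
  right-hand side cancels against the \<Phi>^-1 in \<open>opPsi\<close>.\<close>

lemma opD_opPsi: assumes [simp]: "trilinear G" shows "opD (opPsi G) = opU (opS G)"
proof (rule trilinear_ext)
  note [simp] = trilinear_simps[OF assms] trilinear_lin[OF assms]
  fix a b c assume [simp]: "a \<in> carr V" "b \<in> carr V" "c \<in> carr V"
  have "opD (opPsi G) a b c = RR (\<lambda>r1 r2. DD r1 (\<lambda>s t. QQ (\<lambda>x y z. G (act V (x * r2) c) (act V (y * s) a) (act V (z * t) b))))"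
    by (simp add: opPsi_def opD_def)
  also have "\<dots> = PP (\<lambda>x y z. RR (\<lambda>p q. QQ (\<lambda>x' y' z'. RR (\<lambda>r s. PP (\<lambda>u v w. QQ (\<lambda>k l m.
      G (act V (k * (x * q * y' * s * w)) c) (act V (l * (y * p * x' * u)) a) (act V (m * (z * z' * r * v)) b))))))) "
    by (rule hexagon_left[of X "\<lambda>e f g. QQ (\<lambda>k l m. G (act V (k * g) c) (act V (l * e) a) (act V (m * f) b))"]) (simp add: lin3_def del: act_mult)
  also have "\<dots> = QQ (\<lambda>k l m. PP (\<lambda>x y z. PP (\<lambda>u v w. QQ (\<lambda>x' y' z'. RR (\<lambda>p q. RR (\<lambda>r s.
      G (act V ((k * x) * (q * y' * s * w)) c) (act V ((l * y) * (p * x' * u)) a) (act V ((m * z) * (z' * r * v)) b)))))))"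
    by (simp only: sum_norm mult.assoc) (rule tsum_cong, rule tsum_cong, rule tsum_tsum)
  also have "\<dots> = PP (\<lambda>u v w. QQ (\<lambda>x' y' z'. RR (\<lambda>p q. RR (\<lambda>r s.
      G (act V (1 * (q * y' * s * w)) c) (act V (1 * (p * x' * u)) a) (act V (1 * (z' * r * v)) b)))))"
    by (rule phi_inv_phi[of X]) (simp add: lin3_def del: act_mult)
  also have "\<dots> = PP (\<lambda>u v w. QQ (\<lambda>x' y' z'. RR (\<lambda>r s. RR (\<lambda>p q.
      G (act V (1 * (q * y' * s * w)) c) (act V (1 * (p * x' * u)) a) (act V (1 * (z' * r * v)) b)))))"
    by (rule tsum_cong, rule tsum_cong, rule psum_psum)
  also have "\<dots> = PP (\<lambda>u v w. RR (\<lambda>r s. QQ (\<lambda>x' y' z'. RR (\<lambda>p q.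
      G (act V (1 * (q * y' * s * w)) c) (act V (1 * (p * x' * u)) a) (act V (1 * (z' * r * v)) b)))))"
    by (simp only: sum_norm)
  also have "\<dots> = opU (opS G) a b c"
    by (simp add: opU_def opPhi_def opT_def opPsi_def opS_def)
  finally show "opD (opPsi G) a b c = opU (opS G) a b c" .
qed simp_all

text \<open>The hexagon for id \<otimes> \<Delta> in operator form; its rightmost \<phi>^-1 cancels
  against the \<Phi> in \<open>opPhi\<close>.\<close>

lemma opPhi_opE: assumes [simp]: "trilinear G" shows "opPhi (opE G) = opS (opU G)"
proof (rule trilinear_ext)
  note [simp] = trilinear_simps[OF assms] trilinear_lin[OF assms]
  fix a b c assume [simp]: "a \<in> carr V" "b \<in> carr V" "c \<in> carr V"
  have "opPhi (opE G) a b c = PP (\<lambda>k l m. RR (\<lambda>r1 r2. DD r2 (\<lambda>s t. G (act V (s * l) b) (act V (t * m) c) (act V (r1 * k) a))))"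
    by (simp add: opPhi_def opE_def)
  also have "\<dots> = PP (\<lambda>k l m. QQ (\<lambda>x y z. RR (\<lambda>p q. PP (\<lambda>x' y' z'. RR (\<lambda>r s. QQ (\<lambda>u v w.
      G (act V ((x * x' * s * v) * l) b) (act V ((y * q * z' * w) * m) c) (act V ((z * p * y' * r * u) * k) a)))))))"
    by (rule tsum_cong, rule hexagon_right[of X]) (simp add: lin3_def del: act_mult)
  also have "\<dots> = QQ (\<lambda>u v w. PP (\<lambda>k l m. PP (\<lambda>x' y' z'. QQ (\<lambda>x y z. RR (\<lambda>p q. RR (\<lambda>r s.
      G (act V (x * x' * s * (v * l)) b) (act V (y * q * z' * (w * m)) c) (act V (z * p * y' * r * (u * k)) a)))))))"
    by (simp only: sum_norm mult.assoc) (rule tsum_cong, rule tsum_cong, rule tsum_tsum)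
  also have "\<dots> = PP (\<lambda>x' y' z'. QQ (\<lambda>x y z. RR (\<lambda>p q. RR (\<lambda>r s.
      G (act V (x * x' * s * 1) b) (act V (y * q * z' * 1) c) (act V (z * p * y' * r * 1) a)))))"
    by (rule phi_inv_phi[of X]) (simp add: lin3_def del: act_mult)
  also have "\<dots> = PP (\<lambda>x' y' z'. QQ (\<lambda>x y z. RR (\<lambda>r s. RR (\<lambda>p q.
      G (act V (x * x' * s * 1) b) (act V (y * q * z' * 1) c) (act V (z * p * y' * r * 1) a)))))"
    by (rule tsum_cong, rule tsum_cong, rule psum_psum)
  also have "\<dots> = RR (\<lambda>r s. PP (\<lambda>x' y' z'. RR (\<lambda>p q. QQ (\<lambda>x y z.
      G (act V (x * x' * s * 1) b) (act V (y * q * z' * 1) c) (act V (z * p * y' * r * 1) a)))))"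
    by (simp only: sum_norm)
  also have "\<dots> = opS (opU G) a b c"
    by (simp add: opU_def opPhi_def opT_def opPsi_def opS_def)
  finally show "opPhi (opE G) a b c = opS (opU G) a b c" .
qed simp_all

lemma opU_opU: "trilinear G \<Longrightarrow> opU (opU G) = G"
  by (simp add: opU_def opPsi_opPhi opT_opT opPhi_opPsi)

text \<open>The hexagon factors the crossing of a pair with c into two transpositions, and
  naturality slides the exchange of a and b through that crossing. With the two involutions this
  completes the relations of the symmetric group on three letters.\<close>

lemma yang_baxter: assumes [simp]: "trilinear G" shows "opS (opU (opS G)) = opU (opS (opU G))"
proof -
  have "opS (opU (opS G)) = opD (opT (opPsi G))"
    by (simp add: opD_opPsi[symmetric] opS_opD)
  also have "\<dots> = opD (opPsi (opU G))"
    by (simp add: opU_def opPsi_opPhi)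
  also have "\<dots> = opU (opS (opU G))"
    by (simp add: opD_opPsi)
  finally show ?thesis .
qed

end

end

end

section \<open>The internal commutator\<close>

context qhopf_modules
begin

lemma HM_morphism2_diff:
  assumes V [simp]: "HM_object H V" and W [simp]: "HM_object H W" and X [simp]: "HM_object H X"
    and f: "HM_morphism2 H V W X f" and g: "HM_morphism2 H V W X g"
  shows "HM_morphism2 H V W X (\<lambda>v w. f v w - g v w)"
proof -
  note [simp] = morphism2_in_carr[OF V W X f] morphism2_in_carr[OF V W X g]
    morphism2_left[OF V W X f] morphism2_left[OF V W X g]
    morphism2_right[OF V W X f] morphism2_right[OF V W X g]
    morphism2_in_grade[OF V W X f] morphism2_in_grade[OF V W X g]
    morphism2_act[OF V W X f] morphism2_act[OF V W X g]
  show ?thesis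
    unfolding HM_morphism2_def klinear_def psum_def[symmetric] by (simp add: psum_diff)
qed

end

context triangular_qhopf
begin

context
  fixes V :: "('k, 'h, 'v::ab_group_add, 'm) gmod_scheme"
  assumes V [simp]: "HM_object H V"
begin

abbreviation "EE \<equiv> iend H V"
abbreviation "eval \<equiv> ev H V V"
abbreviation cmp (infixl "\<bullet>" 70) where "L \<bullet> M \<equiv> icomp H V V V L M"
abbreviation "br \<equiv> icommutator H V"

lemma EE [simp]: "HM_object H EE" by simp

lemmas cmp_simps [simp] = icomp_simps[OF V]

lemma HM_morphism2_icommutator: "HM_morphism2 H EE EE EE br"
proof -
  have "HM_morphism2 H EE EE EE (comp_braid H EE EE (icomp H V V V))"
    by (rule HM_morphism2_comp_braid[OF EE EE EE HM_morphism2_icomp[OF V]])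
  from HM_morphism2_diff[OF EE EE EE HM_morphism2_icomp[OF V] this]
  show ?thesis by (simp add: icommutator_def[abs_def])
qed

lemmas br_simps [simp] = morphism2_simps[OF EE EE EE HM_morphism2_icommutator]
lemmas br_act = morphism2_act[OF EE EE EE HM_morphism2_icommutator]

lemma icommutator_hom:
  assumes "L \<in> grade EE l" "M \<in> grade EE m"
  shows "br L M = L \<bullet> M - ksign (l * m) (RR (\<lambda>r1 r2. act EE r2 M \<bullet> act EE r1 L))"
  by (simp add: icommutator_def comp_braid_hom[OF EE EE EE HM_morphism2_icomp[OF V] assms])

text \<open>The one trilinear map from which nested commutators are built: each permuted or
  rebracketed product is the image of this one under the operators of the previous section.\<close>

definition "prod3 = on_carr3 EE (\<lambda>a b c. a \<bullet> b \<bullet> c)"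

lemma trilinear_prod3 [simp]: "trilinear EE EE prod3"
  unfolding prod3_def by (rule trilinear_on_carr3I) (auto simp: klinear_def)

text \<open>Associativity says that \<open>prod3\<close> is the right-bracketed product composed
  with \<Phi>; composing with \<Phi>^-1 inverts this.\<close>

lemma opPsi_prod3:
  assumes [simp]: "a \<in> carr EE" "b \<in> carr EE" "c \<in> carr EE"
  shows "opPsi EE prod3 a b c = a \<bullet> (b \<bullet> c)"
proof -
  let ?n = "on_carr3 EE (\<lambda>a b c. a \<bullet> (b \<bullet> c))"
  have tri: "trilinear EE EE ?n"
    by (rule trilinear_on_carr3I) (auto simp: klinear_def)
  have "opPhi EE ?n = prod3"
    by (rule trilinear_ext[OF EE EE trilinear_ops(3)[OF EE EE tri] trilinear_prod3])
      (simp add: opPhi_def prod3_def icomp_assoc[OF V])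
  from arg_cong[OF this, of "opPsi EE"] have "opPsi EE prod3 = ?n"
    by (simp add: opPsi_opPhi[OF EE EE tri])
  then show ?thesis by simp
qed

abbreviation "oS \<equiv> opS EE"
abbreviation "oU \<equiv> opU EE"
text \<open>Composition with \<tau> \<circ> \<Phi> and, in the next line, with \<Phi>^-1 \<circ>
  \<tau>: the two cyclic permutations of the Jacobi identity, up to Koszul signs.\<close>

abbreviation "rho G \<equiv> opPhi EE (opE EE G)"
abbreviation "sigma G \<equiv> opD EE (opPsi EE G)"

text \<open>As rewrite rules these bring every word in s = \<open>oS\<close> and u =
  \<open>oU\<close> to one of the six forms 1, s, u, su, us, sus, so identities in the group ring
  are decided by simplification.\<close>

lemma perm_simps [simp]:
  assumes "trilinear EE EE G"
  shows "trilinear EE EE (oS G)" "trilinear EE EE (oU G)"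
    "rho G = oS (oU G)" "sigma G = oU (oS G)" "oS (oS G) = G" "oU (oU G) = G"
    "oU (oS (oU G)) = oS (oU (oS G))"
  using assms by (simp_all add: trilinear_ops[OF EE EE] opPhi_opE[OF EE EE] opD_opPsi[OF EE EE] opS_opS[OF EE EE]
      opU_opU[OF EE EE] yang_baxter[OF EE EE])

lemma rho_app:
  assumes "a \<in> carr EE" "b \<in> carr EE" "c \<in> carr EE"
  shows "rho G a b c = PP (\<lambda>x y z. RR (\<lambda>r1 r2. DD r2 (\<lambda>s t.
    G (act EE s (act EE y b)) (act EE t (act EE z c)) (act EE r1 (act EE x a)))))"
  using assms by (simp add: opPhi_def opE_def del: act_mult)

lemma sigma_app:
  assumes "a \<in> carr EE" "b \<in> carr EE" "c \<in> carr EE"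
  shows "sigma G a b c = RR (\<lambda>r1 r2. DD r1 (\<lambda>s t. QQ (\<lambda>x y z.
    G (act EE x (act EE r2 c)) (act EE y (act EE s a)) (act EE z (act EE t b)))))"
  using assms by (simp add: opPsi_def opD_def del: act_mult)

lemma oS_app:
  assumes "a \<in> carr EE" "b \<in> carr EE" "c \<in> carr EE"
  shows "oS G a b c = RR (\<lambda>r1 r2. G (act EE r2 b) (act EE r1 a) c)"
  using assms by (simp add: opS_def)

lemma carr_gradeE: "L \<in> grade EE l \<Longrightarrow> L \<in> carr EE"
  by (rule grade_subset_carr[OF EE])

text \<open>Expanding the outer commutator places c in front of a product, which is right-bracketed.
  The rebracketing and the crossing of c with the pair combine to \<open>sigma\<close>, that is us,
  so up to signs the result is 1 - s - us + sus applied to \<open>prod3\<close>.\<close>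

lemma icommutator_icommutator_left:
  assumes a: "a \<in> grade EE l" and b: "b \<in> grade EE m" and c: "c \<in> grade EE n"
  shows "br (br a b) c = prod3 a b c - ksign (l * m) (oS prod3 a b c)
     - ksign ((l + m) * n) (oU (oS prod3) a b c) + ksign ((l + m) * n + l * m) (oS (oU (oS prod3)) a b c)"
proof -
  note [simp] = carr_gradeE[OF a] carr_gradeE[OF b] carr_gradeE[OF c]
  have "br a b \<in> grade EE (l + m)" using a b by simp
  note [simp] = ksign_closed[OF EE]
  have 1: "br a b \<bullet> c = prod3 a b c - ksign (l * m) (oS prod3 a b c)"
    by (simp add: icommutator_hom[OF a b] oS_app prod3_def) (simp add: ksign_def)
  have D: "opD EE (opPsi EE prod3) a' b' c = RR (\<lambda>r1 r2. act EE r2 c \<bullet> act EE r1 (a' \<bullet> b'))"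
    if [simp]: "a' \<in> carr EE" "b' \<in> carr EE" for a' b'
    by (simp add: opD_def opPsi_prod3 icomp_act[OF V])
  have "RR (\<lambda>r1 r2. act EE r2 c \<bullet> act EE r1 (br a b)) =
     sigma prod3 a b c - ksign (l * m) (oS (sigma prod3) a b c)"
  proof -
    have "oS (sigma prod3) a b c = RR (\<lambda>s1 s2. RR (\<lambda>r1 r2. act EE r2 c \<bullet> act EE r1 (act EE s2 b \<bullet> act EE s1 a)))"
      by (simp only: oS_app D carr_gradeE[OF a] carr_gradeE[OF b] carr_gradeE[OF c] act_in_carr[OF EE])
    also have "\<dots> = RR (\<lambda>r1 r2. act EE r2 c \<bullet> act EE r1 (RR (\<lambda>s1 s2. act EE s2 b \<bullet> act EE s1 a)))"
      by (subst psum_psum) simp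
    finally have "oS (sigma prod3) a b c = RR (\<lambda>r1 r2. act EE r2 c \<bullet> act EE r1 (RR (\<lambda>s1 s2. act EE s2 b \<bullet> act EE s1 a)))" .
    moreover have "RR (\<lambda>r1 r2. act EE r2 c \<bullet> act EE r1 (br a b)) =
       RR (\<lambda>r1 r2. act EE r2 c \<bullet> act EE r1 (a \<bullet> b)) -
       ksign (l * m) (RR (\<lambda>r1 r2. act EE r2 c \<bullet> act EE r1 (RR (\<lambda>s1 s2. act EE s2 b \<bullet> act EE s1 a))))"
      unfolding icommutator_hom[OF a b] by (cases "even (l * m)") (simp_all add: ksign_def psum_diff psum_add del: act_psum cmp_simps(9-))
    ultimately show ?thesis using D[of a b] by simp
  qed
  with 1 have "br (br a b) c = prod3 a b c - ksign (l * m) (oS prod3 a b c) -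
     ksign ((l + m) * n) (sigma prod3 a b c - ksign (l * m) (oS (sigma prod3) a b c))"
    using icommutator_hom[OF \<open>br a b \<in> grade EE (l + m)\<close> c] by simp
  then show ?thesis by (simp add: ksign_def)
qed

text \<open>Write s, u for \<open>oS\<close>, \<open>oU\<close>. Up to signs the three summands are
  1, su (\<open>rho\<close>) and us (\<open>sigma\<close>) times 1 - s - us + sus, applied to
  \<open>prod3\<close>, and (1 + su + us)(1 - s - us + sus) = 0 by ss = uu = 1 and usu =
  sus.\<close>

lemma icommutator_jacobi:
  assumes a: "a \<in> grade EE l" and b: "b \<in> grade EE m" and c: "c \<in> grade EE n"
  shows "br (br a b) c
        + ksign (l * (m + n))
            (PP (\<lambda>x y z. RR (\<lambda>r1 r2. DD r2 (\<lambda>s t.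
               br (br (act EE s (act EE y b)) (act EE t (act EE z c))) (act EE r1 (act EE x a))))))
        + ksign ((l + m) * n)
            (RR (\<lambda>r1 r2. DD r1 (\<lambda>s t. QQ (\<lambda>x y z.
               br (br (act EE x (act EE r2 c)) (act EE y (act EE s a))) (act EE z (act EE t b))))))
        = 0"
proof -
  note [simp] = carr_gradeE[OF a] carr_gradeE[OF b] carr_gradeE[OF c]
  have rho: "PP (\<lambda>x y z. RR (\<lambda>r1 r2. DD r2 (\<lambda>s t.
               br (br (act EE s (act EE y b)) (act EE t (act EE z c))) (act EE r1 (act EE x a))))) =
     rho prod3 a b c - ksign (m * n) (rho (oS prod3) a b c)
     - ksign ((m + n) * l) (rho (oU (oS prod3)) a b c) + ksign ((m + n) * l + m * n) (rho (oS (oU (oS prod3))) a b c)"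
    unfolding rho_app[OF carr_gradeE[OF a] carr_gradeE[OF b] carr_gradeE[OF c]]
    by (subst icommutator_icommutator_left[of _ m _ n _ l])
      (simp_all add: a b c psum_add tsum_add psum_diff tsum_diff ksign_psum ksign_tsum del: act_mult perm_simps)
  have sigma: "RR (\<lambda>r1 r2. DD r1 (\<lambda>s t. QQ (\<lambda>x y z.
               br (br (act EE x (act EE r2 c)) (act EE y (act EE s a))) (act EE z (act EE t b))))) =
     sigma prod3 a b c - ksign (n * l) (sigma (oS prod3) a b c)
     - ksign ((n + l) * m) (sigma (oU (oS prod3)) a b c) + ksign ((n + l) * m + n * l) (sigma (oS (oU (oS prod3))) a b c)"
    unfolding sigma_app[OF carr_gradeE[OF a] carr_gradeE[OF b] carr_gradeE[OF c]]
    by (subst icommutator_icommutator_left[of _ n _ l _ m])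
      (simp_all add: a b c psum_add tsum_add psum_diff tsum_diff ksign_psum ksign_tsum del: act_mult perm_simps)
  \<comment> \<open>In each of the eight parity cases every sign is a constant, and the terms cancel
    in pairs once in normal form.\<close>
  show ?thesis
    unfolding rho sigma icommutator_icommutator_left[OF a b c]
    by (cases "even l"; cases "even m"; cases "even n") (simp_all add: ksign_def)
qed

lemma icommutator_icommutator_right:
  assumes a: "a \<in> grade EE l" and b: "b \<in> grade EE m" and c: "c \<in> grade EE n"
  shows "br a (br b c) = opPsi EE prod3 a b c - ksign (m * n) (opT EE (opPsi EE prod3) a b c)
     - ksign (l * (m + n)) (opE EE prod3 a b c) + ksign (l * (m + n) + m * n) (opT EE (opE EE prod3) a b c)"
proof -
  note [simp] = carr_gradeE[OF a] carr_gradeE[OF b] carr_gradeE[OF c]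
  have bc: "br b c \<in> grade EE (m + n)" using b c by simp
  note [simp] = ksign_closed[OF EE]
  have 1: "a \<bullet> br b c = opPsi EE prod3 a b c - ksign (m * n) (opT EE (opPsi EE prod3) a b c)"
    by (simp add: icommutator_hom[OF b c] opT_def opPsi_prod3) (simp add: ksign_def)
  have e: "opE EE prod3 a b' c' = RR (\<lambda>r1 r2. act EE r2 (b' \<bullet> c') \<bullet> act EE r1 a)"
    if [simp]: "b' \<in> carr EE" "c' \<in> carr EE" for b' c'
    by (simp add: opE_def prod3_def icomp_act[OF V])
  have "opT EE (opE EE prod3) a b c = RR (\<lambda>s1 s2. RR (\<lambda>r1 r2. act EE r2 (act EE s2 c \<bullet> act EE s1 b) \<bullet> act EE r1 a))"
    by (simp only: opT_def on_carr3_app e carr_gradeE[OF a] carr_gradeE[OF b] carr_gradeE[OF c] act_in_carr[OF EE])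
  also have "\<dots> = RR (\<lambda>r1 r2. act EE r2 (RR (\<lambda>s1 s2. act EE s2 c \<bullet> act EE s1 b)) \<bullet> act EE r1 a)"
    by (subst psum_psum) simp
  finally have t: "opT EE (opE EE prod3) a b c = RR (\<lambda>r1 r2. act EE r2 (RR (\<lambda>s1 s2. act EE s2 c \<bullet> act EE s1 b)) \<bullet> act EE r1 a)" .
  have "RR (\<lambda>r1 r2. act EE r2 (br b c) \<bullet> act EE r1 a) =
       RR (\<lambda>r1 r2. act EE r2 (b \<bullet> c) \<bullet> act EE r1 a) -
       ksign (m * n) (RR (\<lambda>r1 r2. act EE r2 (RR (\<lambda>s1 s2. act EE s2 c \<bullet> act EE s1 b)) \<bullet> act EE r1 a))"
    unfolding icommutator_hom[OF b c] by (cases "even (m * n)") (simp_all add: ksign_def psum_diff psum_add del: act_psum)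
  then have "RR (\<lambda>r1 r2. act EE r2 (br b c) \<bullet> act EE r1 a) =
       opE EE prod3 a b c - ksign (m * n) (opT EE (opE EE prod3) a b c)"
    using e[of b c] t by simp
  with 1 have "br a (br b c) = opPsi EE prod3 a b c - ksign (m * n) (opT EE (opPsi EE prod3) a b c) -
     ksign (l * (m + n)) (opE EE prod3 a b c - ksign (m * n) (opT EE (opE EE prod3) a b c))"
    using icommutator_hom[OF a bc] by simp
  then show ?thesis by (simp add: ksign_def)
qed

text \<open>Composing the right-nested commutator with \<Phi> returns it to the bracketing on which
  s = \<open>oS\<close> and u = \<open>oU\<close> act. There it is 1 - u - su + sus applied to
  \<open>prod3\<close>, up to signs.\<close>

lemma phi_icommutator_icommutator:
  assumes a: "a \<in> grade EE l" and b: "b \<in> grade EE m" and c: "c \<in> grade EE n"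
  shows "PP (\<lambda>x y z. br (act EE x a) (br (act EE y b) (act EE z c))) =
     prod3 a b c - ksign (m * n) (oU prod3 a b c)
     - ksign (l * (m + n)) (oS (oU prod3) a b c) + ksign (l * (m + n) + m * n) (oS (oU (oS prod3)) a b c)"
proof -
  note [simp] = carr_gradeE[OF a] carr_gradeE[OF b] carr_gradeE[OF c]
  note ops = trilinear_ops[OF EE EE]
  have app: "opPhi EE G a b c = PP (\<lambda>x y z. G (act EE x a) (act EE y b) (act EE z c))" for G
    by (simp add: opPhi_def)
  have "opPhi EE (opT EE (opE EE prod3)) = oU (rho prod3)"
    unfolding opU_def by (simp only: opPsi_opPhi[OF EE EE ops(6)] ops(1-6) trilinear_prod3)
  then have 1: "opPhi EE (opT EE (opE EE prod3)) = oS (oU (oS prod3))" by simp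
  have 2: "opPhi EE (opT EE (opPsi EE prod3)) = oU prod3" by (simp add: opU_def)
  have "PP (\<lambda>x y z. br (act EE x a) (br (act EE y b) (act EE z c))) =
     opPhi EE (opPsi EE prod3) a b c - ksign (m * n) (opPhi EE (opT EE (opPsi EE prod3)) a b c)
     - ksign (l * (m + n)) (rho prod3 a b c) + ksign (l * (m + n) + m * n) (opPhi EE (opT EE (opE EE prod3)) a b c)"
    unfolding app
    by (subst icommutator_icommutator_right[of _ l _ m _ n])
      (simp_all add: a b c tsum_add tsum_diff ksign_tsum del: act_mult perm_simps)
  then show ?thesis by (simp add: 1 2 opPhi_opPsi[OF EE EE])
qed

text \<open>In the group ring this is 1 - s - us + sus = (1 - s)(1 - u - su + sus), with the Koszul
  signs again settled by parity.\<close>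

lemma icommutator_leibniz:
  assumes a: "a \<in> grade EE l" and b: "b \<in> grade EE m" and c: "c \<in> grade EE n"
  shows "br (br a b) c = PP (\<lambda>x y z. br (act EE x a) (br (act EE y b) (act EE z c))) -
    ksign (l * m) (RR (\<lambda>r1 r2. PP (\<lambda>x y z. br (act EE x (act EE r2 b)) (br (act EE y (act EE r1 a)) (act EE z c)))))"
proof -
  note [simp] = carr_gradeE[OF a] carr_gradeE[OF b] carr_gradeE[OF c]
  have "RR (\<lambda>r1 r2. PP (\<lambda>x y z. br (act EE x (act EE r2 b)) (br (act EE y (act EE r1 a)) (act EE z c)))) =
     oS prod3 a b c - ksign (l * n) (oS (oU prod3) a b c)
     - ksign (m * (l + n)) (oS (oS (oU prod3)) a b c) + ksign (m * (l + n) + l * n) (oS (oS (oU (oS prod3))) a b c)"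
    unfolding oS_app[OF carr_gradeE[OF a] carr_gradeE[OF b] carr_gradeE[OF c]]
    by (subst phi_icommutator_icommutator[of _ m _ l _ n])
      (simp_all add: a b c psum_add psum_diff ksign_psum[symmetric] del: act_mult perm_simps)
  then show ?thesis
    unfolding icommutator_icommutator_left[OF a b c] phi_icommutator_icommutator[OF a b c]
    by (cases "even l"; cases "even m"; cases "even n") (simp_all add: ksign_def)
qed

lemma ev_icommutator:
  assumes L: "L \<in> grade EE l" and M: "M \<in> grade EE m" and v [simp]: "v \<in> carr V"
  shows "eval (br L M) v = PP (\<lambda>x y z. eval (act EE x L) (eval (act EE y M) (act V z v))) -
    ksign (l * m) (RR (\<lambda>r1 r2. PP (\<lambda>x y z. eval (act EE x (act EE r2 M)) (eval (act EE y (act EE r1 L)) (act V z v)))))"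
proof -
  note [simp] = carr_gradeE[OF L] carr_gradeE[OF M]
  show ?thesis
    by (cases "even (l * m)") (simp_all add: icommutator_hom[OF L M] ksign_def ev_icomp[OF V])
qed

text \<open>The braiding is an involution by \<open>R_R21\<close>, so composing with it exchanges
  the two terms of the commutator.\<close>

lemma icommutator_antisym:
  assumes L: "L \<in> grade EE l" and M: "M \<in> grade EE m"
  shows "br L M = - ksign (l * m) (RR (\<lambda>r1 r2. br (act EE r2 M) (act EE r1 L)))"
proof -
  note [simp] = carr_gradeE[OF L] carr_gradeE[OF M]
  have "RR (\<lambda>r1 r2. RR (\<lambda>s1 s2. act EE s2 (act EE r1 L) \<bullet> act EE s1 (act EE r2 M))) =
    RR (\<lambda>s1 s2. RR (\<lambda>r1 r2. act EE (s2 * r1) L \<bullet> act EE (s1 * r2) M))"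
    by (subst psum_psum) simp
  also have "\<dots> = act EE 1 L \<bullet> act EE 1 M"
    by (rule R_R21[of EE "\<lambda>p q. act EE q L \<bullet> act EE p M"]) (simp add: lin2_def del: act_mult)
  finally have "RR (\<lambda>r1 r2. RR (\<lambda>s1 s2. act EE s2 (act EE r1 L) \<bullet> act EE s1 (act EE r2 M))) = L \<bullet> M"
    by simp
  then have "RR (\<lambda>r1 r2. br (act EE r2 M) (act EE r1 L)) =
      RR (\<lambda>r1 r2. act EE r2 M \<bullet> act EE r1 L) - ksign (m * l) (L \<bullet> M)"
    by (subst icommutator_hom[of _ m _ l]) (simp_all add: L M psum_diff ksign_psum[symmetric])
  then show ?thesis
    by (simp add: icommutator_hom[OF L M] mult.commute) (simp add: ksign_def)
qed

end

end

section \<open>Kernels and derivations\<close>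

context qhopf_modules
begin

context
  fixes V :: "('k, 'h, 'v::ab_group_add) gmod"
    and W :: "('k, 'h, 'w::ab_group_add, 'n) gmod_scheme"
    and g :: "'v \<Rightarrow> 'w"
  assumes V [simp]: "HM_object H V" and W [simp]: "HM_object H W" and g: "HM_morphism V W g"
begin

lemma ker_simps [simp]:
  "smul (ker_object V g) = smul V" "act (ker_object V g) = act V"
  "v \<in> grade (ker_object V g) n \<longleftrightarrow> v \<in> grade V n \<and> g v = 0"
  by (simp_all add: ker_object_def)

lemma morphism_klinear: "klinear V W g"
  using g by (simp add: HM_morphism_def)

lemma morphism_sum: "(\<And>i. i \<in> I \<Longrightarrow> x i \<in> carr V) \<Longrightarrow> g (\<Sum>i\<in>I. x i) = (\<Sum>i\<in>I. g (x i))"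
  by (induction I rule: infinite_finite_induct)
    (auto simp: klinear_zero[OF V W morphism_klinear] klinear_add[OF V W morphism_klinear])

lemma zero_in_ker: "0 \<in> grade (ker_object V g) n"
  by (simp add: klinear_zero[OF V W morphism_klinear])

lemma degs_ker: "degs (ker_object V g) \<subseteq> degs V"
proof
  fix n assume "n \<in> degs (ker_object V g)"
  then have "grade (ker_object V g) n \<noteq> {0}" by (simp add: degs_def)
  then obtain v where "v \<in> grade (ker_object V g) n" "v \<noteq> 0" using zero_in_ker[of n] by blast
  then show "n \<in> degs V" by (auto simp: degs_def)
qed

lemma sum_degs_ker:
  assumes "\<And>n. x n \<in> grade (ker_object V g) n"
  shows "(\<Sum>n\<in>degs (ker_object V g). x n) = (\<Sum>n\<in>degs V. x n)"
proof (rule sum.mono_neutral_left[OF finite_degs[OF V] degs_ker])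
  show "\<forall>n\<in>degs V - degs (ker_object V g). x n = 0"
    using assms by (auto simp: degs_def)
qed

text \<open>The kernel taken degree by degree is the whole kernel because g preserves degrees: the
  images of the components of v are the components of g v, and directness in W makes each of them
  0.\<close>

lemma carr_ker: "carr (ker_object V g) = {v \<in> carr V. g v = 0}"
proof (intro equalityI subsetI)
  fix v assume "v \<in> carr (ker_object V g)"
  then obtain x where x: "\<And>n. x n \<in> grade (ker_object V g) n" "v = (\<Sum>n\<in>degs (ker_object V g). x n)"
    unfolding carr_def by blast
  then have *: "x n \<in> carr V" "g (x n) = 0" for n using grade_subset_carr[OF V, of "x n" n] by auto
  then show "v \<in> {v \<in> carr V. g v = 0}" using x(2) by (simp add: morphism_sum)
next
  fix v assume v: "v \<in> {v \<in> carr V. g v = 0}"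
  then have [simp]: "v \<in> carr V" by simp
  have gr: "g (hcomp V n v) \<in> grade W n" for n
    using g by (simp add: HM_morphism_def)
  \<comment> \<open>A degree in only one of the two index sets contributes 0: either the image lies
    in a zero component of W, or the component of v is itself 0.\<close>
  have "(\<Sum>n\<in>degs W. g (hcomp V n v)) = (\<Sum>n\<in>degs V. g (hcomp V n v))"
  proof (rule sum.mono_neutral_cong)
    show "g (hcomp V n v) = 0" if "n \<in> degs V - degs W" for n
      using that grade_eq_zero[OF W gr] by blast
    show "g (hcomp V n v) = 0" if "n \<in> degs W - degs V" for n
      using that grade_eq_zero[OF V hcomp_in_grade[OF V \<open>v \<in> carr V\<close>], of n]
      by (simp add: klinear_zero[OF V W morphism_klinear])
  qed simp_all
  also have "\<dots> = g v"
    by (simp add: morphism_sum[symmetric] sum_hcomp[OF V])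
  finally have "g (hcomp V n v) = 0" for n
    using grade_direct[OF W gr] v by simp
  then have h: "hcomp V n v \<in> grade (ker_object V g) n" for n by simp
  have "v = (\<Sum>n\<in>degs (ker_object V g). hcomp V n v)"
    by (simp add: sum_degs_ker[OF h] sum_hcomp[OF V])
  then show "v \<in> carr (ker_object V g)"
    unfolding carr_def using h by blast
qed

lemma HM_object_ker: "HM_object H (ker_object V g)"
proof (rule HM_objectI)
  note [simp] = klinear_zero[OF V W morphism_klinear] klinear_add[OF V W morphism_klinear]
    klinear_smul[OF V W morphism_klinear]
  have [simp]: "g (act V h v) = act W h (g v)" if "v \<in> carr V" for v h
    using g that by (simp add: HM_morphism_def)
  have c: "v \<in> carr V" if "v \<in> grade V n" for v n using grade_subset_carr[OF V that] .
  show "finite (degs (ker_object V g))" using finite_subset[OF degs_ker] by simp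
  show "0 \<in> grade (ker_object V g) n" for n by (rule zero_in_ker)
  show "v + w \<in> grade (ker_object V g) n" if "v \<in> grade (ker_object V g) n" "w \<in> grade (ker_object V g) n" for n v w
    using that c[of v n] c[of w n] by simp
  show "smul (ker_object V g) k v \<in> grade (ker_object V g) n" if "v \<in> grade (ker_object V g) n" for n k v
    using that c[of v n] by simp
  show "act (ker_object V g) h v \<in> grade (ker_object V g) n" if "v \<in> grade (ker_object V g) n" for n h v
    using that c[of v n] by simp
  show "x n = 0" if "\<And>n. x n \<in> grade (ker_object V g) n" "(\<Sum>n\<in>degs (ker_object V g). x n) = 0" for x n
    using that grade_direct[OF V, of x n] by (simp add: sum_degs_ker)
qed (simp_all add: carr_ker act_add_left[OF V] smul_add_left[OF V] smul_mult[OF V] act_hsmul[OF V])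

end

section \<open>Composites of bilinear and linear morphisms\<close>

context
  fixes V :: "('k, 'h, 'v::ab_group_add, 'm) gmod_scheme"
    and W :: "('k, 'h, 'w::ab_group_add, 'n) gmod_scheme"
    and X :: "('k, 'h, 'x::ab_group_add, 'p) gmod_scheme"
    and Y :: "('k, 'h, 'y::ab_group_add, 'q) gmod_scheme"
  assumes V [simp]: "HM_object H V" and W [simp]: "HM_object H W"
    and X [simp]: "HM_object H X" and Y [simp]: "HM_object H Y"
begin

lemma HM_morphism2_comp_right:
  assumes f: "HM_morphism2 H V W X f" and g: "HM_morphism Y W g"
  shows "HM_morphism2 H V Y X (\<lambda>v y. f v (g y))"
proof -
  have lin: "klinear Y W g" using g by (simp add: HM_morphism_def)
  note [simp] = morphism2_simps[OF V W X f] klinear_in_carr[OF Y W lin] klinear_add[OF Y W lin] klinear_smul[OF Y W lin]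
  have [simp]: "g (act Y h y) = act W h (g y)" if "y \<in> carr Y" for y h
    using g that by (simp add: HM_morphism_def)
  show ?thesis
    using g unfolding HM_morphism2_def klinear_def psum_def[symmetric]
    by (simp add: HM_morphism_def morphism2_act[OF V W X f])
qed

lemma HM_morphism_comp_morphism2:
  assumes f: "HM_morphism2 H V W X f" and g: "HM_morphism X Y g"
  shows "HM_morphism2 H V W Y (\<lambda>v w. g (f v w))"
proof -
  have lin: "klinear X Y g" using g by (simp add: HM_morphism_def)
  note [simp] = morphism2_simps[OF V W X f] klinear_in_carr[OF X Y lin] klinear_add[OF X Y lin] klinear_smul[OF X Y lin]
  have *: "g (act X h x) = act Y h (g x)" if "x \<in> carr X" for x h
    using g that by (simp add: HM_morphism_def)
  show ?thesis
    using g unfolding HM_morphism2_def klinear_def psum_def[symmetric]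
    by (simp add: HM_morphism_def *[symmetric] morphism2_act[OF V W X f] klinear_psum[OF X Y lin])
qed

end

end

section \<open>Currying as a morphism, and its kernel\<close>

context quasi_hopf
begin

context
  fixes U :: "('k, 'h, 'u::ab_group_add, 'm) gmod_scheme"
    and V :: "('k, 'h, 'v::ab_group_add, 'n) gmod_scheme"
    and W :: "('k, 'h, 'w::ab_group_add, 'p) gmod_scheme"
    and f :: "'u \<Rightarrow> 'v \<Rightarrow> 'w"
  assumes U [simp]: "HM_object H U" and V [simp]: "HM_object H V" and W [simp]: "HM_object H W"
    and f: "HM_morphism2 H U V W f"
begin

lemma equivariant_family_morphism2:
  assumes u [simp]: "u \<in> carr U"
  shows "equivariant_family V W (\<lambda>p. f (act U p u))"
  unfolding equivariant_family_def
  using morphism2_left(8)[OF U V W f] morphism2_klinear(1)[OF U V W f]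
  by (auto simp: morphism2_act[OF U V W f])

lemma curry_map_act:
  "u \<in> carr U \<Longrightarrow> act (ihom H V W) h (curry_map H U V f u) = curry_map H U V f (act U h u)"
  by (simp add: curry_map_gcurry act_gcurry[OF V W equivariant_family_morphism2])

lemma HM_morphism_curry_map: "HM_morphism U (ihom H V W) (curry_map H U V f)"
proof -
  note [simp] = morphism2_simps[OF U V W f]
  note E = HM_object_ihom[OF V W]
  have grade: "curry_map H U V f u \<in> grade (ihom H V W) n" if u: "u \<in> grade U n" for u n
  proof -
    have uc: "u \<in> carr U" using grade_subset_carr[OF U u] .
    show ?thesis
      unfolding curry_map_gcurry
    proof (rule gcurry_in_grade[OF V W equivariant_family_morphism2[OF uc]])
      fix p m v assume "v \<in> grade V m"
      then show "f (act U p u) v \<in> grade W (m + n)"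
        using morphism2_in_grade[OF U V W f, of "act U p u" n v m] u by (simp add: add.commute)
    qed
  qed
  have curry_add: "curry_map H U V f (u + u') = curry_map H U V f u + curry_map H U V f u'"
    if "u \<in> carr U" "u' \<in> carr U" for u u'
    using that by (auto simp: curry_map_gcurry gcurry_def on_carr_def fun_eq_iff tsum_add)
  have smul: "curry_map H U V f (smul U c u) = smul (ihom H V W) c (curry_map H U V f u)"
    if "u \<in> carr U" for u c
    using that by (auto simp: curry_map_gcurry gcurry_def ihom_smul[OF V W] on_carr_def fun_eq_iff smul_tsum)
  have carr: "curry_map H U V f u \<in> carr (ihom H V W)" if "u \<in> carr U" for u
    using that
  proof (induction rule: carr_induct[OF U, consumes 1, case_names hom add])
    case (hom n u)
    show ?case by (rule grade_subset_carr[OF E grade[OF hom]])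
  next
    case (add u u')
    show ?case unfolding curry_add[OF add(1,2)]
      by (rule add_in_carr[OF E add(3,4)])
  qed
  show ?thesis
    unfolding HM_morphism_def klinear_def
    using carr curry_add smul grade curry_map_act by auto
qed

text \<open>Currying commutes with the action, so a vanishing curried map also vanishes after p acts
  on u, and evaluation then gives the values of f. For f the defect of the Leibniz rule this is the
  pointwise criterion for derivations.\<close>

lemma curry_map_eq_zero_iff:
  assumes u [simp]: "u \<in> carr U"
  shows "curry_map H U V f u = 0 \<longleftrightarrow> (\<forall>p. \<forall>v\<in>carr V. f (act U p u) v = 0)"
proof
  assume zero: "curry_map H U V f u = 0"
  show "\<forall>p. \<forall>v\<in>carr V. f (act U p u) v = 0"
  proof (intro allI ballI)
    fix p v assume v [simp]: "v \<in> carr V"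
    have "f (act U p u) v = ev H V W (curry_map H U V f (act U p u)) v"
      by (simp add: curry_map_gcurry ev_gcurry[OF V W equivariant_family_morphism2])
    also have "curry_map H U V f (act U p u) = 0"
      using curry_map_act[OF u, of p] zero act_zero_right[OF HM_object_ihom[OF V W], of p] by simp
    also have "ev H V W 0 v = 0"
      by (rule morphism2_left(4)[OF HM_object_ihom[OF V W] V W HM_morphism2_ev[OF V W] v])
    finally show "f (act U p u) v = 0" .
  qed
next
  assume "\<forall>p. \<forall>v\<in>carr V. f (act U p u) v = 0"
  then show "curry_map H U V f u = 0"
    by (auto simp: curry_map_gcurry gcurry_def on_carr_def fun_eq_iff simp del: act_mult)
qed

end

end

section \<open>Derivations and their Lie bracket\<close>

context triangular_qhopf
begin

context
  fixes A :: "('k, 'h, 'a::ab_group_add) galg"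
  assumes A [simp]: "HM_object H A" and mu: "HM_morphism2 H A A A (mu A)"
begin

abbreviation "EA \<equiv> iend H A"
abbreviation "brA \<equiv> icommutator H A"
abbreviation "lh \<equiv> lhat H A"
abbreviation "der_defect L a \<equiv> brA L (lh a) - lh (ev H A A L a)"

lemmas EA = HM_object_ihom[OF A A]

lemma HM_morphism_lhat: "HM_morphism A EA lh"
  unfolding lhat_def by (rule HM_morphism_curry_map[OF A A A mu])

lemma lhat_klinear: "klinear A EA lh"
  using HM_morphism_lhat by (simp add: HM_morphism_def)

lemmas lhat_simps [simp] = klinear_in_carr[OF A EA lhat_klinear] klinear_tsum[OF A EA lhat_klinear]
  klinear_psum[OF A EA lhat_klinear] klinear_diff[OF A EA lhat_klinear] klinear_uminus[OF A EA lhat_klinear]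

lemma lhat_act: "a \<in> carr A \<Longrightarrow> act EA h (lh a) = lh (act A h a)"
  using HM_morphism_lhat by (simp add: HM_morphism_def)

lemma lhat_in_grade: "a \<in> grade A n \<Longrightarrow> lh a \<in> grade EA n"
  using HM_morphism_lhat by (simp add: HM_morphism_def)

lemmas brA_simps [simp] = br_simps[OF A]

lemma HM_morphism2_der_defect: "HM_morphism2 H EA A EA der_defect"
  by (rule HM_morphism2_diff[OF EA A EA
      HM_morphism2_comp_right[OF EA EA EA A HM_morphism2_icommutator[OF A] HM_morphism_lhat]
      HM_morphism_comp_morphism2[OF EA A A EA HM_morphism2_ev[OF A A] HM_morphism_lhat]])

lemma der_eq: "der H A = ker_object EA (curry_map H EA A der_defect)"
  by (simp add: der_def)

lemmas HM_morphism_der_defect = HM_morphism_curry_map[OF EA A EA HM_morphism2_der_defect]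

lemma HM_object_der: "HM_object H (der H A)"
  unfolding der_eq by (rule HM_object_ker[OF EA HM_object_ihom[OF A EA] HM_morphism_der_defect])

lemma der_simps: "smul (der H A) = smul EA" "act (der H A) = act EA"
  by (simp_all add: der_def ker_object_def)

lemma der_grade_iff:
  "L \<in> grade (der H A) n \<longleftrightarrow> L \<in> grade EA n \<and> (\<forall>p. \<forall>a\<in>carr A. der_defect (act EA p L) a = 0)"
proof (cases "L \<in> grade EA n")
  case True
  then have "L \<in> carr EA" by (rule grade_subset_carr[OF EA])
  from curry_map_eq_zero_iff[OF EA A EA HM_morphism2_der_defect this] True show ?thesis
    by (simp add: der_eq ker_object_def)
qed (simp add: der_eq ker_object_def)

lemma der_bracket_lhat:
  assumes "L \<in> grade (der H A) n" "a \<in> carr A"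
  shows "brA (act EA p L) (lh a) = lh (ev H A A (act EA p L) a)"
  using assms der_grade_iff by auto

lemma der_act: "L \<in> grade (der H A) n \<Longrightarrow> act EA h L \<in> grade (der H A) n"
  using act_in_grade[OF HM_object_der, of L n h] by (simp add: der_simps)

text \<open>By the Leibniz form only nested brackets with \<open>lh a\<close> remain. Since
  \<open>lh\<close> is equivariant, the inner bracket is again a value of \<open>lh\<close>, so the
  outer derivation applies too; the outcome matches \<open>ev_icommutator\<close> term by
  term.\<close>

lemma icommutator_defect:
  assumes L: "L \<in> grade (der H A) l" and M: "M \<in> grade (der H A) m" and a: "a \<in> grade A n"
  shows "brA (brA L M) (lh a) = lh (ev H A A (brA L M) a)"
proof -
  have L': "L \<in> grade EA l" and M': "M \<in> grade EA m" using L M by (simp_all add: der_grade_iff)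
  have [simp]: "L \<in> carr EA" "M \<in> carr EA" "a \<in> carr A"
    using grade_subset_carr[OF EA L'] grade_subset_carr[OF EA M'] grade_subset_carr[OF A a] by simp_all
  \<comment> \<open>The acting elements x, y, z are arbitrary because the legs of \<phi> act on all
    three entries.\<close>
  have *: "brA (act EA x K) (brA (act EA y N) (act EA z (lh a))) =
     lh (ev H A A (act EA x K) (ev H A A (act EA y N) (act A z a)))"
    if K: "K \<in> grade (der H A) k" and N: "N \<in> grade (der H A) j" for x y z K N k j
  proof -
    have "K \<in> carr EA" "N \<in> carr EA"
      using K N grade_subset_carr[OF EA] by (auto simp: der_grade_iff)
    then show ?thesis
      by (simp add: lhat_act der_bracket_lhat[OF K] der_bracket_lhat[OF N])
  qed
  have **: "lh (ksign k x) = ksign k (lh x)" if "x \<in> carr A" for k x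
    using that by (simp add: ksign_def)
  show ?thesis
    unfolding icommutator_leibniz[OF A L' M' lhat_in_grade[OF a]] ev_icommutator[OF A L' M' \<open>a \<in> carr A\<close>]
    by (simp add: *[OF L M] *[OF der_act[OF M] der_act[OF L]] ** ksign_closed[OF A])
qed

text \<open>The defect must vanish after every p acts on the bracket. Equivariance distributes p
  over the two entries, which remain derivations by \<open>der_act\<close>, so the unacted case
  suffices.\<close>

lemma icommutator_der_in_grade:
  assumes L: "L \<in> grade (der H A) l" and M: "M \<in> grade (der H A) m"
  shows "brA L M \<in> grade (der H A) (l + m)"
proof -
  have L': "L \<in> grade EA l" and M': "M \<in> grade EA m" using L M by (simp_all add: der_grade_iff)
  have [simp]: "L \<in> carr EA" "M \<in> carr EA"
    using grade_subset_carr[OF EA L'] grade_subset_carr[OF EA M'] by simp_all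
  note defect = morphism2_simps[OF EA A EA HM_morphism2_der_defect]
  have zero: "der_defect (brA K N) a = 0"
    if K: "K \<in> grade (der H A) k" and N: "N \<in> grade (der H A) j" and a: "a \<in> carr A" for K N k j a
  proof -
    have "K \<in> carr EA" "N \<in> carr EA"
      using K N grade_subset_carr[OF EA] by (auto simp: der_grade_iff)
    then have KN: "brA K N \<in> carr EA" by simp
    show ?thesis
      using a
    proof (induction rule: carr_induct[OF A, consumes 1, case_names hom add])
      case (hom n a)
      then show ?case using icommutator_defect[OF K N hom] by simp
    next
      case (add a b)
      show ?case
        using morphism2_right(1)[OF EA A EA HM_morphism2_der_defect KN add(1,2)] add(3,4) by simp
    qed
  qed
  have "der_defect (act EA p (brA L M)) a = 0" if a: "a \<in> carr A" for p a
  proof -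
    have "der_defect (act EA p (brA L M)) a = der_defect (DD p (\<lambda>x y. brA (act EA x L) (act EA y M))) a"
      by (simp add: br_act[OF A])
    also have "\<dots> = DD p (\<lambda>x y. der_defect (brA (act EA x L) (act EA y M)) a)"
      by (rule morphism2_left(6)[OF EA A EA HM_morphism2_der_defect a]) simp
    also have "\<dots> = 0"
      by (simp only: zero[OF der_act[OF L] der_act[OF M] a] psum_zero)
    finally show ?thesis .
  qed
  then show ?thesis
    using L' M' by (simp add: der_grade_iff)
qed

lemma lie_algebra_der: "lie_algebra H (der H A) brA"
proof -
  let ?D = "der H A"
  note D = HM_object_der
  have grE: "L \<in> grade EA n" if "L \<in> grade ?D n" for L n using that by (simp add: der_grade_iff)
  have DE: "L \<in> carr EA" if "L \<in> carr ?D" for L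
    using that unfolding der_eq carr_ker[OF EA HM_object_ihom[OF A EA] HM_morphism_der_defect] by simp
  have carr: "brA L M \<in> carr ?D" if L: "L \<in> carr ?D" and M: "M \<in> carr ?D" for L M
    using L
  proof (induction rule: carr_induct[OF D, consumes 1, case_names hom add])
    case L: (hom l L)
    have L': "L \<in> carr EA" using DE[OF grade_subset_carr[OF D L]] .
    show ?case
      using M
    proof (induction rule: carr_induct[OF D, consumes 1, case_names hom add])
      case (hom m M)
      show ?case by (rule grade_subset_carr[OF D icommutator_der_in_grade[OF L hom]])
    next
      case (add M M')
      have "brA L (M + M') = brA L M + brA L M'" by (rule brA_simps(11)[OF L' DE[OF add(1)] DE[OF add(2)]])
      then show ?case using add_in_carr[OF D add(3,4)] by (simp only:)
    qed
  next
    case (add L L')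
    have "brA (L + L') M = brA L M + brA L' M" by (rule brA_simps(3)[OF DE[OF M] DE[OF add(1)] DE[OF add(2)]])
    then show ?case using add_in_carr[OF D add(3,4)] by (simp only:)
  qed
  have mor: "HM_morphism2 H ?D ?D ?D brA"
    unfolding HM_morphism2_def klinear_def psum_def[symmetric]
    using carr icommutator_der_in_grade by (simp add: DE der_simps br_act[OF A])
  note braid = HM_morphism2_comp_braid[OF D D D mor]
  \<comment> \<open>The braiding of \<open>?D\<close> is built from the degrees and components of
    \<open>?D\<close> itself. On homogeneous elements its formula agrees with that of
    \<open>EA\<close>, so antisymmetry is transferred there and extended by additivity.\<close>
  have anti: "brA a b = - comp_braid H ?D ?D brA a b" if "a \<in> carr ?D" and b: "b \<in> carr ?D" for a b
    using that(1)
  proof (induction rule: carr_induct[OF D, consumes 1, case_names hom add])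
    case a: (hom l a)
    have a': "a \<in> carr ?D" by (rule grade_subset_carr[OF D a])
    show ?case
      using b
    proof (induction rule: carr_induct[OF D, consumes 1, case_names hom add])
      case (hom m b)
      show ?case
        using icommutator_antisym[OF A grE[OF a] grE[OF hom]] comp_braid_hom[OF D D D mor a hom]
        by (simp add: der_simps)
    next
      case (add b b')
      show ?case
        unfolding morphism2_right(1)[OF D D D mor a' add(1,2)] morphism2_right(1)[OF D D D braid a' add(1,2)] add(3,4)
        by (rule minus_add_distrib[symmetric])
    qed
  next
    case (add a a')
    show ?case
      unfolding morphism2_left(1)[OF D D D mor b add(1,2)] morphism2_left(1)[OF D D D braid b add(1,2)] add(3,4)
      by (rule minus_add_distrib[symmetric])
  qed
  show ?thesis
    unfolding lie_algebra_def
    using D mor anti icommutator_jacobi[OF A grE grE grE]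
    by (simp add: psum_def tsum_def der_simps)
qed

end

end

theorem proposition3p7:
  fixes H :: "('k::{comm_ring,monoid_mult}, 'h::{ring,monoid_mult}) qhopf"
    and A :: "('k, 'h, 'a::ab_group_add) galg"
  assumes "triangular H"
    and "braided_commutative_algebra H A"
  shows "lie_algebra H (der H A) (icommutator H A)"
proof -
  have "quasi_hopf_algebra H"
    using assms(1) by (simp add: triangular_def quasitriangular_def Let_def)
  then interpret triangular_qhopf H
    using assms(1) by unfold_locales
  show ?thesis
    using assms(2) by (intro lie_algebra_der) (simp_all add: braided_commutative_algebra_def HM_algebra_def)
qed

end
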